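(* For each $s>1$ there exist $N\in\mathbb{N}$ and a $\frac1s$-Hölder continuous map $g:[0,1]\to\mathbb{R}^N$ such that $\Gamma_s=g([0,1])$ satisfies $\mathcal{H}^s(\Gamma_s)>0$, for $\mathcal{H}^s$-a.e. $x\in\Gamma_s$ the set $\mathrm{Tan}(\Gamma_s,x)$ contains infinitely many pairwise non-homeomorphic tangents, and moreover for $\mathcal{H}^s$-a.e. $x\in\Gamma_s$ there exists $T\in\mathrm{Tan}(\Gamma_s,x)$ with the following property: if $Q\subset\mathbb{R}^n$ (any $n$) is a self-similar set with $\dim_H Q=s$, then the set of points $z\in Q$ for which $T$ is bi-Lipschitz homeomorphic to an element of $\mathrm{Tan}(Q,z)$ is $\mathcal{H}^s$-null.
   Context: A compact set $Q\subset\mathbb{R}^n$ is self-similar if it is the attractor (unique nonempty compact $Q=\bigcup_i\phi_i(Q)$) of a finite family $\{\phi_i\}$ of contracting similarities of $\mathbb{R}^n$ satisfying the open set condition: there is a nonempty open $U$ with $\phi_i(U)\subset U$ and $\phi_i(U)\cap\phi_j(U)=\emptyset$ for $i\neq j$. For nonempty $A,B$, $\mathrm{exc}(A,B)=\sup_{a\in A}\inf_{b\in B}|a-b|$; closed sets $X_m$ converge to a closed set $X$ (Attouch–Wets) if for every $r>0$, $\mathrm{exc}(X_m\cap\overline{B}(\mathbf{0},r),X)\to0$ and $\mathrm{exc}(X\cap\overline{B}(\mathbf{0},r),X_m)\to0$. A closed set $T\ni\mathbf{0}$ is a tangent of $X$ at $x\in X$ if $r_m^{-1}(X-x)\to T$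 for some $r_m\downarrow0$; $\mathrm{Tan}(X,x)$ is the set of tangents. *)

theory Defs
  imports "HOL-Analysis.Analysis"
begin

text \<open>Euclidean space R^n is represented uniformly in n by the carrier
  eucl n = vectors nat => real vanishing from index n on, with the Euclidean
  distance dE n.  This lets the statement quantify over the dimensions N and n
  inside the formula.\<close>

definition eucl :: "nat \<Rightarrow> (nat \<Rightarrow> real) set" where
  "eucl n = {x. \<forall>i\<ge>n. x i = 0}"

definition dE :: "nat \<Rightarrow> (nat \<Rightarrow> real) \<Rightarrow> (nat \<Rightarrow> real) \<Rightarrow> real" where
  "dE n x y = sqrt (\<Sum>i<n. (x i - y i)\<^sup>2)"

definition origin :: "nat \<Rightarrow> real" where
  "origin = (\<lambda>i. 0)"

definition cballE :: "nat \<Rightarrow> real \<Rightarrow> (nat \<Rightarrow> real) set" where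
  "cballE n r = {y \<in> eucl n. dE n origin y \<le> r}"

definition openE :: "nat \<Rightarrow> (nat \<Rightarrow> real) set \<Rightarrow> bool" where
  "openE n U \<longleftrightarrow> U \<subseteq> eucl n \<and>
     (\<forall>x\<in>U. \<exists>e>0. {y \<in> eucl n. dE n x y < e} \<subseteq> U)"

definition closedE :: "nat \<Rightarrow> (nat \<Rightarrow> real) set \<Rightarrow> bool" where
  "closedE n X \<longleftrightarrow> X \<subseteq> eucl n \<and>
     (\<forall>x\<in>eucl n. (\<forall>e>0. \<exists>y\<in>X. dE n x y < e) \<longrightarrow> x \<in> X)"

definition compactE :: "nat \<Rightarrow> (nat \<Rightarrow> real) set \<Rightarrow> bool" where
  "compactE n Q \<longleftrightarrow> Q \<subseteq> eucl n \<and>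
     (\<forall>f :: nat \<Rightarrow> (nat \<Rightarrow> real). (\<forall>m. f m \<in> Q) \<longrightarrow>
        (\<exists>l\<in>Q. \<exists>\<sigma>. strict_mono \<sigma> \<and> (\<lambda>m. dE n (f (\<sigma> m)) l) \<longlonglongrightarrow> 0))"

definition diamE :: "nat \<Rightarrow> (nat \<Rightarrow> real) set \<Rightarrow> real" where
  "diamE n C = (if C = {} then 0 else Sup {dE n x y | x y. x \<in> C \<and> y \<in> C})"

text \<open>Hausdorff measure H^s on R^n (unnormalised; the normalising constant is
  irrelevant for null sets and positivity).\<close>
definition hcontent :: "nat \<Rightarrow> real \<Rightarrow> real \<Rightarrow> (nat \<Rightarrow> real) set \<Rightarrow> ennreal" where
  "hcontent n s \<delta> A = (INF C \<in> {C :: nat \<Rightarrow> (nat \<Rightarrow> real) set.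
        A \<subseteq> (\<Union>i. C i) \<and> (\<forall>i. C i \<subseteq> eucl n \<and> (\<forall>x\<in>C i. \<forall>y\<in>C i. dE n x y \<le> \<delta>))}.
      (\<Sum>i. ennreal (diamE n (C i) powr s)))"

definition hausdorffE :: "nat \<Rightarrow> real \<Rightarrow> (nat \<Rightarrow> real) set \<Rightarrow> ennreal" where
  "hausdorffE n s A = (SUP \<delta> \<in> {0<..}. hcontent n s \<delta> A)"

definition hdimE :: "nat \<Rightarrow> (nat \<Rightarrow> real) set \<Rightarrow> real" where
  "hdimE n A = Inf {t. t \<ge> 0 \<and> hausdorffE n t A = 0}"

definition excE :: "nat \<Rightarrow> (nat \<Rightarrow> real) set \<Rightarrow> (nat \<Rightarrow> real) set \<Rightarrow> ennreal" where
  "excE n A B = (SUP a \<in> A. INF b \<in> B. ennreal (dE n a b))"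

definition aw_conv :: "nat \<Rightarrow> (nat \<Rightarrow> (nat \<Rightarrow> real) set) \<Rightarrow> (nat \<Rightarrow> real) set \<Rightarrow> bool" where
  "aw_conv n Xs X \<longleftrightarrow> (\<forall>r>0.
      (\<lambda>m. excE n (Xs m \<inter> cballE n r) X) \<longlonglongrightarrow> 0 \<and>
      (\<lambda>m. excE n (X \<inter> cballE n r) (Xs m)) \<longlonglongrightarrow> 0)"

definition tangentE :: "nat \<Rightarrow> (nat \<Rightarrow> real) set \<Rightarrow> (nat \<Rightarrow> real) \<Rightarrow> (nat \<Rightarrow> real) set \<Rightarrow> bool" where
  "tangentE n X x T \<longleftrightarrow> x \<in> X \<and> closedE n T \<and> origin \<in> T \<and>
     (\<exists>r :: nat \<Rightarrow> real. (\<forall>m. r m > 0) \<and> decseq r \<and> r \<longlonglongrightarrow> 0 \<and>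
        aw_conv n (\<lambda>m. (\<lambda>y i. (y i - x i) / r m) ` X) T)"

definition TanE :: "nat \<Rightarrow> (nat \<Rightarrow> real) set \<Rightarrow> (nat \<Rightarrow> real) \<Rightarrow> (nat \<Rightarrow> real) set set" where
  "TanE n X x = {T. tangentE n X x T}"

definition contE :: "nat \<Rightarrow> nat \<Rightarrow> ((nat \<Rightarrow> real) \<Rightarrow> (nat \<Rightarrow> real)) \<Rightarrow> (nat \<Rightarrow> real) set \<Rightarrow> bool" where
  "contE n m f A \<longleftrightarrow> (\<forall>x\<in>A. \<forall>e>0. \<exists>d>0. \<forall>y\<in>A. dE n x y < d \<longrightarrow> dE m (f x) (f y) < e)"

definition homeomorphicE :: "nat \<Rightarrow> (nat \<Rightarrow> real) set \<Rightarrow> nat \<Rightarrow> (nat \<Rightarrow> real) set \<Rightarrow> bool" where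
  "homeomorphicE n A m B \<longleftrightarrow>
     (\<exists>f. bij_betw f A B \<and> contE n m f A \<and> contE m n (inv_into A f) B)"

definition bilip_homeomorphicE :: "nat \<Rightarrow> (nat \<Rightarrow> real) set \<Rightarrow> nat \<Rightarrow> (nat \<Rightarrow> real) set \<Rightarrow> bool" where
  "bilip_homeomorphicE n A m B \<longleftrightarrow>
     (\<exists>f L. L > 0 \<and> bij_betw f A B \<and>
        (\<forall>x\<in>A. \<forall>y\<in>A. dE n x y / L \<le> dE m (f x) (f y) \<and> dE m (f x) (f y) \<le> L * dE n x y))"

definition similarityE :: "nat \<Rightarrow> ((nat \<Rightarrow> real) \<Rightarrow> (nat \<Rightarrow> real)) \<Rightarrow> bool" where
  "similarityE n \<phi> \<longleftrightarrow> \<phi> ` eucl n \<subseteq> eucl n \<and>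
     (\<exists>r. 0 < r \<and> r < 1 \<and> (\<forall>x\<in>eucl n. \<forall>y\<in>eucl n. dE n (\<phi> x) (\<phi> y) = r * dE n x y))"

definition self_similarE :: "nat \<Rightarrow> (nat \<Rightarrow> real) set \<Rightarrow> bool" where
  "self_similarE n Q \<longleftrightarrow>
     (\<exists>k::nat. \<exists>\<phi> :: nat \<Rightarrow> (nat \<Rightarrow> real) \<Rightarrow> (nat \<Rightarrow> real).
        (\<forall>i<k. similarityE n (\<phi> i)) \<and>
        Q \<noteq> {} \<and> compactE n Q \<and> Q = (\<Union>i<k. \<phi> i ` Q) \<and>
        (\<exists>U. U \<noteq> {} \<and> openE n U \<and> (\<forall>i<k. \<phi> i ` U \<subseteq> U) \<and>
             (\<forall>i<k. \<forall>j<k. i \<noteq> j \<longrightarrow> \<phi> i ` U \<inter> \<phi> j ` U = {})))"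

definition holderE :: "nat \<Rightarrow> real \<Rightarrow> (real \<Rightarrow> (nat \<Rightarrow> real)) \<Rightarrow> bool" where
  "holderE N a g \<longleftrightarrow> g ` {0..1} \<subseteq> eucl N \<and>
     (\<exists>C. \<forall>t\<in>{0..1}. \<forall>u\<in>{0..1}. dE N (g t) (g u) \<le> C * \<bar>t - u\<bar> powr a)"

end

theory Submission
  imports Defs "HOL-Complex_Analysis.Great_Picard" "HOL-Library.Sublist"
begin

text \<open>Fix a large base \<open>b\<close> and let some of the \<open>b\<close>-adic cells of \<open>[0, 1]\<close> carry a loop: the vertices
  \<open>n b + 2\<close> and \<open>n b + 3\<close> inside such a cell \<open>n\<close> are identified. Collapsing all finer loops gives a position
  \<open>pos l t\<close> at every level \<open>l\<close>. A lacunary sum of bumps \<open>\<kappa>\<^sup>l hat (pos l t)\<close> with \<open>\<kappa> = b powr (- 1 / s)\<close>,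
  whose vertices are distributed over finitely many coordinates by a colouring, is a \<open>1/s\<close>-Hoelder
  curve whose only coincidences are the prescribed ones. Each cell is close to boundedly many cells of
  its level, so the image has positive measure.

  The loops live in sparse blocks of levels and there only in rare special cells, each of which carries a
  loop pattern. Almost every time lies in special cells of every pattern and every length, so each
  pattern, continued to the line without further loops, is a tangent. A line with \<open>k\<close> disjoint loops
  has exactly \<open>k\<close> points whose removal leaves three pieces, which gives infinitely many topological types.

  One more tangent is a line with loops in all \<open>b\<close>-adic cells of \<open>[0, 1]\<close> and none elsewhere. Near each
  of its points a tangent of a self-similar set \<open>Q\<close> contains a similar copy of \<open>Q\<close>; at a loop-free point
  this embeds \<open>Q\<close> into the line. By the open set condition countably many similar copies of \<open>Q\<close>
  cover the tangent, so by Baire one of them contains a whole loop, which does not embed into the line.\<close>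

section \<open>The encoded Euclidean spaces\<close>

text \<open>The two ends of a loop must have exactly equal images, while all other times must stay
  apart in proportion to \<open>kap ^ l\<close>. So a bump of level \<open>l\<close> is evaluated at
  a position in which every finer loop is already a point, and the images of the two ends agree
  summand by summand. Collapsing costs a Lipschitz factor 2 per level, hence a bump of level
  \<open>i\<close> varies by at most a multiple of \<open>(2 / b) ^ (l - i)\<close> over a cell of
  level \<open>l\<close>. Relative to \<open>kap ^ l\<close> the coarser levels then form a
  convergent geometric series if \<open>2 / b < kap\<close>, that is
  \<open>2 < b powr (1 - 1 / s)\<close>; this forces a large base. Separation needs a coordinate in
  which one level dominates: levels share coordinates only if they are congruent modulo
  \<open>D\<close>, and a large \<open>D\<close> makes the other levels small. A tangent with the
  prescribed loops and no others needs windows around special cells that contain no foreign loops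
  and grow without bound. Special cells are marked by digits 1 because these keep them away from all
  coarser loop vertices, and each block has loop-free levels on both sides of its pattern.\<close>

lemma dE_L2: "dE n x y = L2_set (\<lambda>i. x i - y i) {..<n}"
  by (simp add: dE_def L2_set_def)

lemma dE_nonneg [simp]: "0 \<le> dE n x y"
  by (simp add: dE_L2)

lemma dE_refl [simp]: "dE n x x = 0"
  by (simp add: dE_def)

lemma dE_commute: "dE n x y = dE n y x"
  by (simp add: dE_def power2_commute)

lemma dE_triangle: "dE n x z \<le> dE n x y + dE n y z"
proof -
  have "dE n x z = L2_set (\<lambda>i. (x i - y i) + (y i - z i)) {..<n}"
    by (simp add: dE_L2)
  also have "\<dots> \<le> dE n x y + dE n y z"
    unfolding dE_L2 by (rule L2_set_triangle_ineq)
  finally show ?thesis .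
qed

lemma coord_le_dE:
  assumes "i < n" shows "\<bar>x i - y i\<bar> \<le> dE n x y"
proof -
  have "(x i - y i)\<^sup>2 \<le> (\<Sum>i<n. (x i - y i)\<^sup>2)"
    using assms by (intro member_le_sum) auto
  then show ?thesis
    unfolding dE_def by (metis real_sqrt_abs real_sqrt_le_iff)
qed

lemma dE_le_sum: "dE n x y \<le> (\<Sum>i<n. \<bar>x i - y i\<bar>)"
  unfolding dE_L2 by (rule L2_set_le_sum_abs)

lemma dE_le_const:
  assumes "\<And>i. i < n \<Longrightarrow> \<bar>x i - y i\<bar> \<le> c"
  shows "dE n x y \<le> real n * c"
proof -
  have "(\<Sum>i<n. \<bar>x i - y i\<bar>) \<le> of_nat (card {..<n}) * c"
    by (rule sum_bounded_above) (use assms in auto)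
  then show ?thesis using dE_le_sum[of n x y] by simp
qed

lemma dE_eq_0:
  assumes "x \<in> eucl n" "y \<in> eucl n" "dE n x y = 0" shows "x = y"
proof
  fix i show "x i = y i"
  proof (cases "i < n")
    case True then show ?thesis using coord_le_dE[OF True, of x y] assms(3) by simp
  next
    case False then show ?thesis using assms by (simp add: eucl_def)
  qed
qed

lemma dE_scale:
  assumes "r > 0"
  shows "dE n (\<lambda>i. (x i - z i) / r) (\<lambda>i. (y i - z i) / r) = dE n x y / r"
proof -
  have "(\<Sum>i<n. ((x i - z i) / r - (y i - z i) / r)\<^sup>2) = (\<Sum>i<n. (x i - y i)\<^sup>2) / r\<^sup>2"
    by (simp add: sum_divide_distrib diff_divide_distrib[symmetric] power_divide)
  then show ?thesis using assms by (simp add: dE_def real_sqrt_divide)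
qed

lemma blowup_eucl: "x \<in> eucl n \<Longrightarrow> z \<in> eucl n \<Longrightarrow> (\<lambda>i. (x i - z i) / r) \<in> eucl n"
  by (simp add: eucl_def)

lemma origin_eucl [simp]: "origin \<in> eucl n"
  by (simp add: eucl_def origin_def)

lemma dE_tendsto_0_iff:
  "(\<lambda>m. dE n (f m) x) \<longlonglongrightarrow> 0 \<longleftrightarrow> (\<forall>i<n. (\<lambda>m. f m i) \<longlonglongrightarrow> x i)"
proof
  assume L: "(\<lambda>m. dE n (f m) x) \<longlonglongrightarrow> 0"
  show "\<forall>i<n. (\<lambda>m. f m i) \<longlonglongrightarrow> x i"
  proof (intro allI impI)
    fix i assume "i < n"
    then have "(\<lambda>m. \<bar>f m i - x i\<bar>) \<longlonglongrightarrow> 0"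
      by (intro tendsto_sandwich[OF _ _ tendsto_const L])
         (auto intro!: always_eventually coord_le_dE)
    then show "(\<lambda>m. f m i) \<longlonglongrightarrow> x i"
      by (simp add: LIM_zero_iff tendsto_rabs_zero_iff)
  qed
next
  assume R: "\<forall>i<n. (\<lambda>m. f m i) \<longlonglongrightarrow> x i"
  have "(\<lambda>m. \<Sum>i<n. \<bar>f m i - x i\<bar>) \<longlonglongrightarrow> (\<Sum>i<n. \<bar>x i - x i\<bar>)"
    using R by (intro tendsto_intros) auto
  then have "(\<lambda>m. \<Sum>i<n. \<bar>f m i - x i\<bar>) \<longlonglongrightarrow> 0" by simp
  then show "(\<lambda>m. dE n (f m) x) \<longlonglongrightarrow> 0"
    by (rule tendsto_sandwich[OF always_eventually always_eventually tendsto_const, rotated 2])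
       (simp_all add: dE_le_sum)
qed

lemma tendsto_dE:
  assumes "(\<lambda>m. dE n (f m) x) \<longlonglongrightarrow> 0" "(\<lambda>m. dE n (h m) y) \<longlonglongrightarrow> 0"
  shows "(\<lambda>m. dE n (f m) (h m)) \<longlonglongrightarrow> dE n x y"
proof -
  have c: "(\<lambda>m. f m i) \<longlonglongrightarrow> x i" "(\<lambda>m. h m i) \<longlonglongrightarrow> y i" if "i < n" for i
    using assms that unfolding dE_tendsto_0_iff by blast+
  show ?thesis
    unfolding dE_def by (intro tendsto_real_sqrt tendsto_sum tendsto_power tendsto_diff c) auto
qed

lemma dE_limit_unique:
  assumes "(\<lambda>m. dE n (f m) x) \<longlonglongrightarrow> 0" "(\<lambda>m. dE n (f m) y) \<longlonglongrightarrow> 0" "x \<in> eucl n" "y \<in> eucl n"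
  shows "x = y"
proof -
  have "(\<lambda>m. dE n (f m) (f m)) \<longlonglongrightarrow> dE n x y" by (rule tendsto_dE[OF assms(1,2)])
  then have "dE n x y = 0" by (simp add: LIMSEQ_const_iff)
  then show ?thesis using assms dE_eq_0 by blast
qed

text \<open>The diagonal argument of Arzela and Ascoli. The density hypothesis is uniform in
  \<open>m\<close> and so contains the equicontinuity. The index type is free because limits are
  taken over real times and also over points of \<open>Q\<close> paired with cylinder
  numbers.\<close>

lemma pointwise_compactness:
  fixes f :: "nat \<Rightarrow> 'a \<Rightarrow> nat \<Rightarrow> real"
  assumes S: "countable S" "S \<subseteq> X"
    and dense: "\<And>x e. x \<in> X \<Longrightarrow> e > 0 \<Longrightarrow> \<exists>y\<in>S. \<forall>m. dE n (f m x) (f m y) \<le> e"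
    and bdd: "\<And>y. y \<in> S \<Longrightarrow> \<exists>B. \<forall>m. dE n (f m y) origin \<le> B"
  obtains \<sigma> F where "strict_mono (\<sigma> :: nat \<Rightarrow> nat)" "\<And>x. x \<in> X \<Longrightarrow> F x \<in> eucl n"
    "\<And>x. x \<in> X \<Longrightarrow> (\<lambda>m. dE n (f (\<sigma> m) x) (F x)) \<longlonglongrightarrow> 0"
proof -
  obtain B where B: "\<And>y m. y \<in> S \<Longrightarrow> dE n (f m y) origin \<le> B y"
    using bdd by metis
  \<comment> \<open>\<open>function_convergent_subsequence\<close> wants one bound for all
    coordinates, so each value is divided by the bound at its own point.\<close>
  define w where "w m = (\<lambda>(y,i). f m y i / (1 + \<bar>B y\<bar>))" for m
  have "countable (S \<times> {..<n})" using S by auto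
  moreover have "norm (w m z) \<le> 1" if z: "z \<in> S \<times> {..<n}" for m z
  proof -
    obtain y i where z': "z = (y,i)" "y \<in> S" "i < n" using z by auto
    have "\<bar>f m y i - origin i\<bar> \<le> B y" using coord_le_dE[OF z'(3)] B[OF z'(2)] order_trans by blast
    then have "\<bar>f m y i\<bar> \<le> 1 + \<bar>B y\<bar>" by (simp add: origin_def)
    then show ?thesis by (simp add: w_def z'(1) field_simps)
  qed
  ultimately obtain \<sigma> where \<sigma>: "strict_mono \<sigma>"
     and lim: "\<And>z. z \<in> S \<times> {..<n} \<Longrightarrow> \<exists>l. (\<lambda>m. w (\<sigma> m) z) \<longlonglongrightarrow> l"
    using function_convergent_subsequence[of "S \<times> {..<n}" w 1] by metis
  have limS: "convergent (\<lambda>m. f (\<sigma> m) y i)" if "y \<in> S" "i < n" for y i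
  proof -
    have "(y,i) \<in> S \<times> {..<n}" using that by simp
    from lim[OF this] obtain l where "(\<lambda>m. w (\<sigma> m) (y,i)) \<longlonglongrightarrow> l" ..
    then have "(\<lambda>m. (1 + \<bar>B y\<bar>) * w (\<sigma> m) (y,i)) \<longlonglongrightarrow> (1 + \<bar>B y\<bar>) * l"
      by (intro tendsto_intros)
    moreover have "(1 + \<bar>B y\<bar>) * w (\<sigma> m) (y,i) = f (\<sigma> m) y i" for m
      by (simp add: w_def add_nonneg_eq_0_iff)
    ultimately show ?thesis by (auto simp: convergent_def)
  qed
  have conv: "convergent (\<lambda>m. f (\<sigma> m) x i)" if xX: "x \<in> X" and iN: "i < n" for x i
  proof (rule Cauchy_convergent, rule metric_CauchyI)
    fix e :: real assume "e > 0"
    then obtain y where y: "y \<in> S" "\<And>m. dE n (f m x) (f m y) \<le> e/4"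
      using dense[OF xX, of "e/4"] by auto
    have "Cauchy (\<lambda>m. f (\<sigma> m) y i)" using limS[OF y(1) iN] by (rule convergent_Cauchy)
    then obtain M where M: "\<And>m k. m \<ge> M \<Longrightarrow> k \<ge> M \<Longrightarrow> dist (f (\<sigma> m) y i) (f (\<sigma> k) y i) < e/4"
      using \<open>e > 0\<close> unfolding Cauchy_def by (meson zero_less_divide_iff zero_less_numeral)
    have c: "\<bar>f m x i - f m y i\<bar> \<le> e/4" for m
      using coord_le_dE[OF iN] y(2) order_trans by blast
    show "\<exists>M. \<forall>m\<ge>M. \<forall>k\<ge>M. dist (f (\<sigma> m) x i) (f (\<sigma> k) x i) < e"
    proof (intro exI[of _ M] allI impI)
      fix m k assume "m \<ge> M" "k \<ge> M"
      from M[OF this] c[of "\<sigma> m"] c[of "\<sigma> k"] \<open>e > 0\<close>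
      show "dist (f (\<sigma> m) x i) (f (\<sigma> k) x i) < e" unfolding dist_real_def by linarith
    qed
  qed
  define F where "F x i = (if i < n then lim (\<lambda>m. f (\<sigma> m) x i) else 0)" for x i
  show ?thesis
  proof
    show "strict_mono \<sigma>" by fact
    show "F x \<in> eucl n" for x by (simp add: F_def eucl_def)
    show "(\<lambda>m. dE n (f (\<sigma> m) x) (F x)) \<longlonglongrightarrow> 0" if "x \<in> X" for x
      unfolding dE_tendsto_0_iff F_def using conv[OF that] by (simp add: convergent_LIMSEQ_iff)
  qed
qed

text \<open>Bolzano-Weierstrass, as the case of a one-point index set.\<close>

lemma bounded_seq_convergent:
  assumes "\<And>m. dE n (f m) origin \<le> B"
  obtains \<sigma> l where "strict_mono (\<sigma> :: nat \<Rightarrow> nat)" "l \<in> eucl n" "(\<lambda>m. dE n (f (\<sigma> m)) l) \<longlonglongrightarrow> 0"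
proof -
  have "\<exists>\<sigma> F. strict_mono \<sigma> \<and> F () \<in> eucl n \<and> (\<lambda>m. dE n (f (\<sigma> m)) (F ())) \<longlonglongrightarrow> 0"
  proof (rule pointwise_compactness[where S = "{()}" and X = "{()}" and f = "\<lambda>m _. f m" and n = n])
    fix x :: unit and e :: real assume "e > 0"
    then show "\<exists>y\<in>{()}. \<forall>m. dE n (f m) (f m) \<le> e" by simp
  next
    fix y :: unit show "\<exists>B. \<forall>m. dE n (f m) origin \<le> B" using assms by blast
  qed auto
  then show thesis using that by blast
qed

lemma compactE_bounded:
  assumes "compactE n Q"
  obtains B where "\<And>x. x \<in> Q \<Longrightarrow> dE n x origin \<le> B"
proof -
  have "\<exists>B. \<forall>x\<in>Q. dE n x origin \<le> B"
  proof (rule ccontr)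
    assume "\<nexists>B. \<forall>x\<in>Q. dE n x origin \<le> B"
    then have "\<exists>x\<in>Q. dE n x origin > real m" for m by (meson not_le)
    then obtain f where f: "\<And>m. f m \<in> Q" "\<And>m. dE n (f m) origin > real m" by metis
    then obtain l \<sigma> where l: "l \<in> Q" "strict_mono \<sigma>" "(\<lambda>m. dE n (f (\<sigma> m)) l) \<longlonglongrightarrow> 0"
      using assms unfolding compactE_def by meson
    then obtain m0 where "\<And>m. m \<ge> m0 \<Longrightarrow> dE n (f (\<sigma> m)) l < 1"
      by (metis (no_types, lifting) order_tendstoD(2) eventually_sequentially zero_less_one)
    moreover obtain k where k: "real k > 1 + dE n l origin" using reals_Archimedean2 by blast
    ultimately have "dE n (f (\<sigma> (max m0 k))) origin < 1 + dE n l origin"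
      using dE_triangle[of n "f (\<sigma> (max m0 k))" origin l] by (meson add_less_cancel_right le_less_trans max.cobounded1)
    moreover have "real (max m0 k) \<le> real (\<sigma> (max m0 k))" using seq_suble[OF l(2)] by simp
    ultimately show False using f(2)[of "\<sigma> (max m0 k)"] k by simp
  qed
  then show thesis using that by blast
qed

section \<open>Vertex identifications\<close>

locale loops =
  fixes b :: nat and lam :: "nat \<Rightarrow> nat \<Rightarrow> bool"
  assumes b6: "6 \<le> b"
begin

lemma b_pos [simp]: "0 < b" using b6 by simp

lemma digit:
  assumes "j < b"
  shows "(n * b + j) div b = n" "(n * b + j) mod b = j" "0 < j \<Longrightarrow> \<not> b dvd n * b + j"
proof -
  show "(n * b + j) div b = n" "(n * b + j) mod b = j" using assms by simp_all
  then show "0 < j \<Longrightarrow> \<not> b dvd n * b + j" by (simp add: dvd_eq_mod_eq_0)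
qed

lemma digit23:
  "(n * b + 2) div b = n" "(n * b + 3) div b = n" "(n * b + 2) mod b = 2" "(n * b + 3) mod b = 3"
  "\<not> b dvd n * b + 2" "\<not> b dvd n * b + 3"
  using digit[of 2 n] digit[of 3 n] b6 by simp_all

text \<open>The value of \<open>rep l\<close> is the left one of two identified vertices of level \<open>l\<close>, and \<open>lam l n\<close> puts a
  loop into the cell \<open>n\<close> of level \<open>l\<close>.\<close>

primrec rep :: "nat \<Rightarrow> nat \<Rightarrow> nat" where
  "rep 0 = (\<lambda>N. N)"
| "rep (Suc l) = (\<lambda>N. if b dvd N then b * rep l (N div b)
     else if N mod b = 3 \<and> lam l (N div b) then N - 1 else N)"

text \<open>The end vertices of the cell \<open>A\<close> are \<open>A\<close> and
  \<open>Suc A\<close>. Adjacency is closeness on the curve in discrete form: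
  \<open>curve_upper\<close> and \<open>curve_lower\<close> compare it with the distance
  \<open>kap ^ l\<close>.\<close>

definition adj :: "nat \<Rightarrow> nat \<Rightarrow> nat \<Rightarrow> bool" where
  "adj l A B \<longleftrightarrow> (\<exists>v\<in>{A, Suc A}. \<exists>w\<in>{B, Suc B}. rep l v = rep l w)"

lemma rep_mult: "rep (Suc l) (b * N) = b * rep l N"
  by simp

declare rep.simps(2) [simp del]

lemma rep_mult_pow: "rep (l + j) (b ^ j * N) = b ^ j * rep l N"
proof (induction j)
  case (Suc j)
  have "rep (l + Suc j) (b ^ Suc j * N) = rep (Suc (l + j)) (b * (b ^ j * N))"
    by (simp add: mult.assoc)
  also have "\<dots> = b ^ Suc j * rep l N"
    unfolding rep_mult Suc.IH by simp
  finally show ?case .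
qed simp

lemma rep_loop:
  assumes "lam l n"
  shows "rep (Suc l) (n * b + 3) = n * b + 2" "rep (Suc l) (n * b + 2) = n * b + 2"
  using assms by (simp_all only: rep.simps digit23 if_False if_True simp_thms) simp

lemma rep_nondvd:
  assumes "\<not> b dvd v"
  shows "\<not> b dvd rep (Suc l) v" "rep (Suc l) v div b = v div b"
    "rep (Suc l) v = v \<or> lam l (v div b) \<and> v = v div b * b + 3 \<and> rep (Suc l) v = v div b * b + 2"
proof -
  have d: "v div b * b + v mod b = v" by simp
  have "\<not> b dvd rep (Suc l) v \<and> rep (Suc l) v div b = v div b \<and>
     (rep (Suc l) v = v \<or> lam l (v div b) \<and> v = v div b * b + 3 \<and> rep (Suc l) v = v div b * b + 2)"
  proof (cases "v mod b = 3 \<and> lam l (v div b)")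
    case True
    define n where "n = v div b"
    have v: "v = n * b + 3" using True d by (simp add: n_def)
    have l: "lam l n" using True n_def by blast
    show ?thesis unfolding v rep_loop(1)[OF l] digit23 using l digit23 by auto
  next
    case False then show ?thesis using assms by (auto simp: rep.simps(2))
  qed
  then show "\<not> b dvd rep (Suc l) v" "rep (Suc l) v div b = v div b"
    "rep (Suc l) v = v \<or> lam l (v div b) \<and> v = v div b * b + 3 \<and> rep (Suc l) v = v div b * b + 2"
    by blast+
qed

lemma rep_Suc_eqD:
  assumes "rep (Suc l) v = rep (Suc l) w"
  shows "(\<exists>v' w'. v = b * v' \<and> w = b * w' \<and> rep l v' = rep l w') \<or>
     (\<not> b dvd v \<and> \<not> b dvd w \<and> v div b = w div b \<and>
       (v = w \<or> (\<exists>n. lam l n \<and> (v = n * b + 2 \<and> w = n * b + 3 \<or> v = n * b + 3 \<and> w = n * b + 2))))"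
proof (cases "b dvd v")
  case True
  then obtain v' where v': "v = b * v'" by auto
  then have "b dvd rep (Suc l) w" using assms by (metis dvd_triv_left rep_mult)
  then have "b dvd w" using rep_nondvd(1) by blast
  then obtain w' where w': "w = b * w'" by auto
  have "b * rep l v' = b * rep l w'" using assms unfolding v' w' rep_mult .
  then have "rep l v' = rep l w'" using b6 by simp
  then show ?thesis using v' w' by blast
next
  case False
  then have w: "\<not> b dvd w" using assms rep_nondvd(1) by (metis dvd_triv_left rep_mult dvdE)
  have eq: "v div b = w div b" using rep_nondvd(2)[OF False] rep_nondvd(2)[OF w] assms by metis
  show ?thesis
    using False w eq rep_nondvd(3)[OF False, of l] rep_nondvd(3)[OF w, of l] assms by metis
qed

text \<open>Dividing by \<open>b\<close> as long as possible leads from two identified vertices to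
  the single loop that causes it. The explicit form is what the later digit arguments work
  with.\<close>

lemma rep_pair:
  assumes "rep l v = rep l w" "v < w"
  shows "\<exists>i<l. \<exists>n. lam i n \<and> v = (n * b + 2) * b ^ (l - Suc i) \<and> w = (n * b + 3) * b ^ (l - Suc i)"
  using assms
proof (induction l arbitrary: v w)
  case (Suc l)
  from rep_Suc_eqD[OF Suc.prems(1)] show ?case
  proof (elim disjE exE conjE)
    fix v' w' assume vw: "v = b * v'" "w = b * w'" "rep l v' = rep l w'"
    then have "v' < w'" using Suc.prems(2) by simp
    from Suc.IH[OF vw(3) this] obtain i n where
      "i < l" "lam i n" "v' = (n * b + 2) * b ^ (l - Suc i)" "w' = (n * b + 3) * b ^ (l - Suc i)"
      by blast
    note i = this
    have p: "b ^ (Suc l - Suc i) = b * b ^ (l - Suc i)"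
      by (metis Suc_diff_Suc diff_Suc_Suc power_Suc i(1))
    have "v = (n * b + 2) * b ^ (Suc l - Suc i)" "w = (n * b + 3) * b ^ (Suc l - Suc i)"
      unfolding p vw(1,2) i(3,4) by (rule mult.left_commute)+
    then show ?thesis using i(1,2) less_SucI by blast
  next
    fix n assume "lam l n" "v = n * b + 2" "w = n * b + 3"
    then have "l < Suc l \<and> lam l n \<and> v = (n * b + 2) * b ^ (Suc l - Suc l) \<and> w = (n * b + 3) * b ^ (Suc l - Suc l)"
      unfolding diff_self_eq_0 power_0 mult_1_right by (intro conjI lessI)
    then show ?thesis by (intro exI[of _ l] exI[of _ n] conjI) (elim conjE, assumption)+
  next
    assume "v = w" then show ?thesis using Suc.prems(2) by blast
  next
    fix n assume "v = n * b + 3" "w = n * b + 2" then show ?thesis using Suc.prems(2) by linarith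
  qed
qed simp

text \<open>Loop vertices end in the digits 2 and 3, so they belong to no coarser level and to one
  loop only; identifications cannot chain.\<close>

lemma rep_class: "finite {w. rep l w = rep l v} \<and> card {w. rep l w = rep l v} \<le> 2"
proof (induction l arbitrary: v)
  case (Suc l)
  show ?case
  proof (cases "b dvd v")
    case True
    then obtain v' where v': "v = b * v'" by auto
    have "{w. rep (Suc l) w = rep (Suc l) v} \<subseteq> (\<lambda>w. b * w) ` {w. rep l w = rep l v'}"
    proof
      fix w assume "w \<in> {w. rep (Suc l) w = rep (Suc l) v}"
      then have "rep (Suc l) w = rep (Suc l) v" by blast
      from rep_Suc_eqD[OF this] True v' b6 show "w \<in> (\<lambda>w. b * w) ` {w. rep l w = rep l v'}" by auto
    qed
    moreover have "finite ((\<lambda>w. b * w) ` {w. rep l w = rep l v'})"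
      "card ((\<lambda>w. b * w) ` {w. rep l w = rep l v'}) \<le> 2"
      using Suc.IH[of v'] card_image_le[of "{w. rep l w = rep l v'}" "\<lambda>w. b * w"] by auto
    ultimately show ?thesis by (meson card_mono finite_subset le_trans)
  next
    case False
    have "{w. rep (Suc l) w = rep (Suc l) v} \<subseteq> {v div b * b + 2, v div b * b + 3} \<or>
          {w. rep (Suc l) w = rep (Suc l) v} \<subseteq> {v}"
    proof (rule ccontr)
      assume "\<not> ?thesis"
      then obtain w1 w2 where w: "rep (Suc l) w1 = rep (Suc l) v" "w1 \<noteq> v"
         "rep (Suc l) w2 = rep (Suc l) v" "w2 \<notin> {v div b * b + 2, v div b * b + 3}" by blast
      from rep_Suc_eqD[OF w(1)] False w(2) obtain n where n: "v = n * b + 2 \<or> v = n * b + 3" by auto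
      then have vn: "v div b = n" using digit23 by metis
      from rep_Suc_eqD[OF w(3)] False consider "w2 = v" | m where "v = m * b + 2 \<and> w2 = m * b + 3 \<or> v = m * b + 3 \<and> w2 = m * b + 2"
        by auto
      then show False
      proof cases
        case 1 then show False using n vn w(4) by auto
      next
        case (2 m)
        then have "v div b = m" using digit23 by metis
        then show False using 2 w(4) by auto
      qed
    qed
    moreover have "card {v div b * b + 2, v div b * b + 3} \<le> 2" "card {v} \<le> 2" by (auto simp: card_insert_if)
    ultimately show ?thesis
      by (meson card_mono finite.emptyI finite.insertI finite_subset le_trans)
  qed
qed simp

lemma adj_refl [simp]: "adj l A A"
  by (auto simp: adj_def)

lemma adj_sym: "adj l A B \<Longrightarrow> adj l B A"
  unfolding adj_def by metis

lemma card_UN_bound: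
  assumes "finite I" "card I \<le> p" "\<And>i. i \<in> I \<Longrightarrow> finite (F i) \<and> card (F i) \<le> q"
  shows "finite (\<Union>i\<in>I. F i) \<and> card (\<Union>i\<in>I. F i) \<le> p * q"
proof -
  have "card (\<Union>i\<in>I. F i) \<le> (\<Sum>i\<in>I. card (F i))" using assms by (intro card_UN_le) auto
  also have "\<dots> \<le> card I * q" using sum_bounded_above[of I "\<lambda>i. card (F i)" q] assms by auto
  also have "\<dots> \<le> p * q" using assms by simp
  finally show ?thesis using assms by auto
qed

lemma card_pair_le: "finite {x, y} \<and> card {x, y} \<le> 2"
  by (auto simp: card_insert_if)

text \<open>Two end vertices, at most two vertices in each class, two cells at each vertex.\<close>

lemma adj_finite: "finite {B. adj l A B} \<and> card {B. adj l A B} \<le> 8"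
proof -
  define V where "V = (\<Union>v\<in>{A, Suc A}. \<Union>w\<in>{w. rep l w = rep l v}. {w, w - 1})"
  have "{B. adj l A B} \<subseteq> V"
    unfolding adj_def V_def by fastforce
  moreover have "finite V \<and> card V \<le> 2 * (2 * 2)" unfolding V_def
    by (intro card_UN_bound card_pair_le[THEN conjunct1] card_pair_le[THEN conjunct2] card_pair_le
        rep_class[THEN conjunct1] rep_class[THEN conjunct2])
  ultimately show ?thesis using card_mono[of V "{B. adj l A B}"] finite_subset[of _ V] by simp
qed

text \<open>The pairs that may need different colours: if two times are adjacent at level
  \<open>l\<close> but not at level \<open>Suc l\<close>, the ends of their cells of level
  \<open>Suc l\<close> are related in this way.\<close>

definition near_vertices :: "nat \<Rightarrow> nat \<Rightarrow> nat \<Rightarrow> bool" where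
  "near_vertices l v w \<longleftrightarrow> (\<exists>A B. v \<in> {A, Suc A} \<and> w \<in> {B, Suc B} \<and> adj l (A div b) (B div b))"

lemma near_vertices_sym: "near_vertices l v w \<Longrightarrow> near_vertices l w v"
  unfolding near_vertices_def using adj_sym by blast

text \<open>Degree bound for the conflict graph on classes: 2 vertices in a class, 2 cells at each,
  8 cells adjacent to the parent, \<open>b\<close> children of each and 2 ends of each
  child.\<close>

lemma near_reps_finite:
  "finite {rep (Suc l) w | v w. rep (Suc l) v = n \<and> near_vertices l v w} \<and>
   card {rep (Suc l) w | v w. rep (Suc l) v = n \<and> near_vertices l v w} \<le> 64 * b"
proof (cases "\<exists>v. rep (Suc l) v = n")
  case False
  then have "{rep (Suc l) w | v w. rep (Suc l) v = n \<and> near_vertices l v w} = {}" by auto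
  then show ?thesis by (simp only: finite.emptyI card.empty) simp
next
  case True
  then obtain v0 where v0: "n = rep (Suc l) v0" by blast
  define V where "V = (\<Union>v\<in>{v. rep (Suc l) v = rep (Suc l) v0}. \<Union>A\<in>{v, v - 1}.
      \<Union>B'\<in>{B. adj l (A div b) B}. \<Union>j\<in>{..<b}. {B' * b + j, Suc (B' * b + j)})"
  have "{w | v w. rep (Suc l) v = n \<and> near_vertices l v w} \<subseteq> V"
  proof clarify
    fix v w assume v: "n = rep (Suc l) v" "near_vertices l v w"
    then obtain A B where AB: "v \<in> {A, Suc A}" "w \<in> {B, Suc B}" "adj l (A div b) (B div b)"
      unfolding near_vertices_def by blast
    have "w \<in> {B div b * b + B mod b, Suc (B div b * b + B mod b)}"
      using AB(2) by simp
    then have "w \<in> (\<Union>j\<in>{..<b}. {B div b * b + j, Suc (B div b * b + j)})"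
      by (intro UN_I[of "B mod b"]) auto
    moreover have "A \<in> {v, v - 1}" using AB(1) by auto
    ultimately show "w \<in> V" unfolding V_def using v v0 AB(3) by blast
  qed
  moreover have "finite V \<and> card V \<le> 2 * (2 * (8 * (b * 2)))"
    unfolding V_def
    by (intro card_UN_bound card_pair_le[THEN conjunct1] card_pair_le[THEN conjunct2] card_pair_le
        rep_class[THEN conjunct1] rep_class[THEN conjunct2] adj_finite[THEN conjunct1] adj_finite[THEN conjunct2])
      auto
  ultimately have V: "finite V" "card V \<le> 64 * b"
    "{rep (Suc l) w | v w. rep (Suc l) v = n \<and> near_vertices l v w} \<subseteq> rep (Suc l) ` V" by auto
  then show ?thesis by (meson card_image_le card_mono finite_imageI finite_subset le_trans)
qed

end

text \<open>Colour in increasing order: at \<open>n\<close> the earlier conflicting numbers occupy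
  fewer than \<open>K\<close> colours.\<close>

lemma greedy_colouring:
  fixes R :: "nat \<Rightarrow> nat \<Rightarrow> bool"
  assumes "\<And>n. card {m. m < n \<and> R m n} < K"
  shows "\<exists>c. \<forall>n. c n < K \<and> (\<forall>m<n. R m n \<longrightarrow> c m \<noteq> c n)"
proof -
  have "\<exists>c. \<forall>n. c n < K \<and> (\<forall>m<n. R m n \<longrightarrow> c m \<noteq> (c n :: nat))"
  proof (rule dependent_wf_choice[OF wf_less])
    fix f g :: "nat \<Rightarrow> nat" and x r
    assume "\<And>z. (z, x) \<in> {(x, y). x < y} \<Longrightarrow> f z = g z"
    then show "(r < K \<and> (\<forall>m<x. R m x \<longrightarrow> f m \<noteq> r)) = (r < K \<and> (\<forall>m<x. R m x \<longrightarrow> g m \<noteq> r))" by auto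
  next
    fix x and f :: "nat \<Rightarrow> nat"
    have "card (f ` {m. m < x \<and> R m x}) < card {..<K}"
      using card_image_le[of "{m. m < x \<and> R m x}" f] assms[of x] by simp
    then have "\<not> {..<K} \<subseteq> f ` {m. m < x \<and> R m x}"
      using card_mono[of "f ` {m. m < x \<and> R m x}" "{..<K}"] by auto
    then show "\<exists>r. r < K \<and> (\<forall>m<x. R m x \<longrightarrow> f m \<noteq> r)" by auto
  qed
  then show ?thesis .
qed

context loops
begin

lemma colouring_exists:
  "\<exists>col. (\<forall>l v. col l v < 64 * b + 1) \<and>
     (\<forall>l v w. rep l v = rep l w \<longrightarrow> col l v = (col l w :: nat)) \<and>
     (\<forall>l v w. near_vertices l v w \<longrightarrow> rep (Suc l) v \<noteq> rep (Suc l) w \<longrightarrow> col (Suc l) v \<noteq> col (Suc l) w)"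
proof -
  define R where "R l m n \<longleftrightarrow> (\<exists>v w. rep (Suc l) v = n \<and> rep (Suc l) w = m \<and> near_vertices l v w)" for l m n
  have "\<exists>c. \<forall>n. c n < 64 * b + 1 \<and> (\<forall>m<n. R l m n \<longrightarrow> c m \<noteq> (c n :: nat))" for l
  proof (rule greedy_colouring)
    fix n
    have "{m. m < n \<and> R l m n} \<subseteq> {rep (Suc l) w | v w. rep (Suc l) v = n \<and> near_vertices l v w}"
      unfolding R_def by blast
    then have "card {m. m < n \<and> R l m n} \<le> 64 * b"
      using near_reps_finite[of l n] by (meson card_mono le_trans)
    then show "card {m. m < n \<and> R l m n} < 64 * b + 1" by simp
  qed
  then obtain c :: "nat \<Rightarrow> nat \<Rightarrow> nat" where c: "\<And>l n. c l n < 64 * b + 1" "\<And>l n m. m < n \<Longrightarrow> R l m n \<Longrightarrow> c l m \<noteq> c l n"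
    by metis
  have c': "c l (rep (Suc l) v) \<noteq> c l (rep (Suc l) w)"
    if "near_vertices l v w" "rep (Suc l) v \<noteq> rep (Suc l) w" for l v w
  proof (cases "rep (Suc l) v < rep (Suc l) w")
    case True
    then show ?thesis using c(2)[OF True] near_vertices_sym[OF that(1)] unfolding R_def by blast
  next
    case False
    then have lt: "rep (Suc l) w < rep (Suc l) v" using that by simp
    then show ?thesis using c(2)[OF lt, of l] that(1) unfolding R_def by metis
  qed
  \<comment> \<open>Colours are read off the class representative, so identified vertices agree. The
    colouring \<open>c l\<close> serves level \<open>Suc l\<close>; level 0 has nothing to separate
    and takes \<open>c 0\<close> by truncated subtraction.\<close>
  show ?thesis
    by (rule exI[of _ "\<lambda>l v. c (l - 1) (rep l v)"]) (use c(1) c' in simp)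
qed

section \<open>Collapsing the finer loops\<close>

lemma b_nz [simp]: "b \<noteq> 0" using b6 by simp

text \<open>The point \<open>-10\<close> keeps the set nonempty, because \<open>infdist x {} = 0\<close>.\<close>

definition loop_tips :: "nat \<Rightarrow> real set" where
  "loop_tips l = insert (-10) ((\<lambda>n. real (n * b + 3)) ` {n. lam l n})"

text \<open>For a cell \<open>n\<close> with a loop the map is constant on
  \<open>[n b + 2, n b + 3]\<close> and has slope 2 on \<open>[n b + 3, n b + 4]\<close>, which
  makes up for the lost length; elsewhere on the nonnegative reals it is the identity. This slope is
  the factor 2 in \<open>gam\<close>.\<close>

definition collapse :: "nat \<Rightarrow> real \<Rightarrow> real" where
  "collapse l x = x - max 0 (1 - infdist x (loop_tips l))"

lemma infdist_lip: "\<bar>infdist x A - infdist y A\<bar> \<le> \<bar>x - y\<bar>" for x y :: real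
  using infdist_triangle[of x A y] infdist_triangle[of y A x] by (auto simp: dist_real_def abs_minus_commute)

lemma tent_lip: "\<bar>max 0 (1 - infdist x A) - max 0 (1 - infdist y A)\<bar> \<le> \<bar>x - y\<bar>" for x y :: real
proof -
  have "\<bar>max 0 (1 - p) - max 0 (1 - q)\<bar> \<le> \<bar>p - q\<bar>" for p q :: real by (auto simp: max_def)
  then show ?thesis using infdist_lip order_trans by blast
qed

lemma infdist_ge: "A \<noteq> {} \<Longrightarrow> (\<And>a. a \<in> A \<Longrightarrow> c \<le> dist x a) \<Longrightarrow> c \<le> infdist x A" for x :: real
  by (simp add: infdist_def cINF_greatest)

lemma collapse_lip: "\<bar>collapse l x - collapse l y\<bar> \<le> 2 * \<bar>x - y\<bar>"
proof -
  have "\<bar>x - p - (y - q)\<bar> \<le> 2 * \<bar>x - y\<bar>" if "\<bar>p - q\<bar> \<le> \<bar>x - y\<bar>" for p q :: real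
    using that by (smt (verit))
  then show ?thesis using tent_lip unfolding collapse_def by blast
qed

lemma collapse_mono: "x \<le> y \<Longrightarrow> collapse l x \<le> collapse l y"
  using tent_lip[of x "loop_tips l" y] unfolding collapse_def by linarith

lemma collapse_near: "\<bar>collapse l x - x\<bar> \<le> 1"
  using infdist_nonneg[of x "loop_tips l"] unfolding collapse_def by linarith

text \<open>The tents have radius 1, so the tip is the only integer that is moved.\<close>

lemma collapse_nat:
  "collapse l (real N) = real (if N mod b = 3 \<and> lam l (N div b) then N - 1 else N)"
proof (cases "N mod b = 3 \<and> lam l (N div b)")
  case True
  then have "N = N div b * b + 3" by (metis div_mult_mod_eq)
  then have "real N = real (N div b * b + 3)" by simp
  then have "real N \<in> loop_tips l" using True unfolding loop_tips_def
    by (intro insertI2 image_eqI[of _ _ "N div b"]) auto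
  moreover have "N \<noteq> 0" using True by (intro notI) simp
  ultimately show ?thesis using True by (simp add: collapse_def of_nat_diff)
next
  case False
  have "1 \<le> infdist (real N) (loop_tips l)"
  proof (rule infdist_ge)
    show "loop_tips l \<noteq> {}" by (simp add: loop_tips_def)
  next
    fix y assume "y \<in> loop_tips l"
    then consider "y = -10" | n where "lam l n" "y = real (n * b + 3)" by (auto simp: loop_tips_def)
    then show "1 \<le> dist (real N) y"
    proof cases
      case 1 then show ?thesis by (simp add: dist_real_def)
    next
      case (2 n)
      have "N \<noteq> n * b + 3" using False 2 digit23 by metis
      then have "1 \<le> \<bar>int N - int (n * b + 3)\<bar>" by linarith
      then have "1 \<le> real_of_int \<bar>int N - int (n * b + 3)\<bar>" by linarith
      then show ?thesis using 2 by (simp add: dist_real_def)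
    qed
  qed
  then have "collapse l (real N) = real N" by (simp add: collapse_def)
  then show ?thesis by (simp only: if_not_P[OF False])
qed

lemma collapse_mult: "collapse l (real b * real N) = real b * real N"
  using collapse_nat[of l "b * N"] by simp

text \<open>The plain position at level \<open>l + m\<close>, with the loops of the levels
  \<open>l + m - 1\<close> down to \<open>l\<close> collapsed one after the other; each step also
  changes the unit by the factor \<open>b\<close>.\<close>

primrec pos_approx :: "nat \<Rightarrow> nat \<Rightarrow> real \<Rightarrow> real" where
  "pos_approx 0 = (\<lambda>l t. real b ^ l * t)"
| "pos_approx (Suc m) = (\<lambda>l t. collapse l (pos_approx m (Suc l) t) / real b)"

declare pos_approx.simps(2) [simp del]

definition pos :: "nat \<Rightarrow> real \<Rightarrow> real" where
  "pos l t = lim (\<lambda>m. pos_approx m l t)"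

text \<open>The two approximations differ by one collapse at the finest level, a displacement of at
  most 1, and each of the \<open>m\<close> coarser collapses multiplies the difference by at most
  \<open>2 / b\<close>.\<close>

lemma pos_approx_step: "\<bar>pos_approx (Suc m) l t - pos_approx m l t\<bar> \<le> (2 / real b) ^ m"
proof (induction m arbitrary: l)
  case 0
  have "\<bar>collapse l (real b ^ Suc l * t) - real b ^ Suc l * t\<bar> / real b \<le> 1 / real b"
    using collapse_near by (intro divide_right_mono) auto
  also have "\<dots> \<le> 1" using b6 by simp
  also have "\<bar>collapse l (real b ^ Suc l * t) - real b ^ Suc l * t\<bar> / real b =
     \<bar>(collapse l (real b ^ Suc l * t) - real b ^ Suc l * t) / real b\<bar>"
    by simp
  also have "\<dots> = \<bar>pos_approx (Suc 0) l t - pos_approx 0 l t\<bar>"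
    by (simp add: diff_divide_distrib pos_approx.simps(2))
  finally show ?case by simp
next
  case (Suc m)
  have "\<bar>pos_approx (Suc (Suc m)) l t - pos_approx (Suc m) l t\<bar> =
     \<bar>collapse l (pos_approx (Suc m) (Suc l) t) - collapse l (pos_approx m (Suc l) t)\<bar> / real b"
    by (simp only: pos_approx.simps(2) diff_divide_distrib[symmetric] abs_divide abs_of_nat)
  also have "\<dots> \<le> 2 * (2 / real b) ^ m / real b"
    using collapse_lip[of l "pos_approx (Suc m) (Suc l) t" "pos_approx m (Suc l) t"] Suc.IH[of "Suc l"]
    by (intro divide_right_mono) auto
  finally show ?case by simp
qed

lemma pos_approx_tendsto: "(\<lambda>m. pos_approx m l t) \<longlonglongrightarrow> pos l t"
proof -
  have "summable (\<lambda>m. (2 / real b) ^ m)" using b6 by (intro summable_geometric) auto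
  then have "summable (\<lambda>m. pos_approx (Suc m) l t - pos_approx m l t)"
    by (rule summable_comparison_test'[where N = 0]) (use pos_approx_step in auto)
  then have "convergent (\<lambda>m. pos_approx m l t - pos_approx 0 l t)"
    unfolding summable_iff_convergent sum_lessThan_telescope[of "\<lambda>m. pos_approx m l t"] .
  then have "convergent (\<lambda>m. pos_approx m l t)"
    by (simp only: convergent_diff_const_right_iff)
  then show ?thesis unfolding pos_def by (simp add: convergent_LIMSEQ_iff)
qed

lemma continuous_collapse: "isCont (collapse l) x"
  unfolding collapse_def by (intro continuous_intros)

lemma pos_rec: "real b * pos l t = collapse l (pos (Suc l) t)"
proof -
  have "(\<lambda>m. collapse l (pos_approx m (Suc l) t)) \<longlonglongrightarrow> collapse l (pos (Suc l) t)"
    using continuous_collapse pos_approx_tendsto by (rule isCont_tendsto_compose)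
  moreover have "(\<lambda>m. real b * pos_approx (Suc m) l t) \<longlonglongrightarrow> real b * pos l t"
    by (intro tendsto_intros LIMSEQ_Suc pos_approx_tendsto)
  moreover have "real b * pos_approx (Suc m) l t = collapse l (pos_approx m (Suc l) t)" for m
    by (simp add: pos_approx.simps(2))
  ultimately show ?thesis by (simp add: LIMSEQ_unique)
qed

lemma pos_approx_vertex: "pos_approx m l (real N / real b ^ l) = real N"
proof (induction m arbitrary: l N)
  case 0 then show ?case using b_pos by simp
next
  case (Suc m)
  have "real N / real b ^ l = real (b * N) / real b ^ Suc l" using b_pos by simp
  then have "pos_approx m (Suc l) (real N / real b ^ l) = real (b * N)" using Suc.IH[of "Suc l" "b * N"] by metis
  then show ?case using collapse_mult[of l N] by (simp add: pos_approx.simps(2))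
qed

text \<open>A vertex of level \<open>l\<close> is a multiple of \<open>b\<close> at every finer
  level and is never moved.\<close>

lemma pos_vertex: "pos l (real N / real b ^ l) = real N"
  using pos_approx_tendsto[of l "real N / real b ^ l"] by (simp add: pos_approx_vertex LIMSEQ_const_iff)

lemma pos_mono: assumes "t \<le> u" shows "pos l t \<le> pos l u"
proof -
  have "pos_approx m l t \<le> pos_approx m l u" for m
  proof (induction m arbitrary: l)
    case (Suc m)
    then show ?case by (auto simp: pos_approx.simps(2) intro!: divide_right_mono collapse_mono)
  qed (use assms in \<open>auto intro!: mult_left_mono\<close>)
  then show ?thesis
    by (intro LIMSEQ_le[OF pos_approx_tendsto[of l t] pos_approx_tendsto[of l u]]) auto
qed

lemma pos_lip:
  assumes "i \<le> l"
  shows "\<bar>pos i t - pos i u\<bar> \<le> (2 / real b) ^ (l - i) * \<bar>pos l t - pos l u\<bar>"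
proof -
  have "\<bar>pos i t - pos i u\<bar> \<le> (2 / real b) ^ j * \<bar>pos (i + j) t - pos (i + j) u\<bar>" for j
  proof (induction j)
    case (Suc j)
    have "real b * \<bar>pos (i + j) t - pos (i + j) u\<bar> \<le> 2 * \<bar>pos (Suc (i + j)) t - pos (Suc (i + j)) u\<bar>"
      using collapse_lip[of "i + j" "pos (Suc (i + j)) t" "pos (Suc (i + j)) u"]
      unfolding pos_rec[symmetric] right_diff_distrib[symmetric] abs_mult by simp
    then have "\<bar>pos (i + j) t - pos (i + j) u\<bar> \<le> 2 / real b * \<bar>pos (i + Suc j) t - pos (i + Suc j) u\<bar>"
      using b_pos by (simp add: field_simps)
    then have "(2 / real b) ^ j * \<bar>pos (i + j) t - pos (i + j) u\<bar> \<le>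
       (2 / real b) ^ j * (2 / real b * \<bar>pos (i + Suc j) t - pos (i + Suc j) u\<bar>)"
      by (intro mult_left_mono) auto
    then show ?case using Suc.IH by (simp add: mult_ac)
  qed simp
  from this[of "l - i"] show ?thesis using assms by simp
qed

section \<open>Cells and positions\<close>

definition cell :: "nat \<Rightarrow> real \<Rightarrow> nat" where
  "cell l t = nat \<lfloor>real b ^ l * t\<rfloor>"

lemma cell_bounds:
  assumes "0 \<le> t"
  shows "real (cell l t) \<le> real b ^ l * t" "real b ^ l * t < real (cell l t) + 1"
proof -
  have "0 \<le> real b ^ l * t" using assms by simp
  then have "real (cell l t) = of_int \<lfloor>real b ^ l * t\<rfloor>" by (simp add: cell_def)
  then show "real (cell l t) \<le> real b ^ l * t" "real b ^ l * t < real (cell l t) + 1" by linarith+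
qed

lemma cell_unique:
  assumes "real n \<le> real b ^ l * t" "real b ^ l * t < real n + 1"
  shows "cell l t = n"
  using assms unfolding cell_def by linarith

text \<open>Collapsing keeps a time in its closed cell, since \<open>pos l\<close> is monotone and
  fixes both ends.\<close>

lemma pos_cell:
  assumes "0 \<le> t"
  shows "real (cell l t) \<le> pos l t" "pos l t \<le> real (cell l t) + 1"
proof -
  have b: "0 < real b ^ l" using b_pos by simp
  have "real (cell l t) / real b ^ l \<le> t" "t \<le> real (Suc (cell l t)) / real b ^ l"
    using cell_bounds[OF assms, of l] b by (auto simp: field_simps)
  then show "real (cell l t) \<le> pos l t" "pos l t \<le> real (cell l t) + 1"
    using pos_mono pos_vertex by (metis, metis of_nat_Suc add.commute)
qed

lemma cell_div:
  assumes "0 \<le> t"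
  shows "cell (i + j) t div b ^ j = cell i t"
proof (rule sym, rule cell_unique)
  define q where "q = cell (i + j) t div b ^ j"
  have b: "0 < real b ^ j" using b_pos by simp
  have "q * b ^ j \<le> cell (i + j) t" by (simp add: q_def)
  then have "real q * real b ^ j \<le> real (cell (i + j) t)" by (metis of_nat_le_iff of_nat_mult of_nat_power)
  also have "\<dots> \<le> real b ^ i * t * real b ^ j" using cell_bounds(1)[OF assms, of "i + j"] by (simp add: power_add mult_ac)
  finally show "real q \<le> real b ^ i * t" using b by simp
  have "cell (i + j) t < Suc q * b ^ j" unfolding q_def using b_pos
    by (metis dividend_less_div_times mult_Suc zero_less_power add.commute)
  then have "cell (i + j) t + 1 \<le> Suc q * b ^ j" by simp
  then have "real (cell (i + j) t) + 1 \<le> (real q + 1) * real b ^ j"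
    by (metis of_nat_Suc of_nat_le_iff of_nat_mult of_nat_power Suc_eq_plus1 add.commute)
  moreover have "real b ^ i * t * real b ^ j < real (cell (i + j) t) + 1"
    using cell_bounds(2)[OF assms, of "i + j"] by (simp add: power_add mult_ac)
  ultimately have "real b ^ i * t * real b ^ j < (real q + 1) * real b ^ j" by linarith
  then show "real b ^ i * t < real q + 1" using b by (simp only: mult_less_cancel_right_pos)
qed

lemma cell_div1: "0 \<le> t \<Longrightarrow> cell (Suc i) t div b = cell i t"
  using cell_div[of t i 1] by simp

text \<open>At levels below \<open>l\<close> identified vertices have already been merged by the collapsing maps,
  at their own level and above they are merged by \<open>rep\<close>.\<close>

lemma pos_compat:
  assumes "rep l v = rep l w"
  shows "pos i (real v / real b ^ l) = pos i (real w / real b ^ l) \<or>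
     (\<exists>v' w'. pos i (real v / real b ^ l) = real v' \<and> pos i (real w / real b ^ l) = real w' \<and> rep i v' = rep i w')"
proof (cases "l \<le> i")
  case True
  have e: "real v / real b ^ l = real (b ^ (i - l) * v) / real b ^ i" for v
    using True b_pos by (simp add: field_simps flip: power_add)
  have "pos i (real v / real b ^ l) = real (b ^ (i - l) * v)" for v
    unfolding e by (rule pos_vertex)
  moreover have "rep i (b ^ (i - l) * v) = rep i (b ^ (i - l) * w)"
    using rep_mult_pow[of l "i - l" v] rep_mult_pow[of l "i - l" w] assms True by simp
  ultimately show ?thesis by blast
next
  case False
  then have "i \<le> l" by simp
  then show ?thesis using assms
  proof (induction l arbitrary: v w)
    case 0 then show ?case by simp
  next
    case (Suc l)
    show ?case
    proof (cases "i = Suc l")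
      case True then show ?thesis using pos_vertex Suc.prems by blast
    next
      case False
      then have il: "i \<le> l" using Suc.prems by simp
      have merged: "pos i (real (n * b + 2) / real b ^ Suc l) = pos i (real (n * b + 3) / real b ^ Suc l)"
        if n: "lam l n" for n
      proof -
        have "real b * pos l (real (n * b + 2) / real b ^ Suc l) = real b * pos l (real (n * b + 3) / real b ^ Suc l)"
          unfolding pos_rec pos_vertex collapse_nat digit23 using n by simp
        then have "pos l (real (n * b + 2) / real b ^ Suc l) = pos l (real (n * b + 3) / real b ^ Suc l)"
          using b_pos by simp
        then show ?thesis
          using pos_lip[OF il, of "real (n * b + 2) / real b ^ Suc l" "real (n * b + 3) / real b ^ Suc l"] by simp
      qed
      from rep_Suc_eqD[OF Suc.prems(2)] show ?thesis
      proof (elim disjE exE conjE)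
        fix v' w' assume vw: "v = b * v'" "w = b * w'" "rep l v' = rep l w'"
        have "real v / real b ^ Suc l = real v' / real b ^ l" "real w / real b ^ Suc l = real w' / real b ^ l"
          using b_pos vw by simp_all
        then show ?thesis using Suc.IH[OF il vw(3)] by metis
      next
        assume "v = w" then show ?thesis by blast
      next
        fix n assume "lam l n" "v = n * b + 2" "w = n * b + 3"
        then show ?thesis using merged by metis
      next
        fix n assume "lam l n" "v = n * b + 3" "w = n * b + 2"
        then show ?thesis using merged by metis
      qed
    qed
  qed
qed

end

section \<open>The curve\<close>

text \<open>\<open>bs\<close> amounts to \<open>gam < 1\<close>. \<open>D_coarse\<close> and
  \<open>D_fine\<close> bound, relative to \<open>kap ^ l\<close>, what all coarser and all finer
  levels of one residue class modulo \<open>D\<close> can add to a bump of level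
  \<open>l\<close>.\<close>

locale loop_curve = loops b lam for b lam +
  fixes s :: real and D :: nat and col :: "nat \<Rightarrow> nat \<Rightarrow> nat"
  assumes s1: "1 < s" and bs: "2 < real b powr (1 - 1 / s)"
    and D_pos: "0 < D"
    and D_coarse: "real b * (2 * real b powr (1 / s - 1)) ^ D / (1 - 2 * real b powr (1 / s - 1)) \<le> 1 / 8"
    and D_fine: "(real b powr (- 1 / s)) ^ D / (1 - real b powr (- 1 / s)) \<le> 1 / 8"
    and col_less: "col l v < 64 * b + 1"
    and col_rep: "rep l v = rep l w \<Longrightarrow> col l v = col l w"
    and col_near: "near_vertices l v w \<Longrightarrow> rep (Suc l) v \<noteq> rep (Suc l) w \<Longrightarrow> col (Suc l) v \<noteq> col (Suc l) w"
begin

definition kap :: real where "kap = real b powr (- 1 / s)"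
text \<open>The quotient of \<open>2 / b\<close> and \<open>kap\<close>: relative to
  \<open>kap ^ l\<close>, a bump of level \<open>i \<le> l\<close> varies over a cell of level
  \<open>l\<close> by at most a multiple of \<open>gam ^ (l - i)\<close>.\<close>

definition gam :: real where "gam = 2 * real b powr (1 / s - 1)"

lemma b_gt1: "1 < real b" using b6 by simp

lemma kap01: "0 < kap" "kap < 1"
  using b_gt1 s1 by (auto simp: kap_def powr_less_one)

lemma gam01: "0 < gam" "gam < 1"
proof -
  have "real b powr (1 / s - 1) * real b powr (1 - 1 / s) = 1"
    using b_gt1 by (simp flip: powr_add)
  moreover have "real b powr (1 / s - 1) * 2 < real b powr (1 / s - 1) * real b powr (1 - 1 / s)"
    using bs b_gt1 by (intro mult_strict_left_mono) auto
  ultimately show "gam < 1" by (simp add: gam_def)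
  show "0 < gam" using b_gt1 by (simp add: gam_def)
qed

lemma kap_gam: "kap * gam = 2 / real b"
proof -
  have "real b powr (- 1 / s) * real b powr (1 / s - 1) = real b powr (- 1)"
    by (simp flip: powr_add)
  then show ?thesis using b_gt1 by (simp add: kap_def gam_def powr_minus_divide)
qed

lemma kap_pow: "kap ^ l = (1 / real b ^ l) powr (1 / s)"
proof -
  have "kap ^ l = (real b powr (- 1 / s)) powr real l"
    using kap01 by (simp add: kap_def powr_realpow)
  also have "\<dots> = (real b powr (- real l)) powr (1 / s)"
    by (simp add: powr_powr mult.commute)
  also have "real b powr (- real l) = 1 / real b ^ l"
    using b_gt1 by (simp add: powr_minus_divide powr_realpow)
  finally show ?thesis .
qed

lemma kap_powr: "(kap ^ l) powr s = 1 / real b ^ l"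
  unfolding kap_pow using s1 b_gt1 by (simp add: powr_powr)

text \<open>The vertex \<open>v\<close> of level \<open>l\<close> bumps the coordinate \<open>tag l v\<close>. For a tag not used on a level \<open>verts l k\<close> is
  empty and \<open>hat l k\<close> is the constant \<open>1\<close>, which does not affect differences.\<close>

definition dim :: nat where "dim = D * (64 * b + 1)"
definition tag :: "nat \<Rightarrow> nat \<Rightarrow> nat" where "tag l v = (l mod D) * (64 * b + 1) + col l v"
definition verts :: "nat \<Rightarrow> nat \<Rightarrow> real set" where "verts l k = real ` {v. tag l v = k}"
definition hat :: "nat \<Rightarrow> nat \<Rightarrow> real \<Rightarrow> real" where "hat l k x = max 0 (1 - infdist x (verts l k))"
definition curve :: "real \<Rightarrow> nat \<Rightarrow> real" where
  "curve t k = (if k < dim then \<Sum>l. kap ^ l * hat l k (pos l t) else 0)"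

lemma curve_eucl: "curve t \<in> eucl dim"
  by (simp add: eucl_def curve_def)

lemma tag_less: "tag l v < dim"
proof -
  have "tag l v < (l mod D) * (64 * b + 1) + (64 * b + 1)"
    unfolding tag_def using col_less[of l v] by simp
  also have "\<dots> = Suc (l mod D) * (64 * b + 1)" by simp
  also have "\<dots> \<le> D * (64 * b + 1)" using D_pos by (intro mult_right_mono) (auto simp: Suc_leI)
  finally show ?thesis by (simp add: dim_def)
qed

lemma tag_level: "tag l v div (64 * b + 1) = l mod D"
proof -
  have "(l mod D * (64 * b + 1) + col l v) div (64 * b + 1) = l mod D + col l v div (64 * b + 1)"
    by (rule div_mult_self3) simp
  then show ?thesis unfolding tag_def using col_less[of l v] by simp
qed

lemma hat_range: "0 \<le> hat l k x" "hat l k x \<le> 1"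
  using infdist_nonneg[of x "verts l k"] by (auto simp: hat_def)

lemma hat_lip: "\<bar>hat l k x - hat l k y\<bar> \<le> \<bar>x - y\<bar>"
  unfolding hat_def by (rule tent_lip)

lemma hat_vertex: "hat l k (real v) = (if tag l v = k \<or> verts l k = {} then 1 else 0)"
proof (cases "verts l k = {}")
  case True then show ?thesis by (simp add: hat_def infdist_def)
next
  case nonempty: False
  show ?thesis
  proof (cases "tag l v = k")
    case True
    then have "real v \<in> verts l k" by (auto simp: verts_def)
    then show ?thesis using True by (simp add: hat_def)
  next
    case False
    have "1 \<le> infdist (real v) (verts l k)"
    proof (rule infdist_ge[OF nonempty])
      fix y assume "y \<in> verts l k"
      then obtain w where w: "y = real w" "tag l w = k" by (auto simp: verts_def)
      then have "w \<noteq> v" using False by auto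
      then have "1 \<le> \<bar>int v - int w\<bar>" by linarith
      then have "1 \<le> real_of_int \<bar>int v - int w\<bar>" by linarith
      then show "1 \<le> dist (real v) y" using w by (simp add: dist_real_def)
    qed
    then show ?thesis using False nonempty by (simp add: hat_def)
  qed
qed

lemma hat_compat:
  assumes "rep l v = rep l w"
  shows "hat i k (pos i (real v / real b ^ l)) = hat i k (pos i (real w / real b ^ l))"
  using pos_compat[OF assms, of i]
proof (elim disjE exE conjE)
  fix v' w' assume vw: "pos i (real v / real b ^ l) = real v'" "pos i (real w / real b ^ l) = real w'" "rep i v' = rep i w'"
  have "tag i v' = tag i w'" unfolding tag_def col_rep[OF vw(3)] ..
  then show ?thesis unfolding vw(1,2) hat_vertex by simp
qed simp

text \<open>An exact equality and not an estimate, because \<open>hat_compat\<close> makes every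
  summand of every coordinate agree.\<close>

lemma curve_vertex_eq:
  assumes "rep l v = rep l w"
  shows "curve (real v / real b ^ l) = curve (real w / real b ^ l)"
  unfolding curve_def fun_eq_iff hat_compat[OF assms] by simp

section \<open>Distances on the curve against adjacency of cells\<close>

definition adjt :: "nat \<Rightarrow> real \<Rightarrow> real \<Rightarrow> bool" where
  "adjt l t u \<longleftrightarrow> adj l (cell l t) (cell l u)"

lemma adjt_close:
  assumes "0 \<le> t" "0 \<le> u" "\<bar>t - u\<bar> \<le> 1 / real b ^ l"
  shows "adjt l t u"
proof -
  have "\<bar>t - u\<bar> * real b ^ l \<le> 1"
    using assms(3) b_gt1 by (simp add: field_simps)
  moreover have "real b ^ l * t - real b ^ l * u = (t - u) * real b ^ l" by (simp add: algebra_simps)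
  ultimately have "\<bar>real b ^ l * t - real b ^ l * u\<bar> \<le> 1"
    by (simp only: abs_mult) simp
  then have "cell l t = cell l u \<or> cell l t = Suc (cell l u) \<or> cell l u = Suc (cell l t)"
    using cell_bounds[OF assms(1), of l] cell_bounds[OF assms(2), of l] by linarith
  then show ?thesis unfolding adjt_def adj_def by auto
qed

lemma adjt_0:
  assumes "t \<in> {0..1}" "u \<in> {0..1}" shows "adjt 0 t u"
  using assms by (intro adjt_close) auto

text \<open>Go from \<open>t\<close> to an end of its cell and from the identified end of the other
  cell to \<open>u\<close>; the jump in between costs nothing by \<open>hat_compat\<close>.\<close>

lemma hat_near:
  assumes "adjt l t u" "i \<le> l" "0 \<le> t" "0 \<le> u"
  shows "\<bar>hat i k (pos i t) - hat i k (pos i u)\<bar> \<le> 2 * (2 / real b) ^ (l - i)"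
proof -
  obtain v w where v: "v \<in> {cell l t, Suc (cell l t)}" and w: "w \<in> {cell l u, Suc (cell l u)}"
    and vw: "rep l v = rep l w"
    using assms(1) unfolding adjt_def adj_def by blast
  have half: "\<bar>hat i k (pos i t) - hat i k (pos i (real v / real b ^ l))\<bar> \<le> (2 / real b) ^ (l - i)"
    if t: "0 \<le> t" and v: "v \<in> {cell l t, Suc (cell l t)}" for t v
  proof -
    have "\<bar>pos l t - pos l (real v / real b ^ l)\<bar> \<le> 1"
      unfolding pos_vertex using pos_cell[OF t, of l] v by auto
    then have "(2 / real b) ^ (l - i) * \<bar>pos l t - pos l (real v / real b ^ l)\<bar> \<le> (2 / real b) ^ (l - i) * 1"
      by (intro mult_left_mono) auto
    then show ?thesis
      using pos_lip[OF assms(2), of t "real v / real b ^ l"] hat_lip[of i k "pos i t" "pos i (real v / real b ^ l)"]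
      by linarith
  qed
  show ?thesis
    using half[OF assms(3) v] half[OF assms(4) w] unfolding hat_compat[OF vw] by linarith
qed

lemma kap_summable: "summable (\<lambda>l. kap ^ l)"
  using kap01 by (intro summable_geometric) auto

lemma terms_summable: "summable (\<lambda>l. kap ^ l * hat l k (pos l t))"
proof (rule summable_comparison_test'[OF kap_summable, where N = 0])
  fix n show "norm (kap ^ n * hat n k (pos n t)) \<le> kap ^ n"
    using hat_range[of n k "pos n t"] kap01 by (simp add: mult_left_le)
qed

lemma geom_sum_le:
  assumes "0 < q" "q < 1"
  shows "(\<Sum>i<n. q ^ i) \<le> 1 / (1 - (q :: real))"
proof -
  have "(\<Sum>i<n. q ^ i) \<le> (\<Sum>i. q ^ i)"
    using assms by (intro sum_le_suminf summable_geometric) auto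
  also have "\<dots> = 1 / (1 - q)" using assms by (intro suminf_geometric) auto
  finally show ?thesis .
qed

text \<open>The first summand accounts for the levels up to \<open>l\<close>, the second for the
  finer ones.\<close>

definition C0 :: real where "C0 = 2 / (1 - gam) + 1 / (1 - kap)"

lemma C0_pos: "0 < C0" using gam01 kap01 by (simp add: C0_def add_pos_pos)

lemma curve_diff_split:
  assumes "k < dim"
  shows "curve t k - curve u k = (\<Sum>i<n. kap ^ i * (hat i k (pos i t) - hat i k (pos i u)))
     + (\<Sum>i. kap ^ (i + n) * (hat (i + n) k (pos (i + n) t) - hat (i + n) k (pos (i + n) u)))"
    and "\<bar>\<Sum>i. kap ^ (i + n) * (hat (i + n) k (pos (i + n) t) - hat (i + n) k (pos (i + n) u))\<bar>
      \<le> kap ^ n / (1 - kap)"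
proof -
  let ?a = "\<lambda>i. kap ^ i * (hat i k (pos i t) - hat i k (pos i u))"
  have sm: "summable ?a"
    using summable_diff[OF terms_summable terms_summable] by (simp add: right_diff_distrib)
  have "curve t k - curve u k = (\<Sum>i. ?a i)"
    unfolding curve_def using assms by (simp add: suminf_diff[OF terms_summable terms_summable] right_diff_distrib)
  also have "\<dots> = (\<Sum>i<n. ?a i) + (\<Sum>i. ?a (i + n))"
    using suminf_split_initial_segment[OF sm, of n] by simp
  finally show "curve t k - curve u k = (\<Sum>i<n. ?a i) + (\<Sum>i. ?a (i + n))" .
  have le: "norm (?a i) \<le> kap ^ i" for i
  proof -
    have "\<bar>hat i k (pos i t) - hat i k (pos i u)\<bar> \<le> 1"
      using hat_range[of i k "pos i t"] hat_range[of i k "pos i u"] by linarith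
    then show ?thesis using kap01 by (simp add: abs_mult mult_left_le)
  qed
  have "norm (\<Sum>i. ?a (i + n)) \<le> (\<Sum>i. kap ^ (i + n))"
    by (rule norm_suminf_le) (use le kap_summable in \<open>auto simp: summable_iff_shift\<close>)
  also have "\<dots> = kap ^ n * (\<Sum>i. kap ^ i)"
    unfolding power_add using kap_summable by (subst mult.commute) (rule suminf_mult)
  also have "\<dots> = kap ^ n / (1 - kap)" using kap01 by (subst suminf_geometric) auto
  finally show "\<bar>\<Sum>i. ?a (i + n)\<bar> \<le> kap ^ n / (1 - kap)" by simp
qed

lemma kap_ratio: "i \<le> l \<Longrightarrow> kap ^ i * (2 / real b) ^ (l - i) = kap ^ l * gam ^ (l - i)"
proof -
  assume "i \<le> l"
  have "kap ^ i * (2 / real b) ^ (l - i) = kap ^ i * (kap ^ (l - i) * gam ^ (l - i))"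
    unfolding kap_gam[symmetric] by (simp add: power_mult_distrib)
  also have "\<dots> = kap ^ (i + (l - i)) * gam ^ (l - i)" by (simp only: power_add mult.assoc)
  finally show ?thesis using \<open>i \<le> l\<close> by simp
qed

lemma curve_upper_coord:
  assumes "adjt l t u" "0 \<le> t" "0 \<le> u"
  shows "\<bar>curve t k - curve u k\<bar> \<le> C0 * kap ^ l"
proof (cases "k < dim")
  case False then show ?thesis using C0_pos kap01 by (simp add: curve_def)
next
  case True
  let ?a = "\<lambda>i. kap ^ i * (hat i k (pos i t) - hat i k (pos i u))"
  have "\<bar>\<Sum>i<Suc l. ?a i\<bar> \<le> (\<Sum>i<Suc l. 2 * (kap ^ l * gam ^ (Suc l - Suc i)))"
  proof (intro order_trans[OF sum_abs] sum_mono)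
    fix i assume "i \<in> {..<Suc l}"
    then have il: "i \<le> l" by simp
    have "\<bar>?a i\<bar> \<le> kap ^ i * (2 * (2 / real b) ^ (l - i))"
      unfolding abs_mult using hat_near[OF assms(1) il assms(2,3), of k] kap01
      by (auto intro!: mult_mono)
    also have "\<dots> = 2 * (kap ^ l * gam ^ (Suc l - Suc i))" using kap_ratio[OF il] by simp
    finally show "\<bar>?a i\<bar> \<le> 2 * (kap ^ l * gam ^ (Suc l - Suc i))" .
  qed
  also have "\<dots> = (\<Sum>i<Suc l. 2 * (kap ^ l * gam ^ i))"
    by (rule sum.nat_diff_reindex)
  also have "\<dots> = 2 * kap ^ l * (\<Sum>i<Suc l. gam ^ i)" by (simp only: sum_distrib_left mult.assoc)
  also have "\<dots> \<le> 2 * kap ^ l * (1 / (1 - gam))"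
    using kap01 by (intro mult_left_mono geom_sum_le gam01) auto
  also have "\<dots> = kap ^ l * (2 / (1 - gam))" by simp
  finally have 1: "\<bar>\<Sum>i<Suc l. ?a i\<bar> \<le> kap ^ l * (2 / (1 - gam))" .
  have "kap ^ Suc l / (1 - kap) \<le> kap ^ l / (1 - kap)"
    using kap01 by (intro divide_right_mono power_decreasing) auto
  then have 2: "kap ^ Suc l / (1 - kap) \<le> kap ^ l * (1 / (1 - kap))" by simp
  have "C0 * kap ^ l = kap ^ l * (2 / (1 - gam)) + kap ^ l * (1 / (1 - kap))"
    by (simp add: C0_def algebra_simps)
  then show ?thesis
    using 1 2 curve_diff_split[OF True, where t = t and u = u and n = "Suc l"] by linarith
qed

lemma curve_upper:
  assumes "adjt l t u" "0 \<le> t" "0 \<le> u"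
  shows "dE dim (curve t) (curve u) \<le> real dim * (C0 * kap ^ l)"
  by (intro dE_le_const curve_upper_coord assms)

text \<open>Take the end \<open>v\<close> of the cell of \<open>t\<close> nearest to its position.
  Since the parents are still adjacent, the colour of \<open>v\<close> differs from those of both
  ends of the cell of \<open>u\<close>; every other vertex is too far from the position of
  \<open>u\<close> to be felt there.\<close>

lemma hat_separate:
  assumes "adjt l t u" "\<not> adjt (Suc l) t u" "0 \<le> t" "0 \<le> u"
  obtains k where "k < dim" "k div (64 * b + 1) = Suc l mod D"
    "1 / 2 \<le> hat (Suc l) k (pos (Suc l) t)" "hat (Suc l) k (pos (Suc l) u) = 0"
proof -
  let ?A = "cell (Suc l) t" and ?B = "cell (Suc l) u" and ?x = "pos (Suc l) u"
  obtain v where v: "v \<in> {?A, Suc ?A}" "\<bar>pos (Suc l) t - real v\<bar> \<le> 1 / 2"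
  proof (cases "pos (Suc l) t \<le> real ?A + 1 / 2")
    case True then show ?thesis using that[of ?A] pos_cell[OF assms(3), of "Suc l"] by auto
  next
    case False then show ?thesis using that[of "Suc ?A"] pos_cell[OF assms(3), of "Suc l"] by auto
  qed
  define k where "k = tag (Suc l) v"
  have mem: "real v \<in> verts (Suc l) k" by (auto simp: verts_def k_def)
  have "hat (Suc l) k (real v) = 1" by (simp add: hat_vertex k_def)
  then have 1: "1 / 2 \<le> hat (Suc l) k (pos (Suc l) t)"
    using hat_lip[of "Suc l" k "pos (Suc l) t" "real v"] v(2) by linarith
  have diff: "tag (Suc l) w \<noteq> k" if "w \<in> {?B, Suc ?B}" for w
  proof -
    have "rep (Suc l) v \<noteq> rep (Suc l) w"
      using assms(2) v(1) that unfolding adjt_def adj_def by blast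
    moreover have "near_vertices l v w"
      unfolding near_vertices_def using v(1) that assms(1) cell_div1[OF assms(3), of l] cell_div1[OF assms(4), of l]
      unfolding adjt_def by metis
    ultimately show ?thesis using col_near[of l v w] by (simp add: k_def tag_def)
  qed
  have "1 \<le> infdist ?x (verts (Suc l) k)"
  proof (rule infdist_ge)
    fix y assume "y \<in> verts (Suc l) k"
    then obtain w where w: "y = real w" "tag (Suc l) w = k" by (auto simp: verts_def)
    then have "w \<noteq> ?B" "w \<noteq> Suc ?B" using diff by auto
    then have "w + 1 \<le> ?B \<or> ?B + 2 \<le> w" by linarith
    then have "real w + 1 \<le> real ?B \<or> real ?B + 2 \<le> real w" by linarith
    then show "1 \<le> dist ?x y" using pos_cell[OF assms(4), of "Suc l"] w(1) unfolding dist_real_def by linarith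
  qed (use mem in auto)
  then have "hat (Suc l) k ?x = 0" by (simp add: hat_def)
  then show ?thesis using that[of k] 1 tag_less tag_level by (simp add: k_def)
qed

text \<open>In the coordinate from \<open>hat_separate\<close> level \<open>L\<close> contributes at
  least \<open>kap ^ L / 2\<close>. The other levels that use this coordinate differ from
  \<open>L\<close> by multiples of \<open>D\<close>, and the coarser and the finer ones take away at
  most \<open>kap ^ L / 8\<close> each.\<close>

lemma curve_lower_step:
  assumes "adjt l t u" "\<not> adjt (Suc l) t u" "0 \<le> t" "0 \<le> u"
  shows "kap ^ Suc l / 4 \<le> dE dim (curve t) (curve u)"
proof -
  obtain k where k: "k < dim" "k div (64 * b + 1) = Suc l mod D"
    "1 / 2 \<le> hat (Suc l) k (pos (Suc l) t)" "hat (Suc l) k (pos (Suc l) u) = 0"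
    using hat_separate[OF assms] .
  define L where "L = Suc l"
  let ?a = "\<lambda>i. kap ^ i * (hat i k (pos i t) - hat i k (pos i u))"
  have zero: "?a i = 0" if "i mod D \<noteq> L mod D" for i
  proof -
    have "verts i k = {}" using tag_level[of i] k(2) that by (auto simp: verts_def L_def)
    then show ?thesis by (simp add: hat_def infdist_def)
  qed
  have main: "kap ^ L / 2 \<le> \<bar>?a L\<bar>"
    using k(3,4) kap01 by (simp add: L_def abs_mult field_simps)
  have far: "D \<le> L - i" if "i < L" "i mod D = L mod D" for i
  proof -
    have "D dvd L - i" using that mod_eq_dvd_iff_nat[of i L D] by simp
    then show ?thesis using that by (intro dvd_imp_le) auto
  qed
  have coarse: "\<bar>?a i\<bar> \<le> kap ^ L * real b * gam ^ (L - i)" if "i < L" for i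
  proof -
    have il: "i \<le> l" using that L_def by simp
    have "\<bar>?a i\<bar> \<le> kap ^ i * (2 * (2 / real b) ^ (l - i))"
      unfolding abs_mult using hat_near[OF assms(1) il assms(3,4), of k] kap01
      by (auto intro!: mult_mono)
    \<comment> \<open>Adjacency is known only at level \<open>l = L - 1\<close>. The missing level
      costs \<open>b / 2\<close>, whence the factor \<open>b\<close> in
      \<open>D_coarse\<close>.\<close>
    also have "2 * (2 / real b) ^ (l - i) = real b * (2 / real b) ^ (L - i)"
      using il by (simp add: L_def Suc_diff_le)
    also have "kap ^ i * (real b * (2 / real b) ^ (L - i)) = kap ^ L * real b * gam ^ (L - i)"
      using kap_ratio[of i L] that by (simp add: mult_ac)
    finally show ?thesis .
  qed
  have "\<bar>\<Sum>i<L. ?a i\<bar> \<le> kap ^ L / 8"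
  proof -
    \<comment> \<open>The \<open>D - 1\<close> levels just below \<open>L\<close> have other
      residues and vanish, so the geometric series starts at \<open>gam ^ D\<close>.\<close>
    have trunc: "(\<Sum>i<L. ?a i) = (\<Sum>i<Suc L - D. ?a i)"
    proof (rule sum.mono_neutral_right)
      show "{..<Suc L - D} \<subseteq> {..<L}" using D_pos by auto
      show "\<forall>i\<in>{..<L} - {..<Suc L - D}. ?a i = 0"
      proof
        fix i assume i: "i \<in> {..<L} - {..<Suc L - D}"
        then have "\<not> D \<le> L - i" by auto
        then show "?a i = 0" using zero[of i] far[of i] i by auto
      qed
    qed simp
    have "\<bar>\<Sum>i<L. ?a i\<bar> \<le> (\<Sum>i<Suc L - D. kap ^ L * real b * gam ^ (L - i))"
      unfolding trunc
      using D_pos by (intro order_trans[OF sum_abs] sum_mono coarse) auto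
    also have "\<dots> = (\<Sum>i<Suc L - D. kap ^ L * real b * gam ^ (D + (Suc L - D - Suc i)))"
    proof (rule sum.cong[OF refl])
      fix i assume "i \<in> {..<Suc L - D}"
      then have "i < Suc L - D" by simp
      then have "L - i = D + (Suc L - D - Suc i)" by arith
      then show "kap ^ L * real b * gam ^ (L - i) = kap ^ L * real b * gam ^ (D + (Suc L - D - Suc i))" by simp
    qed
    also have "\<dots> = (\<Sum>i<Suc L - D. kap ^ L * real b * gam ^ (D + i))"
      by (rule sum.nat_diff_reindex)
    also have "\<dots> = kap ^ L * (real b * gam ^ D * (\<Sum>i<Suc L - D. gam ^ i))"
      by (simp add: sum_distrib_left power_add mult_ac)
    also have "\<dots> \<le> kap ^ L * (real b * gam ^ D * (1 / (1 - gam)))"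
      using kap01 gam01 by (intro mult_left_mono geom_sum_le) auto
    also have "\<dots> \<le> kap ^ L * (1 / 8)"
      using D_coarse kap01 by (intro mult_left_mono) (auto simp: gam_def)
    finally show ?thesis by simp
  qed
  moreover have "\<bar>\<Sum>i. ?a (i + (L + D))\<bar> \<le> kap ^ L / 8"
  proof -
    have "\<bar>\<Sum>i. ?a (i + (L + D))\<bar> \<le> kap ^ (L + D) / (1 - kap)"
      by (rule curve_diff_split(2)[OF k(1)])
    also have "\<dots> = kap ^ L * (kap ^ D / (1 - kap))" by (simp add: power_add)
    also have "\<dots> \<le> kap ^ L * (1 / 8)"
      using D_fine kap01 by (intro mult_left_mono) (auto simp: kap_def)
    finally show ?thesis by simp
  qed
  moreover have "(\<Sum>i<L + D. ?a i) = (\<Sum>i<L. ?a i) + ?a L"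
  proof -
    have "(\<Sum>i<L + D. ?a i) = (\<Sum>i<Suc L. ?a i)"
    proof (rule sum.mono_neutral_right)
      show "{..<Suc L} \<subseteq> {..<L + D}" using D_pos by auto
      show "\<forall>i\<in>{..<L + D} - {..<Suc L}. ?a i = 0"
      proof
        fix i assume i: "i \<in> {..<L + D} - {..<Suc L}"
        have "i mod D \<noteq> L mod D"
        proof
          assume "i mod D = L mod D"
          then have "D dvd i - L" using i mod_eq_dvd_iff_nat[of L i D] by simp
          then have "D \<le> i - L" using i by (intro dvd_imp_le) auto
          then show False using i by auto
        qed
        then show "?a i = 0" by (rule zero)
      qed
    qed simp
    then show ?thesis by simp
  qed
  ultimately have "kap ^ L / 4 \<le> \<bar>curve t k - curve u k\<bar>"
    using main curve_diff_split(1)[OF k(1), of t u "L + D"] by linarith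
  then show ?thesis using coord_le_dE[OF k(1)] order_trans unfolding L_def by blast
qed

text \<open>The step applies at the first level \<open>m \<le> l\<close> where adjacency fails, and
  \<open>kap ^ l \<le> kap ^ m\<close>.\<close>

lemma curve_lower:
  assumes "t \<in> {0..1}" "u \<in> {0..1}" "\<not> adjt l t u"
  shows "kap ^ l / 4 \<le> dE dim (curve t) (curve u)"
proof -
  define m where "m = (LEAST l. \<not> adjt l t u)"
  have m: "\<not> adjt m t u" unfolding m_def by (rule LeastI[of _ l]) (rule assms)
  have ml: "m \<le> l" unfolding m_def by (rule Least_le) (rule assms)
  obtain m' where m': "m = Suc m'" using m adjt_0[OF assms(1,2)] by (cases m) auto
  have "adjt m' t u" using not_less_Least[of m' "\<lambda>l. \<not> adjt l t u"] m' m_def by auto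
  then have "kap ^ m / 4 \<le> dE dim (curve t) (curve u)"
    using curve_lower_step[of m' t u] m m' assms by auto
  moreover have "kap ^ l \<le> kap ^ m" using ml kap01 by (intro power_decreasing) auto
  ultimately show ?thesis by linarith
qed

text \<open>The distance of two times is bracketed between consecutive powers of
  \<open>1 / b\<close>; the division by \<open>kap\<close> pays for this gap.\<close>

definition C1 :: real where "C1 = real dim * C0 / kap"

lemma C1_nonneg: "0 \<le> C1" using C0_pos kap01 by (simp add: C1_def)

lemma scale_bracket:
  assumes "0 < d" "d \<le> 1"
  obtains l where "1 / real b ^ Suc l < d" "d \<le> 1 / real b ^ l"
proof -
  have "\<exists>n. 1 / real b ^ n < d"
    using real_arch_pow_inv[of d "1 / real b"] assms b_gt1 by (auto simp: power_one_over)
  define m where "m = (LEAST n. 1 / real b ^ n < d)"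
  have m: "1 / real b ^ m < d" unfolding m_def by (rule LeastI_ex) fact
  then obtain l where l: "m = Suc l" using assms by (cases m) auto
  have "\<not> 1 / real b ^ l < d" using not_less_Least[of l "\<lambda>n. 1 / real b ^ n < d"] l m_def by auto
  then show thesis using that[of l] m l by simp
qed

lemma curve_holder:
  assumes "0 \<le> t" "0 \<le> u" "\<bar>t - u\<bar> \<le> 1"
  shows "dE dim (curve t) (curve u) \<le> C1 * \<bar>t - u\<bar> powr (1 / s)"
proof (cases "t = u")
  case True then show ?thesis using C1_nonneg by simp
next
  case False
  then obtain l where l: "1 / real b ^ Suc l < \<bar>t - u\<bar>" "\<bar>t - u\<bar> \<le> 1 / real b ^ l"
    using scale_bracket[of "\<bar>t - u\<bar>"] assms by auto
  have "kap ^ Suc l \<le> \<bar>t - u\<bar> powr (1 / s)"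
    unfolding kap_pow using l(1) s1 b_gt1 by (intro powr_mono2) auto
  then have "C1 * kap ^ Suc l \<le> C1 * \<bar>t - u\<bar> powr (1 / s)"
    using C1_nonneg by (rule mult_left_mono)
  moreover have "C1 * kap ^ Suc l = real dim * (C0 * kap ^ l)" using kap01 by (simp add: C1_def)
  moreover have "dE dim (curve t) (curve u) \<le> real dim * (C0 * kap ^ l)"
    using adjt_close[OF assms(1,2) l(2)] assms by (intro curve_upper)
  ultimately show ?thesis by linarith
qed

lemma curve_holderE: "holderE dim (1 / s) curve"
  unfolding holderE_def using curve_eucl curve_holder by (auto intro!: exI[of _ C1])

end

section \<open>Hausdorff measure\<close>

lemma diamE_le:
  assumes "\<And>x y. x \<in> C \<Longrightarrow> y \<in> C \<Longrightarrow> dE n x y \<le> d" "0 \<le> d"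
  shows "diamE n C \<le> d"
proof (cases "C = {}")
  case False
  then have "{dE n x y | x y. x \<in> C \<and> y \<in> C} \<noteq> {}" by blast
  then have "Sup {dE n x y | x y. x \<in> C \<and> y \<in> C} \<le> d" by (rule cSup_least) (use assms in auto)
  then show ?thesis using False by (simp add: diamE_def)
qed (simp add: diamE_def assms)

lemma dE_le_diamE:
  assumes "\<And>x y. x \<in> C \<Longrightarrow> y \<in> C \<Longrightarrow> dE n x y \<le> d" "x \<in> C" "y \<in> C"
  shows "dE n x y \<le> diamE n C"
proof -
  have "bdd_above {dE n x y | x y. x \<in> C \<and> y \<in> C}" using assms(1) by (intro bdd_aboveI[of _ d]) auto
  then have "dE n x y \<le> Sup {dE n x y | x y. x \<in> C \<and> y \<in> C}" using assms(2,3) by (intro cSup_upper) auto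
  then show ?thesis using assms by (auto simp: diamE_def)
qed

lemma diamE_nonneg_bounded:
  assumes "\<And>x y. x \<in> C \<Longrightarrow> y \<in> C \<Longrightarrow> dE n x y \<le> d"
  shows "0 \<le> diamE n C"
proof (cases "C = {}")
  case False
  then obtain x where "x \<in> C" by blast
  then show ?thesis using dE_le_diamE[of C n d x x] assms by simp
qed (simp add: diamE_def)

lemma hausdorffE_null_mono:
  assumes "hausdorffE n s B = 0" "A \<subseteq> B" shows "hausdorffE n s A = 0"
proof -
  have "hcontent n s \<delta> A \<le> hcontent n s \<delta> B" for \<delta>
    unfolding hcontent_def by (rule INF_superset_mono) (use assms(2) in auto)
  then have "hausdorffE n s A \<le> hausdorffE n s B"
    unfolding hausdorffE_def by (intro SUP_mono) auto
  then show ?thesis using assms(1) by simp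
qed

lemma hausdorffE_null_iff:
  "hausdorffE n s A = 0 \<longleftrightarrow> (\<forall>\<delta>>0. \<forall>\<epsilon>>0. \<exists>C :: nat \<Rightarrow> (nat \<Rightarrow> real) set. A \<subseteq> (\<Union>i. C i) \<and>
     (\<forall>i. C i \<subseteq> eucl n \<and> (\<forall>x\<in>C i. \<forall>y\<in>C i. dE n x y \<le> \<delta>)) \<and>
     (\<Sum>i. ennreal (diamE n (C i) powr s)) \<le> ennreal \<epsilon>)"
proof
  assume H: "hausdorffE n s A = 0"
  show "\<forall>\<delta>>0. \<forall>\<epsilon>>0. \<exists>C :: nat \<Rightarrow> (nat \<Rightarrow> real) set. A \<subseteq> (\<Union>i. C i) \<and>
     (\<forall>i. C i \<subseteq> eucl n \<and> (\<forall>x\<in>C i. \<forall>y\<in>C i. dE n x y \<le> \<delta>)) \<and>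
     (\<Sum>i. ennreal (diamE n (C i) powr s)) \<le> ennreal \<epsilon>"
  proof (intro allI impI)
    fix \<delta> \<epsilon> :: real assume d: "\<delta> > 0" and e: "\<epsilon> > 0"
    have "hcontent n s \<delta> A \<le> hausdorffE n s A"
      unfolding hausdorffE_def using d by (intro SUP_upper) auto
    then have "hcontent n s \<delta> A < ennreal \<epsilon>" using H e by simp
    then show "\<exists>C :: nat \<Rightarrow> (nat \<Rightarrow> real) set. A \<subseteq> (\<Union>i. C i) \<and>
     (\<forall>i. C i \<subseteq> eucl n \<and> (\<forall>x\<in>C i. \<forall>y\<in>C i. dE n x y \<le> \<delta>)) \<and>
     (\<Sum>i. ennreal (diamE n (C i) powr s)) \<le> ennreal \<epsilon>"
      unfolding hcontent_def INF_less_iff by (auto intro: less_imp_le)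
  qed
next
  assume R: "\<forall>\<delta>>0. \<forall>\<epsilon>>0. \<exists>C :: nat \<Rightarrow> (nat \<Rightarrow> real) set. A \<subseteq> (\<Union>i. C i) \<and>
     (\<forall>i. C i \<subseteq> eucl n \<and> (\<forall>x\<in>C i. \<forall>y\<in>C i. dE n x y \<le> \<delta>)) \<and>
     (\<Sum>i. ennreal (diamE n (C i) powr s)) \<le> ennreal \<epsilon>"
  have "hcontent n s \<delta> A \<le> 0" if d: "\<delta> > 0" for \<delta>
  proof (rule ennreal_le_epsilon)
    fix e :: real assume "e > 0"
    then obtain C :: "nat \<Rightarrow> (nat \<Rightarrow> real) set" where C: "A \<subseteq> (\<Union>i. C i)"
       "\<forall>i. C i \<subseteq> eucl n \<and> (\<forall>x\<in>C i. \<forall>y\<in>C i. dE n x y \<le> \<delta>)"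
       "(\<Sum>i. ennreal (diamE n (C i) powr s)) \<le> ennreal e" using R d by meson
    have "hcontent n s \<delta> A \<le> (\<Sum>i. ennreal (diamE n (C i) powr s))"
      unfolding hcontent_def by (rule INF_lower) (use C in auto)
    then show "hcontent n s \<delta> A \<le> 0 + ennreal e" using C(3) by simp
  qed
  then show "hausdorffE n s A = 0"
    unfolding hausdorffE_def by (intro antisym SUP_least) auto
qed

lemma hausdorffE_null_UN:
  fixes A :: "nat \<Rightarrow> (nat \<Rightarrow> real) set"
  assumes "\<And>k. hausdorffE n s (A k) = 0"
  shows "hausdorffE n s (\<Union>k. A k) = 0"
  unfolding hausdorffE_null_iff
proof (intro allI impI)
  fix \<delta> \<epsilon> :: real assume d: "\<delta> > 0" and e: "\<epsilon> > 0"
  have "\<exists>C :: nat \<Rightarrow> (nat \<Rightarrow> real) set. A k \<subseteq> (\<Union>i. C i) \<and>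
     (\<forall>i. C i \<subseteq> eucl n \<and> (\<forall>x\<in>C i. \<forall>y\<in>C i. dE n x y \<le> \<delta>)) \<and>
     (\<Sum>i. ennreal (diamE n (C i) powr s)) \<le> ennreal (\<epsilon> * (1/2) ^ Suc k)" for k
    using assms[of k] d e unfolding hausdorffE_null_iff by auto
  then obtain C :: "nat \<Rightarrow> nat \<Rightarrow> (nat \<Rightarrow> real) set" where C: "\<And>k. A k \<subseteq> (\<Union>i. C k i)"
     "\<And>k i. C k i \<subseteq> eucl n \<and> (\<forall>x\<in>C k i. \<forall>y\<in>C k i. dE n x y \<le> \<delta>)"
     "\<And>k. (\<Sum>i. ennreal (diamE n (C k i) powr s)) \<le> ennreal (\<epsilon> * (1/2) ^ Suc k)"
    by metis
  define G where "G j = C (fst (prod_decode j)) (snd (prod_decode j))" for j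
  have "(\<Sum>j. ennreal (diamE n (G j) powr s)) = (\<Sum>k. \<Sum>i. ennreal (diamE n (C k i) powr s))"
  proof -
    have "(\<Sum>j. (\<lambda>(k, i). ennreal (diamE n (C k i) powr s)) (prod_decode j)) =
       (\<Sum>k. \<Sum>i. ennreal (diamE n (C k i) powr s))"
      by (rule suminf_ennreal_2dimen) simp
    then show ?thesis by (simp only: G_def case_prod_unfold)
  qed
  also have "\<dots> \<le> (\<Sum>k. ennreal (\<epsilon> * (1/2) ^ Suc k))"
    by (intro suminf_le C(3)) auto
  also have "\<dots> = ennreal \<epsilon>"
  proof (rule suminf_ennreal_eq)
    show "(\<lambda>k. \<epsilon> * (1/2) ^ Suc k) sums \<epsilon>"
      using sums_mult[OF power_half_series, of \<epsilon>] by simp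
  qed (use e in auto)
  finally have "(\<Sum>j. ennreal (diamE n (G j) powr s)) \<le> ennreal \<epsilon>" .
  moreover have "(\<Union>k. A k) \<subseteq> (\<Union>j. G j)"
  proof
    fix x assume "x \<in> (\<Union>k. A k)"
    then obtain k i where "x \<in> C k i" using C(1) by blast
    then have "x \<in> G (prod_encode (k, i))" by (simp add: G_def)
    then show "x \<in> (\<Union>j. G j)" by blast
  qed
  moreover have "\<forall>j. G j \<subseteq> eucl n \<and> (\<forall>x\<in>G j. \<forall>y\<in>G j. dE n x y \<le> \<delta>)" using C(2) by (simp add: G_def)
  ultimately show "\<exists>C :: nat \<Rightarrow> (nat \<Rightarrow> real) set. (\<Union>k. A k) \<subseteq> (\<Union>i. C i) \<and>
     (\<forall>i. C i \<subseteq> eucl n \<and> (\<forall>x\<in>C i. \<forall>y\<in>C i. dE n x y \<le> \<delta>)) \<and>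
     (\<Sum>i. ennreal (diamE n (C i) powr s)) \<le> ennreal \<epsilon>" by blast
qed

section \<open>Null sets and positive measure on the curve\<close>

context loop_curve
begin

lemma kap_pow_small: "0 < e \<Longrightarrow> \<exists>l. kap ^ l < e"
  using real_arch_pow_inv[of e kap] kap01 by blast

text \<open>The image of a cell of level \<open>J\<close> has diameter at most a multiple of
  \<open>kap ^ J\<close>, whose power \<open>s\<close> is the length \<open>1 / b ^ J\<close> of the
  cell. So it is enough to cover \<open>E\<close> by an arbitrarily small proportion of
  cells.\<close>

lemma curve_null_image:
  assumes E: "E \<subseteq> {0..1}"
    and cover: "\<And>\<epsilon> J0. \<epsilon> > 0 \<Longrightarrow> \<exists>J\<ge>J0. \<exists>N. finite N \<and> (\<forall>t\<in>E. cell J t \<in> N) \<and> real (card N) \<le> \<epsilon> * real b ^ J"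
  shows "hausdorffE dim s (curve ` E) = 0"
  unfolding hausdorffE_null_iff
proof (intro allI impI)
  fix \<delta> \<epsilon> :: real assume d: "\<delta> > 0" and e: "\<epsilon> > 0"
  define c where "c = real dim * C0"
  have "0 < dim" using D_pos by (simp add: dim_def)
  then have c0: "0 < c" using C0_pos by (simp add: c_def)
  obtain J0 where J0: "kap ^ J0 < \<delta> / c" using kap_pow_small[of "\<delta> / c"] d c0 by auto
  obtain J N where J: "J0 \<le> J" and N: "finite N" "\<forall>t\<in>E. cell J t \<in> N"
     "real (card N) \<le> \<epsilon> / c powr s * real b ^ J"
    using cover[of "\<epsilon> / c powr s" J0] e c0 by auto
  define C where "C i = (if i \<in> N then curve ` {t \<in> E. cell J t = i} else {})" for i
  have dist: "dE dim x y \<le> c * kap ^ J" if "x \<in> C i" "y \<in> C i" for x y i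
  proof -
    obtain t u where tu: "x = curve t" "y = curve u" "t \<in> E" "u \<in> E" "cell J t = cell J u"
      using \<open>x \<in> C i\<close> \<open>y \<in> C i\<close> by (auto simp: C_def split: if_splits)
    have "adjt J t u" unfolding adjt_def tu(5) by simp
    moreover have "0 \<le> t" "0 \<le> u" using tu E by auto
    ultimately show ?thesis using curve_upper[of J t u] tu(1,2) by (simp add: c_def mult.assoc)
  qed
  have "kap ^ J \<le> kap ^ J0" using J kap01 by (intro power_decreasing) auto
  then have "c * kap ^ J \<le> c * kap ^ J0" using c0 by (intro mult_left_mono) auto
  moreover have "c * kap ^ J0 < \<delta>" using J0 c0 by (simp add: field_simps)
  ultimately have small: "c * kap ^ J \<le> \<delta>" by linarith
  have "diamE dim (C i) powr s \<le> c powr s / real b ^ J" for i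
  proof -
    have "diamE dim (C i) \<le> c * kap ^ J" using dist c0 kap01 by (intro diamE_le) auto
    moreover have "0 \<le> diamE dim (C i)" using dist by (rule diamE_nonneg_bounded)
    ultimately have "diamE dim (C i) powr s \<le> (c * kap ^ J) powr s" using s1 by (intro powr_mono2) auto
    also have "\<dots> = c powr s * (kap ^ J) powr s" using c0 kap01 by (simp add: powr_mult)
    finally show ?thesis by (simp add: kap_powr)
  qed
  then have each: "ennreal (diamE dim (C i) powr s) \<le> ennreal (c powr s / real b ^ J)" for i
    by (rule ennreal_leI)
  have "(\<Sum>i. ennreal (diamE dim (C i) powr s)) = (\<Sum>i\<in>N. ennreal (diamE dim (C i) powr s))"
    by (rule suminf_finite[OF N(1)]) (use s1 in \<open>auto simp: C_def diamE_def\<close>)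
  also have "\<dots> \<le> (\<Sum>i\<in>N. ennreal (c powr s / real b ^ J))" by (intro sum_mono each)
  also have "\<dots> = ennreal (real (card N) * (c powr s / real b ^ J))"
    by (simp only: sum_constant ennreal_of_nat_eq_real_of_nat) (rule ennreal_mult[symmetric], auto)
  also have "\<dots> \<le> ennreal \<epsilon>"
  proof (rule ennreal_leI)
    have "real (card N) * (c powr s / real b ^ J) \<le> \<epsilon> / c powr s * real b ^ J * (c powr s / real b ^ J)"
      using N(3) by (intro mult_right_mono) auto
    also have "\<dots> = \<epsilon>" using c0 b_gt1 by simp
    finally show "real (card N) * (c powr s / real b ^ J) \<le> \<epsilon>" .
  qed
  finally have "(\<Sum>i. ennreal (diamE dim (C i) powr s)) \<le> ennreal \<epsilon>" .
  moreover have "curve ` E \<subseteq> (\<Union>i. C i)" using N(2) by (auto simp: C_def)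
  moreover have "\<forall>i. C i \<subseteq> eucl dim \<and> (\<forall>x\<in>C i. \<forall>y\<in>C i. dE dim x y \<le> \<delta>)"
  proof (intro allI conjI ballI)
    show "C i \<subseteq> eucl dim" for i using curve_eucl by (auto simp: C_def)
    show "dE dim x y \<le> \<delta>" if "x \<in> C i" "y \<in> C i" for i x y
      using dist[OF that] small by simp
  qed
  ultimately show "\<exists>C :: nat \<Rightarrow> (nat \<Rightarrow> real) set. curve ` E \<subseteq> (\<Union>i. C i) \<and>
     (\<forall>i. C i \<subseteq> eucl dim \<and> (\<forall>x\<in>C i. \<forall>y\<in>C i. dE dim x y \<le> \<delta>)) \<and>
     (\<Sum>i. ennreal (diamE dim (C i) powr s)) \<le> ennreal \<epsilon>" by blast
qed

definition cell_nbhd :: "nat \<Rightarrow> real \<Rightarrow> real set" where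
  "cell_nbhd l t = (\<Union>B\<in>{B. adj l (cell l t) B}. {real B / real b ^ l .. (real B + 1) / real b ^ l})"

lemma cell_nbhd_measure:
  "cell_nbhd l t \<in> sets lborel" "emeasure lborel (cell_nbhd l t) \<le> ennreal (8 / real b ^ l)"
proof -
  have fin: "finite {B. adj l (cell l t) B}" "card {B. adj l (cell l t) B} \<le> 8" using adj_finite by auto
  show "cell_nbhd l t \<in> sets lborel" unfolding cell_nbhd_def using fin(1) by (intro sets.finite_UN) auto
  have "emeasure lborel (cell_nbhd l t) \<le>
     (\<Sum>B\<in>{B. adj l (cell l t) B}. emeasure lborel {real B / real b ^ l .. (real B + 1) / real b ^ l})"
    unfolding cell_nbhd_def by (rule emeasure_subadditive_finite) (use fin in auto)
  also have "\<dots> = (\<Sum>B\<in>{B. adj l (cell l t) B}. ennreal (1 / real b ^ l))"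
  proof (rule sum.cong[OF refl])
    fix B
    have "real B / real b ^ l \<le> (real B + 1) / real b ^ l" using b_gt1 by (intro divide_right_mono) auto
    then have "emeasure lborel {real B / real b ^ l .. (real B + 1) / real b ^ l} =
       ennreal ((real B + 1) / real b ^ l - real B / real b ^ l)" by simp
    then show "emeasure lborel {real B / real b ^ l .. (real B + 1) / real b ^ l} = ennreal (1 / real b ^ l)"
      by (simp add: diff_divide_distrib[symmetric])
  qed
  also have "\<dots> = ennreal (real (card {B. adj l (cell l t) B}) * (1 / real b ^ l))"
    by (simp only: sum_constant ennreal_of_nat_eq_real_of_nat) (rule ennreal_mult[symmetric], auto)
  also have "\<dots> \<le> ennreal (8 * (1 / real b ^ l))"
    using fin(2) by (intro ennreal_leI mult_right_mono) auto
  finally show "emeasure lborel (cell_nbhd l t) \<le> ennreal (8 / real b ^ l)" by simp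
qed

lemma in_cell_nbhd:
  assumes "t \<in> {0..1}" "u \<in> {0..1}" "dE dim (curve t) (curve u) < kap ^ l / 4"
  shows "u \<in> cell_nbhd l t"
proof -
  have "adj l (cell l t) (cell l u)" using curve_lower[OF assms(1,2), of l] assms(3) by (auto simp: adjt_def)
  moreover have "u \<in> {real (cell l u) / real b ^ l .. (real (cell l u) + 1) / real b ^ l}"
    using cell_bounds[of u l] assms(2) b_gt1 by (auto simp: field_simps less_imp_le)
  ultimately show ?thesis unfolding cell_nbhd_def by blast
qed

text \<open>8 adjacent cells, a factor \<open>b\<close> for one level lost, and
  \<open>4 powr s\<close> for the constant 1/4 in \<open>curve_lower\<close>.\<close>

definition KH :: real where "KH = 8 * real b * 4 powr s"

lemma KH_pos: "0 < KH" using b_gt1 by (simp add: KH_def)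

text \<open>The estimate behind the mass distribution principle for the image of Lebesgue measure.
  \<open>C\<close> is arbitrary, so its preimage is enclosed in a Borel set. The bound 1/4 places
  \<open>d\<close> below the separation at level 0.\<close>

lemma curve_preimage_measure:
  assumes C: "\<And>x y. x \<in> C \<Longrightarrow> y \<in> C \<Longrightarrow> dE dim x y \<le> d" and d: "0 \<le> d" "d < 1 / 4"
  shows "\<exists>J\<in>sets lborel. {t \<in> {0..1}. curve t \<in> C} \<subseteq> J \<and> emeasure lborel J \<le> ennreal (KH * d powr s)"
proof (cases "\<exists>t\<in>{0..1}. curve t \<in> C")
  case False then show ?thesis by (intro bexI[of _ "{}"]) auto
next
  case True
  then obtain t where t: "t \<in> {0..1}" "curve t \<in> C" by blast
  have sub: "{t \<in> {0..1}. curve t \<in> C} \<subseteq> cell_nbhd l t" if "d < kap ^ l / 4" for l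
    using in_cell_nbhd[OF t(1), of _ l] C[OF t(2)] that by force
  show ?thesis
  proof (cases "d = 0")
    case True
    define J where "J = (\<Inter>l. cell_nbhd l t)"
    have J: "J \<in> sets lborel" unfolding J_def using cell_nbhd_measure(1) by (intro sets.countable_INT) auto
    have "emeasure lborel J \<le> 0"
    proof (rule ennreal_le_epsilon)
      fix e :: real assume e: "e > 0"
      obtain l where "(1 / real b) ^ l < e / 8"
        using real_arch_pow_inv[of "e / 8" "1 / real b"] e b_gt1 by auto
      then have "8 / real b ^ l \<le> e" by (simp add: power_one_over)
      moreover have "emeasure lborel J \<le> emeasure lborel (cell_nbhd l t)"
        using cell_nbhd_measure(1) by (intro emeasure_mono) (auto simp: J_def)
      ultimately show "emeasure lborel J \<le> 0 + ennreal e"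
        using cell_nbhd_measure(2)[of l t] ennreal_leI[of "8 / real b ^ l" e] by (auto intro: order_trans)
    qed
    moreover have "{t \<in> {0..1}. curve t \<in> C} \<subseteq> J"
      unfolding J_def using sub True kap01 by (intro INT_greatest) auto
    ultimately show ?thesis using J by (intro bexI[of _ J]) auto
  next
    case False
    \<comment> \<open>The first level whose separation no longer exceeds \<open>d\<close>; at the
      level before it the whole preimage lies in one \<open>cell_nbhd\<close>.\<close>
    define m where "m = (LEAST l. kap ^ l / 4 \<le> d)"
    obtain l0 where "kap ^ l0 < 4 * d" using kap_pow_small[of "4 * d"] False d by auto
    then have "kap ^ l0 / 4 \<le> d" by simp
    then have "\<exists>l. kap ^ l / 4 \<le> d" ..
    then have m: "kap ^ m / 4 \<le> d" unfolding m_def by (rule LeastI_ex)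
    then obtain l where l: "m = Suc l" using d by (cases m) auto
    have dl: "d < kap ^ l / 4" using not_less_Least[of l "\<lambda>l. kap ^ l / 4 \<le> d"] l m_def by auto
    have "8 / real b ^ l = 8 * real b * (kap ^ Suc l) powr s" unfolding kap_powr using b_gt1 by simp
    also have "\<dots> \<le> 8 * real b * (4 * d) powr s"
      using m l kap01 s1 by (intro mult_left_mono powr_mono2) auto
    also have "\<dots> = KH * d powr s" using d by (simp add: KH_def powr_mult)
    finally have "emeasure lborel (cell_nbhd l t) \<le> ennreal (KH * d powr s)"
      using cell_nbhd_measure(2)[of l t] by (meson ennreal_leI order_trans)
    then show ?thesis using sub[OF dl] cell_nbhd_measure(1) by blast
  qed
qed

lemma curve_hausdorff_pos: "0 < hausdorffE dim s (curve ` {0..1})"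
proof -
  have "ennreal (1 / KH) \<le> hcontent dim s 1 (curve ` {0..1})"
    unfolding hcontent_def
  proof (rule INF_greatest, clarify)
    fix C :: "nat \<Rightarrow> (nat \<Rightarrow> real) set"
    assume cov: "curve ` {0..1} \<subseteq> (\<Union>i. C i)" and C: "\<forall>i. C i \<subseteq> eucl dim \<and> (\<forall>x\<in>C i. \<forall>y\<in>C i. dE dim x y \<le> 1)"
    let ?d = "\<lambda>i. diamE dim (C i)"
    have d0: "0 \<le> ?d i" for i using C by (intro diamE_nonneg_bounded[of _ _ 1]) auto
    show "ennreal (1 / KH) \<le> (\<Sum>i. ennreal (?d i powr s))"
    \<comment> \<open>A single set of diameter at least 1/4 already pays for the whole
      bound.\<close>
    proof (cases "\<exists>i. 1 / 4 \<le> ?d i")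
      case True
      then obtain i where i: "1 / 4 \<le> ?d i" by blast
      have "1 / KH \<le> 1 / 4 powr s" using b_gt1 by (simp add: KH_def field_simps)
      also have "\<dots> = (1 / 4) powr s" by (simp add: powr_divide)
      also have "\<dots> \<le> ?d i powr s" using i s1 by (intro powr_mono2) auto
      finally have "ennreal (1 / KH) \<le> ennreal (?d i powr s)" by (rule ennreal_leI)
      also have "\<dots> = (\<Sum>j\<in>{i}. ennreal (?d j powr s))" by simp
      also have "\<dots> \<le> (\<Sum>j. ennreal (?d j powr s))"
        by (rule sum_le_suminf[OF summableI]) auto
      finally show ?thesis .
    next
      case False
      have "\<exists>J\<in>sets lborel. {t \<in> {0..1}. curve t \<in> C i} \<subseteq> J \<and> emeasure lborel J \<le> ennreal (KH * ?d i powr s)" for i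
      proof (rule curve_preimage_measure)
        show "dE dim x y \<le> ?d i" if "x \<in> C i" "y \<in> C i" for x y
          by (rule dE_le_diamE[of "C i" dim 1]) (use C that in auto)
        show "?d i < 1 / 4" using False by (simp add: not_le)
      qed (rule d0)
      then obtain J where J: "\<And>i. J i \<in> sets lborel" "\<And>i. {t \<in> {0..1}. curve t \<in> C i} \<subseteq> J i"
         "\<And>i. emeasure lborel (J i) \<le> ennreal (KH * ?d i powr s)" by metis
      have "ennreal 1 = emeasure lborel {0..1::real}" by simp
      also have "\<dots> \<le> emeasure lborel (\<Union>i. J i)"
      proof (rule emeasure_mono)
        show "{0..1} \<subseteq> (\<Union>i. J i)"
        proof
          fix t :: real assume t: "t \<in> {0..1}"
          then obtain i where "curve t \<in> C i" using cov by blast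
          then show "t \<in> (\<Union>i. J i)" using J(2)[of i] t by blast
        qed
      qed (use J in auto)
      also have "\<dots> \<le> (\<Sum>i. emeasure lborel (J i))"
        using J(1) by (intro emeasure_subadditive_countably) auto
      also have "\<dots> \<le> (\<Sum>i. ennreal KH * ennreal (?d i powr s))"
        using J(3) KH_pos by (intro suminf_le) (auto simp: ennreal_mult[symmetric])
      also have "\<dots> = ennreal KH * (\<Sum>i. ennreal (?d i powr s))" by (rule ennreal_suminf_cmult)
      finally have "ennreal (1 / KH) * ennreal 1 \<le> ennreal (1 / KH) * (ennreal KH * (\<Sum>i. ennreal (?d i powr s)))"
        by (rule mult_left_mono) simp
      also have "\<dots> = (\<Sum>i. ennreal (?d i powr s))"
        using KH_pos by (simp add: mult.assoc[symmetric] ennreal_mult[symmetric])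
      finally show ?thesis by simp
    qed
  qed
  also have "\<dots> \<le> hausdorffE dim s (curve ` {0..1})"
    unfolding hausdorffE_def by (rule SUP_upper) simp
  finally show ?thesis using KH_pos by (meson ennreal_less_zero_iff less_le_trans zero_less_divide_1_iff)
qed

end

section \<open>Attouch--Wets limits\<close>

lemma excE_less_iff:
  assumes "excE n A B < ennreal e" "a \<in> A"
  shows "\<exists>b\<in>B. dE n a b < e"
proof -
  have "(INF b \<in> B. ennreal (dE n a b)) \<le> excE n A B"
    unfolding excE_def using assms(2) by (rule SUP_upper)
  then have "(INF b \<in> B. ennreal (dE n a b)) < ennreal e" using assms(1) by (rule le_less_trans)
  then obtain b where "b \<in> B" "ennreal (dE n a b) < ennreal e" by (auto simp: INF_less_iff)
  then show ?thesis by (auto simp: ennreal_less_iff)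
qed

lemma excE_le:
  assumes "\<And>a. a \<in> A \<Longrightarrow> \<exists>b\<in>B. dE n a b \<le> e"
  shows "excE n A B \<le> ennreal e"
  unfolding excE_def
proof (rule SUP_least)
  fix a assume "a \<in> A"
  then obtain b where "b \<in> B" "dE n a b \<le> e" using assms by blast
  then show "(INF b \<in> B. ennreal (dE n a b)) \<le> ennreal e"
    by (intro INF_lower2[of b]) (auto intro: ennreal_leI)
qed

lemma aw_conv_approx:
  assumes "aw_conv n Xs X" "y \<in> X" "y \<in> eucl n" "e > 0"
  shows "\<forall>\<^sub>F m in sequentially. \<exists>x\<in>Xs m. dE n y x < e"
proof -
  define r where "r = dE n origin y + 1"
  have "r > 0" using dE_nonneg[of n origin y] unfolding r_def by linarith
  then have "(\<lambda>m. excE n (X \<inter> cballE n r) (Xs m)) \<longlonglongrightarrow> 0" using assms(1) by (simp add: aw_conv_def)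
  then have "\<forall>\<^sub>F m in sequentially. excE n (X \<inter> cballE n r) (Xs m) < ennreal e"
    using assms(4) by (intro order_tendstoD(2)) auto
  then show ?thesis
  proof eventually_elim
    case (elim m)
    then show ?case by (rule excE_less_iff) (use assms in \<open>auto simp: cballE_def r_def\<close>)
  qed
qed

text \<open>For each \<open>e\<close> one good index is enough, so a point approached only along a
  subsequence already lies in the limit.\<close>

lemma aw_conv_limit:
  assumes "aw_conv n Xs X" "closedE n X" "\<And>m. Xs m \<subseteq> eucl n" "x \<in> eucl n"
    and freq: "\<And>e. e > 0 \<Longrightarrow> \<exists>\<^sub>F m in sequentially. \<exists>x'\<in>Xs m. dE n x x' < e"
  shows "x \<in> X"
proof -
  have "\<exists>y\<in>X. dE n x y < e" if e: "e > 0" for e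
  proof -
    define r where "r = dE n origin x + 1"
    have "r > 0" using dE_nonneg[of n origin x] unfolding r_def by linarith
    then have "(\<lambda>m. excE n (Xs m \<inter> cballE n r) X) \<longlonglongrightarrow> 0" using assms(1) by (simp add: aw_conv_def)
    then have ev: "\<forall>\<^sub>F m in sequentially. excE n (Xs m \<inter> cballE n r) X < ennreal (e / 2)"
      using e by (intro order_tendstoD(2)) auto
    have "\<exists>\<^sub>F m in sequentially. \<exists>x'\<in>Xs m. dE n x x' < min (e / 2) 1"
      using e by (intro freq) auto
    then have "\<exists>\<^sub>F m in sequentially. (\<exists>x'\<in>Xs m. dE n x x' < min (e / 2) 1) \<and> excE n (Xs m \<inter> cballE n r) X < ennreal (e / 2)"
      using ev by (rule frequently_eventually_frequently)
    then obtain m where m: "\<exists>x'\<in>Xs m. dE n x x' < min (e / 2) 1" "excE n (Xs m \<inter> cballE n r) X < ennreal (e / 2)"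
      using frequently_ex by blast
    then obtain x' where x': "x' \<in> Xs m" "dE n x x' < e / 2" "dE n x x' < 1" by auto
    \<comment> \<open>This is what the second bound, 1, in the choice of \<open>x'\<close> is
      for.\<close>
    have "x' \<in> Xs m \<inter> cballE n r"
      using x' assms(3)[of m] dE_triangle[of n origin x' x] by (auto simp: cballE_def r_def)
    then obtain y where "y \<in> X" "dE n x' y < e / 2" using excE_less_iff[OF m(2)] by blast
    then show ?thesis using x'(2) dE_triangle[of n x y x'] by (intro bexI[of _ y]) auto
  qed
  then show ?thesis using assms(2,4) unfolding closedE_def by blast
qed

section \<open>Separated sets and dense subsets\<close>

text \<open>Rounding to cubes of side \<open>1 / K\<close>. By \<open>restrict\<close> the values
  lie in a \<open>PiE\<close>, which is countable, and finite when the coordinates are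
  bounded.\<close>

definition grid :: "nat \<Rightarrow> nat \<Rightarrow> (nat \<Rightarrow> real) \<Rightarrow> nat \<Rightarrow> int" where
  "grid n K x = restrict (\<lambda>i. \<lfloor>x i * real K\<rfloor>) {..<n}"

lemma grid_eq_dist:
  assumes "grid n K x = grid n K y" "K > 0"
  shows "dE n x y \<le> real n * (1 / real K)"
proof (rule dE_le_const)
  fix i assume i: "i < n"
  have "grid n K x i = grid n K y i" using assms by simp
  then have "\<lfloor>x i * real K\<rfloor> = \<lfloor>y i * real K\<rfloor>" using i by (simp add: grid_def)
  then have "\<bar>x i * real K - y i * real K\<bar> \<le> 1" by linarith
  then have "\<bar>x i - y i\<bar> * real K \<le> 1" by (simp add: abs_mult flip: left_diff_distrib)
  then show "\<bar>x i - y i\<bar> \<le> 1 / real K" using assms(2) by (simp add: field_simps)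
qed

text \<open>Pigeonhole: a cube of small enough side holds at most one point of
  \<open>P\<close>.\<close>

lemma separated_card_bound:
  assumes "\<delta> > 0"
  shows "\<exists>M. \<forall>P. (\<forall>x\<in>P. dE n x origin \<le> R) \<longrightarrow>
     (\<forall>x\<in>P. \<forall>y\<in>P. x \<noteq> y \<longrightarrow> \<delta> \<le> dE n x y) \<longrightarrow> finite P \<and> card P \<le> M"
proof -
  obtain K where K: "real K > real n / \<delta>" using reals_Archimedean2 by blast
  have K0: "K > 0" using K assms by (cases K) (auto simp: field_simps divide_less_0_iff)
  have Kd: "real n * (1 / real K) < \<delta>" using K K0 assms by (simp add: field_simps)
  define B where "B = PiE {..<n} (\<lambda>_. {\<lfloor>- (R * real K)\<rfloor> .. \<lceil>R * real K\<rceil>})"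
  have finB: "finite B" unfolding B_def by (intro finite_PiE) auto
  show ?thesis
  proof (intro exI[of _ "card B"] allI impI)
    fix P assume P0: "\<forall>x\<in>P. dE n x origin \<le> R" "\<forall>x\<in>P. \<forall>y\<in>P. x \<noteq> y \<longrightarrow> \<delta> \<le> dE n x y"
    then have P: "\<And>x. x \<in> P \<Longrightarrow> dE n x origin \<le> R"
      "\<And>x y. x \<in> P \<Longrightarrow> y \<in> P \<Longrightarrow> x \<noteq> y \<Longrightarrow> \<delta> \<le> dE n x y" by blast+
    have inj: "inj_on (grid n K) P"
    proof (rule inj_onI, rule ccontr)
      fix x y assume "x \<in> P" "y \<in> P" "grid n K x = grid n K y" "x \<noteq> y"
      then show False using grid_eq_dist[of n K x y] K0 Kd P(2)[of x y] by auto
    qed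
    have sub: "grid n K ` P \<subseteq> B"
    proof clarify
      fix x assume "x \<in> P"
      have "- (R * real K) \<le> x i * real K \<and> x i * real K \<le> R * real K" if "i < n" for i
      proof -
        have "\<bar>x i\<bar> \<le> R" using coord_le_dE[OF that, of x origin] P(1)[OF \<open>x \<in> P\<close>] by (simp add: origin_def)
        then have "\<bar>x i\<bar> * real K \<le> R * real K" by (intro mult_right_mono) auto
        then have "\<bar>x i * real K\<bar> \<le> R * real K" by (simp add: abs_mult)
        then show ?thesis by linarith
      qed
      then show "grid n K x \<in> B"
        unfolding B_def grid_def restrict_PiE_iff
        by (auto intro: floor_mono order_trans[OF floor_le_ceiling ceiling_mono])
    qed
    then show "finite P \<and> card P \<le> card B"
      using inj finB by (meson card_inj_on_le finite_imageD finite_subset)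
  qed
qed

text \<open>Choose one point of \<open>A\<close> in every occupied cube of every mesh.\<close>

lemma countable_dense_subset:
  obtains S where "countable S" "S \<subseteq> A" "\<And>x e. x \<in> A \<Longrightarrow> e > 0 \<Longrightarrow> \<exists>y\<in>S. dE n x y \<le> e"
proof -
  define S where "S = (\<Union>K. inv_into A (grid n K) ` (grid n K ` A))"
  have cnt: "countable (grid n K ` A)" for K
  proof -
    have "grid n K ` A \<subseteq> PiE {..<n} (\<lambda>_. UNIV)"
      by (rule image_subsetI) (simp add: grid_def)
    moreover have "countable (PiE {..<n} (\<lambda>_. UNIV :: int set))" by (intro countable_PiE) auto
    ultimately show ?thesis by (rule countable_subset)
  qed
  have "countable S" unfolding S_def by (rule countable_UN[OF countableI_type countable_image[OF cnt]])
  moreover have "S \<subseteq> A" unfolding S_def by (auto intro: inv_into_into)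
  moreover have "\<exists>y\<in>S. dE n x y \<le> e" if "x \<in> A" "e > 0" for x e
  proof -
    obtain K where K: "real K > real n / e" using reals_Archimedean2 by blast
    have K0: "K > 0" using K that by (cases K) (auto simp: field_simps divide_less_0_iff)
    let ?y = "inv_into A (grid n K) (grid n K x)"
    have "?y \<in> S" unfolding S_def using that by blast
    moreover have "grid n K x = grid n K ?y" using that by (simp add: f_inv_into_f)
    then have "dE n x ?y \<le> real n * (1 / real K)" using K0 by (rule grid_eq_dist)
    moreover have "real n * (1 / real K) < e" using K K0 that by (simp add: field_simps)
    ultimately show ?thesis by (intro bexI[of _ ?y]) auto
  qed
  ultimately show thesis using that by blast
qed

section \<open>Similarities are onto\<close>

text \<open>The orbit of a point outside the image of an isometry fixing the origin would be an
  infinite separated bounded set.\<close>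

lemma isometry_surj:
  assumes g: "\<And>x. x \<in> eucl n \<Longrightarrow> g x \<in> eucl n" "\<And>x y. x \<in> eucl n \<Longrightarrow> y \<in> eucl n \<Longrightarrow> dE n (g x) (g y) = dE n x y"
    and g0: "g origin = origin" and y: "y \<in> eucl n"
  shows "\<exists>x\<in>eucl n. g x = y"
proof -
  have it: "(g ^^ k) x \<in> eucl n" if "x \<in> eucl n" for k x using that g(1) by (induction k) auto
  have it_iso: "dE n ((g ^^ k) x) ((g ^^ k) x') = dE n x x'" if "x \<in> eucl n" "x' \<in> eucl n" for k x x'
    using that it g(2) by (induction k) auto
  have it0: "(g ^^ k) origin = origin" for k using g0 by (induction k) auto
  have nrm: "dE n ((g ^^ k) y) origin = dE n y origin" for k
    using it_iso[OF y, of origin k] it0 by simp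
  have nrm': "\<And>k. dE n ((g ^^ k) y) origin \<le> dE n y origin" by (simp add: nrm)
  obtain \<sigma> l where \<sigma>: "strict_mono \<sigma>" "l \<in> eucl n" "(\<lambda>m. dE n ((g ^^ \<sigma> m) y) l) \<longlonglongrightarrow> 0"
    using bounded_seq_convergent[of n "\<lambda>k. (g ^^ k) y", OF nrm'] by metis
  \<comment> \<open>Recurrence of the orbit: cancelling the common iterate
    \<open>g ^^ \<sigma> M\<close> from two iterates close to each other brings a point of the image
    of \<open>g\<close> close to \<open>y\<close>.\<close>
  have "\<exists>d. dE n (g ((g ^^ d) y)) y < 1 / real (Suc m)" for m
  proof -
    have pos: "0 < 1 / (2 * real (Suc m))" by simp
    obtain M where M: "\<And>k. k \<ge> M \<Longrightarrow> dE n ((g ^^ \<sigma> k) y) l < 1 / (2 * real (Suc m))"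
      using order_tendstoD(2)[OF \<sigma>(3) pos] unfolding eventually_sequentially by blast
    have lt: "\<sigma> M < \<sigma> (Suc M)" using \<sigma>(1) by (simp add: strict_mono_def)
    then obtain d where d: "\<sigma> (Suc M) = \<sigma> M + Suc d" using less_imp_Suc_add by auto
    have "dE n ((g ^^ Suc d) y) y = dE n ((g ^^ \<sigma> M) ((g ^^ Suc d) y)) ((g ^^ \<sigma> M) y)"
      using it_iso[OF it[OF y, of "Suc d"] y, of "\<sigma> M"] by simp
    also have "\<dots> = dE n ((g ^^ \<sigma> (Suc M)) y) ((g ^^ \<sigma> M) y)"
      unfolding d funpow_add by simp
    also have "\<dots> \<le> dE n ((g ^^ \<sigma> (Suc M)) y) l + dE n ((g ^^ \<sigma> M) y) l"
      using dE_triangle[of n _ "(g ^^ \<sigma> M) y" l] dE_commute by metis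
    also have "\<dots> < 1 / (2 * real (Suc m)) + 1 / (2 * real (Suc m))"
      by (intro add_strict_mono M) auto
    also have "\<dots> = 1 / real (Suc m)" by (simp add: field_simps)
    finally show ?thesis by (intro exI[of _ d]) simp
  qed
  then obtain d where d: "\<And>m. dE n (g ((g ^^ d m) y)) y < 1 / real (Suc m)" by metis
  obtain \<tau> x where \<tau>: "strict_mono \<tau>" "x \<in> eucl n" "(\<lambda>m. dE n ((g ^^ d (\<tau> m)) y) x) \<longlonglongrightarrow> 0"
    using bounded_seq_convergent[of n "\<lambda>k. (g ^^ d k) y", OF nrm'] by metis
  have "(\<lambda>m. dE n (g ((g ^^ d (\<tau> m)) y)) (g x)) \<longlonglongrightarrow> 0"
    using \<tau>(3) g(2)[OF it[OF y] \<tau>(2)] by simp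
  moreover have "(\<lambda>m. dE n (g ((g ^^ d (\<tau> m)) y)) y) \<longlonglongrightarrow> 0"
  proof (rule tendsto_sandwich[OF always_eventually always_eventually tendsto_const])
    have "(\<lambda>m. 1 / real (Suc m)) \<longlonglongrightarrow> 0" by (rule lim_1_over_n[THEN LIMSEQ_Suc])
    then show "(\<lambda>m. 1 / real (Suc (\<tau> m))) \<longlonglongrightarrow> 0"
      using LIMSEQ_subseq_LIMSEQ[OF _ \<tau>(1)] by (simp add: o_def)
    show "\<forall>m. dE n (g ((g ^^ d (\<tau> m)) y)) y \<le> 1 / real (Suc (\<tau> m))" using d less_imp_le by blast
  qed simp
  ultimately have "g x = y" using dE_limit_unique g(1)[OF \<tau>(2)] y by metis
  then show ?thesis using \<tau>(2) by blast
qed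

text \<open>\<open>similarityE\<close> does not ask for onto maps, but \<open>stop_separated\<close>
  has to pull points back into \<open>U\<close>.\<close>

lemma similarity_surj:
  assumes f: "\<And>x. x \<in> eucl n \<Longrightarrow> f x \<in> eucl n" "\<And>x y. x \<in> eucl n \<Longrightarrow> y \<in> eucl n \<Longrightarrow> dE n (f x) (f y) = r * dE n x y"
    and r: "r > 0" and y: "y \<in> eucl n"
  shows "\<exists>x\<in>eucl n. f x = y"
proof -
  define g where "g x i = (f x i - f origin i) / r" for x i
  have ge: "g x = (\<lambda>i. (f x i - f origin i) / r)" for x by (simp add: g_def fun_eq_iff)
  have fo: "f origin \<in> eucl n" using f(1) by simp
  have "\<exists>x\<in>eucl n. g x = (\<lambda>i. (y i - f origin i) / r)"
  proof (rule isometry_surj)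
    show "g x \<in> eucl n" if "x \<in> eucl n" for x
      unfolding ge using f(1)[OF that] fo by (rule blowup_eucl)
    show "dE n (g x) (g x') = dE n x x'" if "x \<in> eucl n" "x' \<in> eucl n" for x x'
      unfolding ge dE_scale[OF r] using f(2)[OF that] r by simp
    show "g origin = origin" by (simp add: ge origin_def fun_eq_iff)
    show "(\<lambda>i. (y i - f origin i) / r) \<in> eucl n" using y fo by (rule blowup_eucl)
  qed
  then obtain x where x: "x \<in> eucl n" "g x = (\<lambda>i. (y i - f origin i) / r)" by blast
  have "f x i = y i" for i using fun_cong[OF x(2), of i] r by (simp add: g_def)
  then show ?thesis using x(1) by blast
qed

section \<open>Self-similar sets\<close>

locale osc_ifs =
  fixes n k :: nat and \<phi> :: "nat \<Rightarrow> (nat \<Rightarrow> real) \<Rightarrow> nat \<Rightarrow> real" and \<rho> :: "nat \<Rightarrow> real"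
    and Q U :: "(nat \<Rightarrow> real) set"
  assumes phi_eucl: "i < k \<Longrightarrow> x \<in> eucl n \<Longrightarrow> \<phi> i x \<in> eucl n"
    and phi_sim: "i < k \<Longrightarrow> x \<in> eucl n \<Longrightarrow> y \<in> eucl n \<Longrightarrow> dE n (\<phi> i x) (\<phi> i y) = \<rho> i * dE n x y"
    and rho01: "i < k \<Longrightarrow> 0 < \<rho> i" "i < k \<Longrightarrow> \<rho> i < 1"
    and Q: "compactE n Q" "Q \<noteq> {}" "Q = (\<Union>i<k. \<phi> i ` Q)"
    and U: "openE n U" "U \<noteq> {}" "i < k \<Longrightarrow> \<phi> i ` U \<subseteq> U"
       "i < k \<Longrightarrow> j < k \<Longrightarrow> i \<noteq> j \<Longrightarrow> \<phi> i ` U \<inter> \<phi> j ` U = {}"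
begin

primrec wmap :: "nat list \<Rightarrow> (nat \<Rightarrow> real) \<Rightarrow> nat \<Rightarrow> real" where
  "wmap [] = (\<lambda>x. x)"
| "wmap (i # w) = (\<lambda>x. \<phi> i (wmap w x))"

primrec wrat :: "nat list \<Rightarrow> real" where
  "wrat [] = 1"
| "wrat (i # w) = \<rho> i * wrat w"

definition words :: "nat list set" where "words = lists {..<k}"

lemma words_simps [simp]: "[] \<in> words" "i # w \<in> words \<longleftrightarrow> i < k \<and> w \<in> words"
  "v @ w \<in> words \<longleftrightarrow> v \<in> words \<and> w \<in> words"
  by (auto simp: words_def)

lemma wmap_eucl: "w \<in> words \<Longrightarrow> x \<in> eucl n \<Longrightarrow> wmap w x \<in> eucl n"
  by (induction w) (auto intro: phi_eucl)

lemma wmap_sim: "w \<in> words \<Longrightarrow> x \<in> eucl n \<Longrightarrow> y \<in> eucl n \<Longrightarrow> dE n (wmap w x) (wmap w y) = wrat w * dE n x y"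
  by (induction w) (auto simp: phi_sim wmap_eucl)

lemma wmap_append: "wmap (v @ w) x = wmap v (wmap w x)"
  by (induction v) auto

lemma wrat_append: "wrat (v @ w) = wrat v * wrat w"
  by (induction v) auto

lemma wrat_pos: "w \<in> words \<Longrightarrow> 0 < wrat w"
  by (induction w) (auto simp: rho01)

lemma wrat_le1: "w \<in> words \<Longrightarrow> wrat w \<le> 1"
proof (induction w)
  case (Cons i w)
  then have "\<rho> i * wrat w \<le> 1 * 1" using rho01[of i] wrat_pos[of w] by (intro mult_mono) auto
  then show ?case by simp
qed simp

lemma Q_eucl: "x \<in> Q \<Longrightarrow> x \<in> eucl n"
  using Q(1) by (auto simp: compactE_def)

lemma phi_Q: "i < k \<Longrightarrow> x \<in> Q \<Longrightarrow> \<phi> i x \<in> Q"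
  using Q(3) by blast

lemma wmap_Q: "w \<in> words \<Longrightarrow> x \<in> Q \<Longrightarrow> wmap w x \<in> Q"
  by (induction w) (auto intro: phi_Q)

lemma k_pos: "0 < k" using Q by (cases k) auto

definition rmin :: real where "rmin = Min (\<rho> ` {..<k})"
definition rmax :: real where "rmax = Max (\<rho> ` {..<k})"

lemma rmin: "0 < rmin" "i < k \<Longrightarrow> rmin \<le> \<rho> i"
proof -
  show "0 < rmin" unfolding rmin_def using k_pos rho01 by (subst Min_gr_iff) auto
  show "i < k \<Longrightarrow> rmin \<le> \<rho> i" unfolding rmin_def by (intro Min_le) auto
qed

lemma rmax: "rmax < 1" "0 \<le> rmax" "i < k \<Longrightarrow> \<rho> i \<le> rmax"
proof -
  show le: "i < k \<Longrightarrow> \<rho> i \<le> rmax" for i unfolding rmax_def by (intro Max_ge) auto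
  show "rmax < 1" unfolding rmax_def using k_pos rho01 by (subst Max_less_iff) auto
  show "0 \<le> rmax" using le[OF k_pos] rho01[OF k_pos] by linarith
qed

lemma wrat_le_pow: "w \<in> words \<Longrightarrow> wrat w \<le> rmax ^ length w"
proof (induction w)
  case (Cons i w)
  then show ?case using rmax rho01[of i] wrat_pos[of w] by (auto intro!: mult_mono)
qed simp

text \<open>Moran's stopping words: the ratio drops to \<open>r\<close> or below with the last
  letter, so the cylinder has size comparable with \<open>r\<close>.\<close>

definition stop :: "real \<Rightarrow> nat list \<Rightarrow> bool" where
  "stop r w \<longleftrightarrow> w \<in> words \<and> w \<noteq> [] \<and> wrat w \<le> r \<and> r < wrat (butlast w)"

text \<open>Lengthen the word letter by letter. If it never stopped, its ratio would stay above
  \<open>r\<close> although it is at most \<open>rmax ^ m\<close>.\<close>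

lemma stop_exists:
  assumes "x \<in> Q" "0 < r" "r < 1"
  shows "\<exists>w. stop r w \<and> x \<in> wmap w ` Q"
proof (rule ccontr)
  assume none: "\<nexists>w. stop r w \<and> x \<in> wmap w ` Q"
  have "\<exists>w\<in>words. length w = m \<and> x \<in> wmap w ` Q \<and> r < wrat w" for m
  proof (induction m)
    case 0 show ?case using assms by (intro bexI[of _ "[]"]) auto
  next
    case (Suc m)
    then obtain w q where w: "w \<in> words" "length w = m" "x = wmap w q" "q \<in> Q" "r < wrat w" by blast
    obtain i q' where i: "i < k" "q' \<in> Q" "q = \<phi> i q'" using Q(3) w(4) by blast
    have x: "x \<in> wmap (w @ [i]) ` Q" using w i by (auto simp: wmap_append)
    have "r < wrat (w @ [i])"
    proof (rule ccontr)
      assume "\<not> r < wrat (w @ [i])"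
      then have "stop r (w @ [i])" using w i by (auto simp: stop_def)
      then show False using none x by blast
    qed
    then show ?case using w i x by (intro bexI[of _ "w @ [i]"]) auto
  qed
  then have "r < rmax ^ m" for m using wrat_le_pow by (metis less_le_trans)
  moreover obtain m where "rmax ^ m < r" using real_arch_pow_inv[OF assms(2) rmax(1)] by blast
  ultimately show False using less_asym by blast
qed

lemma stop_lower: assumes "stop r w" "0 < r" shows "rmin * r \<le> wrat w"
proof -
  have w: "w = butlast w @ [last w]" using assms by (simp add: stop_def)
  then have "butlast w @ [last w] \<in> words" using assms by (simp add: stop_def)
  then have "last w < k" by simp
  have "rmin * r \<le> \<rho> (last w) * wrat (butlast w)"
    using rmin \<open>last w < k\<close> assms by (intro mult_mono) (auto simp: stop_def rho01 less_imp_le)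
  moreover have "wrat w = wrat (butlast w) * \<rho> (last w)" by (subst w) (simp add: wrat_append)
  ultimately show ?thesis by (simp add: mult.commute)
qed

lemma stop_antichain:
  assumes "stop r w" "stop r v" "prefix w v" shows "w = v"
proof (rule ccontr)
  assume "w \<noteq> v"
  then obtain u where u: "v = w @ u" "u \<noteq> []" using assms(3) by (auto simp: prefix_def)
  have bw: "butlast v = w @ butlast u" using u by (simp add: butlast_append)
  have "u = butlast u @ [last u]" using u by simp
  moreover have "u \<in> words" using assms(2) u by (simp add: stop_def)
  ultimately have "butlast u \<in> words" by (metis words_simps(3))
  then have "wrat (butlast v) \<le> wrat w"
    unfolding bw wrat_append using wrat_le1 wrat_pos[of w] assms(1) by (simp add: stop_def mult_left_le)
  then show False using assms by (simp add: stop_def)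
qed

lemma U_eucl: "x \<in> U \<Longrightarrow> x \<in> eucl n" using U(1) by (auto simp: openE_def)

lemma wmap_U: "w \<in> words \<Longrightarrow> x \<in> U \<Longrightarrow> wmap w x \<in> U"
  by (induction w) (use U(3) in auto)

text \<open>The open set condition applies at the first letter where the words differ, and the maps
  of the common prefix are injective.\<close>

lemma wmap_disjoint:
  assumes "w \<in> words" "v \<in> words" "\<not> prefix w v" "\<not> prefix v w" "x \<in> U" "y \<in> U"
  shows "wmap w x \<noteq> wmap v y"
  using assms(1-4)
proof (induction w arbitrary: v)
  case (Cons a w)
  then obtain c v' where v: "v = c # v'" by (cases v) auto
  have mem: "a < k" "w \<in> words" "c < k" "v' \<in> words" using Cons.prems v by auto
  show ?case
  proof (cases "a = c")
    case True
    then have ne: "wmap w x \<noteq> wmap v' y" using Cons v by auto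
    have e: "wmap w x \<in> eucl n" "wmap v' y \<in> eucl n" using mem assms(5,6) wmap_eucl U_eucl by auto
    then have "dE n (wmap w x) (wmap v' y) \<noteq> 0" using ne dE_eq_0 by blast
    then have "dE n (\<phi> a (wmap w x)) (\<phi> a (wmap v' y)) \<noteq> 0" using phi_sim[OF mem(1) e] rho01(1)[OF mem(1)] by simp
    then show ?thesis using v True by auto
  next
    case False
    have "\<phi> a (wmap w x) \<in> \<phi> a ` U" "\<phi> c (wmap v' y) \<in> \<phi> c ` U" using wmap_U mem assms(5,6) by auto
    then have "\<phi> a (wmap w x) \<noteq> \<phi> c (wmap v' y)" using U(4)[OF mem(1,3) False] by (metis disjoint_iff)
    then show ?thesis using v by simp
  qed
qed simp

lemma wmap_surj: "w \<in> words \<Longrightarrow> y \<in> eucl n \<Longrightarrow> \<exists>x\<in>eucl n. wmap w x = y"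
  by (rule similarity_surj[OF _ wmap_sim wrat_pos]) (auto intro: wmap_eucl)

text \<open>Stopping words are incomparable, so their images of \<open>U\<close> are disjoint, and
  each contains a ball around the image of \<open>u\<close> of radius comparable with
  \<open>r\<close>. In place of the ball, \<open>wmap v u\<close> is pulled back along
  \<open>wmap w\<close>; if it were too close, its preimage would lie in \<open>U\<close>.\<close>

lemma stop_separated:
  obtains u \<eta> where "u \<in> eucl n" "\<eta> > 0"
    "\<And>r w v. stop r w \<Longrightarrow> stop r v \<Longrightarrow> w \<noteq> v \<Longrightarrow> 0 < r \<Longrightarrow> \<eta> * r \<le> dE n (wmap w u) (wmap v u)"
proof -
  obtain u where u: "u \<in> U" using U(2) by blast
  obtain e where e: "e > 0" "{y \<in> eucl n. dE n u y < e} \<subseteq> U" using U(1) u unfolding openE_def by blast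
  have ue: "u \<in> eucl n" using U_eucl[OF u] .
  have "e * rmin * r \<le> dE n (wmap w u) (wmap v u)"
    if st: "stop r w" "stop r v" "w \<noteq> v" "0 < r" for r w v
  proof (rule ccontr)
    assume "\<not> ?thesis"
    then have lt: "dE n (wmap w u) (wmap v u) < e * (rmin * r)" by (simp add: mult.assoc)
    have wv: "w \<in> words" "v \<in> words" using st by (auto simp: stop_def)
    obtain x where x: "x \<in> eucl n" "wmap w x = wmap v u" using wmap_surj[OF wv(1) wmap_eucl[OF wv(2) ue]] by blast
    have "wrat w * dE n u x < e * wrat w"
      using lt stop_lower[OF st(1,4)] e(1) wmap_sim[OF wv(1) ue x(1)] x(2)
      by (smt (verit) mult_left_mono)
    then have "dE n u x < e" using wrat_pos[OF wv(1)] by (simp add: mult.commute)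
    then have "x \<in> U" using e x(1) by auto
    moreover have "\<not> prefix w v" "\<not> prefix v w" using stop_antichain st by blast+
    ultimately show False using wmap_disjoint[OF wv, of x u] u x(2) by blast
  qed
  then show thesis using that[of u "e * rmin"] ue e rmin by simp
qed

text \<open>Blown up by \<open>1 / r\<close> around \<open>z\<close>, the images of the reference
  point \<open>u\<close> are separated and lie in a fixed ball, so the bound depends on neither
  \<open>r\<close> nor \<open>z\<close>.\<close>

lemma stop_count:
  shows "\<exists>M :: nat. \<forall>r>0. \<forall>z\<in>eucl n.
    finite {w. stop r w \<and> (\<exists>x\<in>wmap w ` Q. dE n x z \<le> R * r)} \<and>
    card {w. stop r w \<and> (\<exists>x\<in>wmap w ` Q. dE n x z \<le> R * r)} \<le> M"
proof -
  obtain u \<eta> where u: "u \<in> eucl n" and \<eta>: "\<eta> > 0"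
    and sep: "\<And>r w v. stop r w \<Longrightarrow> stop r v \<Longrightarrow> w \<noteq> v \<Longrightarrow> 0 < r \<Longrightarrow> \<eta> * r \<le> dE n (wmap w u) (wmap v u)"
    using stop_separated by metis
  obtain B where B: "\<And>x. x \<in> Q \<Longrightarrow> dE n x origin \<le> B" using compactE_bounded[OF Q(1)] by blast
  define D where "D = dE n u origin + B"
  have D: "dE n u q \<le> D" if "q \<in> Q" for q
    using B[OF that] dE_triangle[of n u q origin] by (simp add: D_def dE_commute[of n origin])
  obtain M where M: "\<forall>P. (\<forall>x\<in>P. dE n x origin \<le> R + D) \<longrightarrow>
     (\<forall>x\<in>P. \<forall>y\<in>P. x \<noteq> y \<longrightarrow> \<eta> \<le> dE n x y) \<longrightarrow> finite P \<and> card P \<le> M"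
    using separated_card_bound[OF \<eta>, of n "R + D"] by (elim exE)
  show ?thesis
  proof (intro exI[of _ M] allI impI ballI)
    fix r z assume r: "0 < (r :: real)" and z: "z \<in> eucl n"
    define S where "S = {w. stop r w \<and> (\<exists>x\<in>wmap w ` Q. dE n x z \<le> R * r)}"
    define h where "h w = (\<lambda>i. (wmap w u i - z i) / r)" for w
    have hd: "dE n (h w) (h v) = dE n (wmap w u) (wmap v u) / r" for w v unfolding h_def by (rule dE_scale[OF r])
    have sep': "\<eta> \<le> dE n (h w) (h v)" if "w \<in> S" "v \<in> S" "w \<noteq> v" for w v
      unfolding hd using sep[of r w v] that r by (simp add: S_def field_simps)
    have inj: "inj_on h S"
    proof (rule inj_onI, rule ccontr)
      fix w v assume "w \<in> S" "v \<in> S" "h w = h v" "w \<noteq> v"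
      then show False using sep'[of w v] \<eta> by simp
    qed
    have "finite (h ` S) \<and> card (h ` S) \<le> M"
    proof (rule M[rule_format])
      fix x assume "x \<in> h ` S"
      then obtain w q where w: "x = h w" "stop r w" "q \<in> Q" "dE n (wmap w q) z \<le> R * r" unfolding S_def by blast
      then have ww: "w \<in> words" by (simp add: stop_def)
      have "origin = (\<lambda>i. (z i - z i) / r)" by (simp add: origin_def)
      then have "dE n x origin = dE n (wmap w u) z / r" unfolding w(1) h_def using dE_scale[OF r, of n "wmap w u" z z] by simp
      also have "dE n (wmap w u) z \<le> dE n (wmap w u) (wmap w q) + dE n (wmap w q) z" by (rule dE_triangle)
      also have "dE n (wmap w u) (wmap w q) = wrat w * dE n u q" using ww u w(3) Q_eucl by (intro wmap_sim) auto
      also have "wrat w * dE n u q \<le> r * D" using w(2) D[OF w(3)] r by (intro mult_mono) (auto simp: stop_def)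
      also have "(r * D + dE n (wmap w q) z) / r \<le> (r * D + R * r) / r" using w(4) r by (intro divide_right_mono) auto
      also have "\<dots> = R + D" using r by (simp add: field_simps)
      finally show "dE n x origin \<le> R + D" using r by (simp add: divide_right_mono)
    qed (use sep' in auto)
    then show "finite {w. stop r w \<and> (\<exists>x\<in>wmap w ` Q. dE n x z \<le> R * r)} \<and>
      card {w. stop r w \<and> (\<exists>x\<in>wmap w ` Q. dE n x z \<le> R * r)} \<le> M"
      unfolding S_def[symmetric] using inj by (simp add: card_image finite_image_iff)
  qed
qed

text \<open>Blown-up cylinders are similar copies of \<open>Q\<close> with ratios between
  \<open>lo\<close> and \<open>hi\<close>, and this survives pointwise limits. All numbers
  \<open>j\<close> share one subsequence because a piece of a tangent is covered by several
  cylinders at once.\<close>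

lemma cylinder_limits:
  fixes e :: "nat \<Rightarrow> nat \<Rightarrow> nat list"
  assumes e: "\<And>m j. e m j \<in> words" "\<And>m j. lo * r m \<le> wrat (e m j)" "\<And>m j. wrat (e m j) \<le> hi * r m"
    and lo: "0 < lo" and r: "\<And>m. 0 < r m" and z: "z \<in> eucl n"
    and bdd: "\<And>j. \<exists>B. \<forall>m. \<forall>p\<in>Q. dE n (\<lambda>i. (wmap (e m j) p i - z i) / r m) origin \<le> B"
    and two: "a \<in> Q" "a' \<in> Q" "a \<noteq> a'"
  shows "\<exists>\<sigma> F. strict_mono (\<sigma> :: nat \<Rightarrow> nat) \<and> (\<forall>j. \<forall>p\<in>Q. F j p \<in> eucl n) \<and>
    (\<forall>j. \<forall>p\<in>Q. (\<lambda>m. dE n (\<lambda>i. (wmap (e (\<sigma> m) j) p i - z i) / r (\<sigma> m)) (F j p)) \<longlonglongrightarrow> 0) \<and>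
    (\<forall>j. \<exists>c>0. \<forall>p\<in>Q. \<forall>q\<in>Q. dE n (F j p) (F j q) = c * dE n p q)"
proof -
  obtain S where S: "countable S" "S \<subseteq> Q" "\<And>x \<epsilon>. x \<in> Q \<Longrightarrow> \<epsilon> > 0 \<Longrightarrow> \<exists>y\<in>S. dE n x y \<le> \<epsilon>"
    using countable_dense_subset[of Q n] by blast
  define f where "f m = (\<lambda>(p,j). (\<lambda>i. (wmap (e m j) p i - z i) / r m))" for m
  have fsim: "dE n (f m (p,j)) (f m (q,j)) = wrat (e m j) / r m * dE n p q" if "p \<in> Q" "q \<in> Q" for m j p q
    unfolding f_def using dE_scale[OF r] wmap_sim[OF e(1)] Q_eucl that by simp
  have rat: "lo \<le> wrat (e m j) / r m" "wrat (e m j) / r m \<le> hi" for m j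
    using e(2,3)[of m j] r[of m] by (simp_all add: field_simps)
  have hi: "0 < hi" using rat[of 0 0] lo by linarith
  obtain \<sigma> F where \<sigma>: "strict_mono \<sigma>" and F: "\<And>x. x \<in> Q \<times> UNIV \<Longrightarrow> F x \<in> eucl n"
    "\<And>x. x \<in> Q \<times> UNIV \<Longrightarrow> (\<lambda>m. dE n (f (\<sigma> m) x) (F x)) \<longlonglongrightarrow> 0"
  proof (rule pointwise_compactness[of "S \<times> UNIV" "Q \<times> UNIV" n f])
    show "countable (S \<times> (UNIV :: nat set))" using S by (intro countable_SIGMA) auto
    show "S \<times> (UNIV :: nat set) \<subseteq> Q \<times> UNIV" using S by auto
    fix x :: "(nat \<Rightarrow> real) \<times> nat" and \<epsilon> :: real assume x: "x \<in> Q \<times> UNIV" and \<epsilon>: "\<epsilon> > 0"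
    obtain p j where pj: "x = (p,j)" "p \<in> Q" using x by auto
    obtain y where y: "y \<in> S" "dE n p y \<le> \<epsilon> / hi" using S(3)[OF pj(2), of "\<epsilon> / hi"] \<epsilon> hi by auto
    have "dE n (f m (p,j)) (f m (y,j)) \<le> \<epsilon>" for m
    proof -
      have "y \<in> Q" using y S by auto
      then have "dE n (f m (p,j)) (f m (y,j)) = wrat (e m j) / r m * dE n p y" using fsim pj by auto
      also have "\<dots> \<le> hi * (\<epsilon> / hi)" using rat[where m=m and j=j] y(2) lo hi by (intro mult_mono) auto
      finally show ?thesis using hi by simp
    qed
    then show "\<exists>y\<in>S \<times> UNIV. \<forall>m. dE n (f m x) (f m y) \<le> \<epsilon>" using y(1) pj(1) by (intro bexI[of _ "(y,j)"]) auto
  next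
    fix y :: "(nat \<Rightarrow> real) \<times> nat" assume "y \<in> S \<times> UNIV"
    then obtain p j where "y = (p,j)" "p \<in> Q" using S by auto
    then show "\<exists>B. \<forall>m. dE n (f m y) origin \<le> B" using bdd[of j] by (auto simp: f_def)
  qed blast
  have "\<exists>c>0. \<forall>p\<in>Q. \<forall>q\<in>Q. dE n (F (p,j)) (F (q,j)) = c * dE n p q" for j
  proof -
    have d0: "dE n a a' \<noteq> 0" using two dE_eq_0 Q_eucl by blast
    \<comment> \<open>Two distinct points of \<open>Q\<close> make the limit ratio readable; it is
      at least \<open>lo\<close> and therefore positive.\<close>
    define c where "c = dE n (F (a,j)) (F (a',j)) / dE n a a'"
    have lim: "(\<lambda>m. wrat (e (\<sigma> m) j) / r (\<sigma> m) * dE n p q) \<longlonglongrightarrow> dE n (F (p,j)) (F (q,j))"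
      if "p \<in> Q" "q \<in> Q" for p q
      using tendsto_dE[OF F(2) F(2), of "(p,j)" "(q,j)"] that fsim by simp
    have "(\<lambda>m. wrat (e (\<sigma> m) j) / r (\<sigma> m) * dE n a a' / dE n a a') \<longlonglongrightarrow> c"
      unfolding c_def using lim[OF two(1,2)] d0 by (intro tendsto_divide) auto
    then have c: "(\<lambda>m. wrat (e (\<sigma> m) j) / r (\<sigma> m)) \<longlonglongrightarrow> c" using d0 by simp
    have "lo \<le> c" by (rule LIMSEQ_le_const[OF c]) (use rat in blast)
    moreover have "dE n (F (p,j)) (F (q,j)) = c * dE n p q" if "p \<in> Q" "q \<in> Q" for p q
      using lim[OF that] tendsto_mult[OF c tendsto_const[of "dE n p q"]] LIMSEQ_unique by blast
    ultimately show ?thesis using lo by (intro exI[of _ c]) auto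
  qed
  then show ?thesis
  proof (intro exI[of _ \<sigma>] exI[of _ "\<lambda>j p. F (p,j)"] conjI \<sigma> allI ballI)
    fix j p assume p: "p \<in> Q"
    show "F (p, j) \<in> eucl n" using F(1) p by simp
    show "(\<lambda>m. dE n (\<lambda>i. (wmap (e (\<sigma> m) j) p i - z i) / r (\<sigma> m)) (F (p, j))) \<longlonglongrightarrow> 0"
      using F(2)[of "(p,j)"] p by (simp add: f_def)
  qed blast
qed

end

section \<open>Tangents of self-similar sets\<close>

context osc_ifs
begin

text \<open>Attouch-Wets convergence in pointwise form. Finitely many scales are dropped so that the
  others are below 1, as \<open>stop_exists\<close> demands.\<close>

lemma tangent_scales:
  assumes "tangentE n X z T" "X \<subseteq> eucl n"
  shows "\<exists>r :: nat \<Rightarrow> real. (\<forall>m. 0 < r m \<and> r m < 1) \<and>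
    (\<forall>y\<in>T. \<forall>e>0. \<exists>N. \<forall>m\<ge>N. \<exists>q\<in>X. dE n y (\<lambda>i. (q i - z i) / r m) < e) \<and>
    (\<forall>x\<in>eucl n. (\<forall>e>0. \<forall>N. \<exists>m\<ge>N. \<exists>q\<in>X. dE n x (\<lambda>i. (q i - z i) / r m) < e) \<longrightarrow> x \<in> T)"
proof -
  obtain r :: "nat \<Rightarrow> real" where r: "\<And>m. r m > 0" "r \<longlonglongrightarrow> 0"
    and aw: "aw_conv n (\<lambda>m. (\<lambda>y i. (y i - z i) / r m) ` X) T"
    and T: "closedE n T" and z: "z \<in> X"
    using assms(1) unfolding tangentE_def by blast
  have ze: "z \<in> eucl n" using z assms(2) by blast
  obtain m0 where m0: "\<And>m. m \<ge> m0 \<Longrightarrow> r m < 1"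
    using order_tendstoD(2)[OF r(2), of 1] unfolding eventually_sequentially by auto
  show ?thesis
  proof (intro exI[of _ "\<lambda>m. r (m + m0)"] conjI allI ballI impI)
    show "0 < r (m + m0)" "r (m + m0) < 1" for m using r m0 by auto
  next
    fix y and e :: real assume y: "y \<in> T" and e: "e > 0"
    have "y \<in> eucl n" using y T by (auto simp: closedE_def)
    from aw_conv_approx[OF aw y this e]
    obtain N where N: "\<And>m. m \<ge> N \<Longrightarrow> \<exists>x\<in>(\<lambda>y i. (y i - z i) / r m) ` X. dE n y x < e"
      unfolding eventually_sequentially by blast
    show "\<exists>N. \<forall>m\<ge>N. \<exists>q\<in>X. dE n y (\<lambda>i. (q i - z i) / r (m + m0)) < e"
    proof (intro exI[of _ N] allI impI)
      fix m assume "m \<ge> N"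
      then show "\<exists>q\<in>X. dE n y (\<lambda>i. (q i - z i) / r (m + m0)) < e" using N[of "m + m0"] by simp
    qed
  next
    fix x assume x: "x \<in> eucl n"
      and H: "\<forall>e>0. \<forall>N. \<exists>m\<ge>N. \<exists>q\<in>X. dE n x (\<lambda>i. (q i - z i) / r (m + m0)) < e"
    show "x \<in> T"
    proof (rule aw_conv_limit[OF aw T _ x])
      show "(\<lambda>y i. (y i - z i) / r m) ` X \<subseteq> eucl n" for m using blowup_eucl ze assms(2) by blast
      fix e :: real assume e: "e > 0"
      show "\<exists>\<^sub>F m in sequentially. \<exists>x'\<in>(\<lambda>y i. (y i - z i) / r m) ` X. dE n x x' < e"
        unfolding frequently_sequentially
      proof
        fix N
        obtain m where "m \<ge> N" "\<exists>q\<in>X. dE n x (\<lambda>i. (q i - z i) / r (m + m0)) < e" using H e by blast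
        then show "\<exists>m\<ge>N. \<exists>x'\<in>(\<lambda>y i. (y i - z i) / r m) ` X. dE n x x' < e"
          by (intro exI[of _ "m + m0"]) auto
      qed
    qed
  qed
qed

lemma Q_diam: obtains D where "D > 0" "\<And>p q. p \<in> Q \<Longrightarrow> q \<in> Q \<Longrightarrow> dE n p q \<le> D"
proof -
  obtain B where B: "\<And>x. x \<in> Q \<Longrightarrow> dE n x origin \<le> B" using compactE_bounded[OF Q(1)] by blast
  have "dE n p q \<le> \<bar>2 * B\<bar> + 1" if "p \<in> Q" "q \<in> Q" for p q
    using dE_triangle[of n p q origin] dE_commute[of n origin q] B[OF that(1)] B[OF that(2)] by linarith
  then show thesis using that[of "\<bar>2 * B\<bar> + 1"] by simp
qed

text \<open>The blow-ups of \<open>Q\<close> have points near \<open>y\<close>. Cylinders through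
  them, at a scale smaller by the factor \<open>c\<close>, stay near \<open>y\<close>, and a limit
  of these is a copy of \<open>Q\<close> inside \<open>T\<close>.\<close>

lemma tangent_contains_copy:
  assumes T: "tangentE n Q z T" and two: "a \<in> Q" "a' \<in> Q" "a \<noteq> a'" and y: "y \<in> T" and eps: "\<epsilon> > 0"
  shows "\<exists>F. \<exists>c>0. (\<forall>p\<in>Q. F p \<in> T \<and> dE n (F p) y < \<epsilon>) \<and> (\<forall>p\<in>Q. \<forall>q\<in>Q. dE n (F p) (F q) = c * dE n p q)"
proof -
  have Qe: "Q \<subseteq> eucl n" using Q_eucl by blast
  have z: "z \<in> eucl n" using T Qe by (auto simp: tangentE_def)
  obtain r :: "nat \<Rightarrow> real" where r0: "\<forall>m. 0 < r m \<and> r m < 1"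
    and near0: "\<forall>y\<in>T. \<forall>e>0. \<exists>N. \<forall>m\<ge>N. \<exists>q\<in>Q. dE n y (\<lambda>i. (q i - z i) / r m) < e"
    and lim0: "\<forall>x\<in>eucl n. (\<forall>e>0. \<forall>N. \<exists>m\<ge>N. \<exists>q\<in>Q. dE n x (\<lambda>i. (q i - z i) / r m) < e) \<longrightarrow> x \<in> T"
    using tangent_scales[OF T Qe] by (elim exE conjE)
  have r: "\<And>m. 0 < r m" "\<And>m. r m < 1" using r0 by auto
  have near: "\<exists>N. \<forall>m\<ge>N. \<exists>q\<in>Q. dE n y (\<lambda>i. (q i - z i) / r m) < e" if "y \<in> T" "e > 0" for y e
    using near0 that by blast
  have lim: "x \<in> T" if "x \<in> eucl n" "\<And>e N. e > 0 \<Longrightarrow> \<exists>m\<ge>N. \<exists>q\<in>Q. dE n x (\<lambda>i. (q i - z i) / r m) < e" for x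
    using lim0 that by blast
  obtain D where D: "D > 0" "\<And>p q. p \<in> Q \<Longrightarrow> q \<in> Q \<Longrightarrow> dE n p q \<le> D" using Q_diam by blast
  \<comment> \<open>A cylinder stopped at \<open>c * r' m\<close> has a blow-up of diameter at most
    \<open>\<epsilon> / 4\<close>. Together with the error \<open>\<epsilon> / 2\<close> of its
    chosen point this leaves room for a strict inequality in the limit; \<open>c \<le> 1\<close>
    keeps the stopping scale below 1.\<close>
  define c where "c = min 1 (\<epsilon> / (4 * D))"
  have c: "0 < c" "c \<le> 1" "c * D \<le> \<epsilon> / 4" using D(1) eps by (auto simp: c_def min_def field_simps)
  obtain N where N: "\<And>m. m \<ge> N \<Longrightarrow> \<exists>q\<in>Q. dE n y (\<lambda>i. (q i - z i) / r m) < \<epsilon> / 2"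
    using near[OF y, of "\<epsilon> / 2"] eps by auto
  define r' where "r' m = r (m + N)" for m
  have r': "0 < r' m" "r' m < 1" for m using r by (auto simp: r'_def)
  have "\<exists>w. stop (c * r' m) w \<and> (\<exists>p\<in>Q. dE n y (\<lambda>i. (wmap w p i - z i) / r' m) < \<epsilon> / 2)" for m
  proof -
    obtain q where q: "q \<in> Q" "dE n y (\<lambda>i. (q i - z i) / r' m) < \<epsilon> / 2" using N[of "m + N"] by (auto simp: r'_def)
    have "c * r' m \<le> 1 * r' m" using c r'[of m] by (intro mult_right_mono) auto
    then have "c * r' m < 1" using r'[of m] by linarith
    then obtain w where "stop (c * r' m) w" "q \<in> wmap w ` Q" using stop_exists[OF q(1), of "c * r' m"] c r'[of m] by auto
    then show ?thesis using q(2) by blast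
  qed
  then obtain w p0 where w: "\<And>m. stop (c * r' m) (w m)"
    and p0: "\<And>m. p0 m \<in> Q" "\<And>m. dE n y (\<lambda>i. (wmap (w m) (p0 m) i - z i) / r' m) < \<epsilon> / 2" by metis
  have ww: "w m \<in> words" for m using w[of m] by (simp add: stop_def)
  have up: "wrat (w m) \<le> c * r' m" for m using w[of m] by (simp add: stop_def)
  have low: "(c * rmin) * r' m \<le> wrat (w m)" for m
    using stop_lower[OF w[of m]] c r'[of m] by (simp add: mult_ac)
  have close: "dE n (\<lambda>i. (wmap (w m) p i - z i) / r' m) y < 3 / 4 * \<epsilon>" if p: "p \<in> Q" for m p
  proof -
    have "dE n (\<lambda>i. (wmap (w m) p i - z i) / r' m) (\<lambda>i. (wmap (w m) (p0 m) i - z i) / r' m) =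
       wrat (w m) * dE n p (p0 m) / r' m"
      using dE_scale[OF r'(1)] wmap_sim[OF ww] Q_eucl p p0(1) by simp
    also have "\<dots> \<le> (c * r' m) * D / r' m"
      using up[of m] D(2)[OF p p0(1)] c r'[of m] by (intro divide_right_mono mult_mono) auto
    also have "\<dots> = c * D" using r'(1)[of m] by simp
    also have "\<dots> \<le> \<epsilon> / 4" by (rule c(3))
    finally show ?thesis
      using p0(2)[of m] dE_triangle[of n "\<lambda>i. (wmap (w m) p i - z i) / r' m" y "\<lambda>i. (wmap (w m) (p0 m) i - z i) / r' m"]
        dE_commute[of n y "\<lambda>i. (wmap (w m) (p0 m) i - z i) / r' m"] by linarith
  qed
  have bdd: "\<exists>B. \<forall>m. \<forall>p\<in>Q. dE n (\<lambda>i. (wmap (w m) p i - z i) / r' m) origin \<le> B"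
  proof (intro exI[of _ "3 / 4 * \<epsilon> + dE n y origin"] allI ballI)
    fix m p assume "p \<in> Q"
    from close[OF this, of m] show "dE n (\<lambda>i. (wmap (w m) p i - z i) / r' m) origin \<le> 3 / 4 * \<epsilon> + dE n y origin"
      using dE_triangle[of n "\<lambda>i. (wmap (w m) p i - z i) / r' m" origin y] by linarith
  qed
  have "0 < c * rmin" using c rmin by simp
  have "\<exists>\<sigma> F. strict_mono (\<sigma> :: nat \<Rightarrow> nat) \<and> (\<forall>j::nat. \<forall>p\<in>Q. F j p \<in> eucl n) \<and>
      (\<forall>j. \<forall>p\<in>Q. (\<lambda>m. dE n (\<lambda>i. (wmap (w (\<sigma> m)) p i - z i) / r' (\<sigma> m)) (F j p)) \<longlonglongrightarrow> 0) \<and>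
      (\<forall>j. \<exists>c>0. \<forall>p\<in>Q. \<forall>q\<in>Q. dE n (F j p) (F j q) = c * dE n p q)"
    by (rule cylinder_limits[of "\<lambda>m j. w m" "c * rmin" r' c z a a', OF ww low up \<open>0 < c * rmin\<close> r'(1) z bdd two])
  then obtain \<sigma> F where \<sigma>: "strict_mono (\<sigma> :: nat \<Rightarrow> nat)" and F1: "\<forall>j::nat. \<forall>p\<in>Q. F j p \<in> eucl n"
    and F2: "\<forall>j. \<forall>p\<in>Q. (\<lambda>m. dE n (\<lambda>i. (wmap (w (\<sigma> m)) p i - z i) / r' (\<sigma> m)) (F j p)) \<longlonglongrightarrow> 0"
    and F3: "\<forall>j. \<exists>c>0. \<forall>p\<in>Q. \<forall>q\<in>Q. dE n (F j p) (F j q) = c * dE n p q"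
    by (elim exE conjE)
  have F: "F j p \<in> eucl n" "(\<lambda>m. dE n (\<lambda>i. (wmap (w (\<sigma> m)) p i - z i) / r' (\<sigma> m)) (F j p)) \<longlonglongrightarrow> 0" if "p \<in> Q" for j p
    using F1 F2 that by blast+
  have "F 0 p \<in> T \<and> dE n (F 0 p) y < \<epsilon>" if p: "p \<in> Q" for p
  proof
    show "F 0 p \<in> T"
    proof (rule lim[OF F(1)[OF p]])
      fix e :: real and M :: nat assume "e > 0"
      then obtain M' where M': "\<And>m. m \<ge> M' \<Longrightarrow> dE n (\<lambda>i. (wmap (w (\<sigma> m)) p i - z i) / r' (\<sigma> m)) (F 0 p) < e"
        using order_tendstoD(2)[OF F(2)[OF p]] unfolding eventually_sequentially by blast
      define m where "m = max M M'"
      have "M \<le> \<sigma> m + N" using seq_suble[OF \<sigma>, of m] by (simp add: m_def)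
      moreover have "dE n (F 0 p) (\<lambda>i. (wmap (w (\<sigma> m)) p i - z i) / r (\<sigma> m + N)) < e"
        using M'[of m] dE_commute by (simp add: m_def r'_def)
      ultimately show "\<exists>m\<ge>M. \<exists>q\<in>Q. dE n (F 0 p) (\<lambda>i. (q i - z i) / r m) < e"
        using wmap_Q[OF ww p] by blast
    qed
    have "(\<lambda>m. dE n (\<lambda>i. (wmap (w (\<sigma> m)) p i - z i) / r' (\<sigma> m)) y) \<longlonglongrightarrow> dE n (F 0 p) y"
      by (rule tendsto_dE[OF F(2)[OF p]]) simp
    then have "dE n (F 0 p) y \<le> 3 / 4 * \<epsilon>"
      by (rule LIMSEQ_le_const2) (use close[OF p] less_imp_le in blast)
    then show "dE n (F 0 p) y < \<epsilon>" using eps by simp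
  qed
  then show ?thesis using F3[rule_format, of 0] by blast
qed

text \<open>At every scale a bounded number of stopping cylinders meets the ball. Numbered by
  \<open>j < M\<close> they converge along a common subsequence, and each point of \<open>T\<close>
  in the ball is approached infinitely often under one fixed number.\<close>

lemma tangent_ball_covered:
  assumes T: "tangentE n Q z T" and two: "a \<in> Q" "a' \<in> Q" "a \<noteq> a'"
  shows "\<exists>\<S>. countable \<S> \<and> {y \<in> T. dE n y origin \<le> real R} \<subseteq> \<Union>\<S> \<and>
    (\<forall>A\<in>\<S>. \<exists>F. \<exists>c>0. A = F ` Q \<and> A \<subseteq> eucl n \<and> (\<forall>p\<in>Q. \<forall>q\<in>Q. dE n (F p) (F q) = c * dE n p q))"
proof -
  have Qe: "Q \<subseteq> eucl n" using Q_eucl by blast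
  have zQ: "z \<in> Q" and z: "z \<in> eucl n" using T Qe by (auto simp: tangentE_def)
  obtain r :: "nat \<Rightarrow> real" where r0: "\<forall>m. 0 < r m \<and> r m < 1"
    and near0: "\<forall>y\<in>T. \<forall>e>0. \<exists>N. \<forall>m\<ge>N. \<exists>q\<in>Q. dE n y (\<lambda>i. (q i - z i) / r m) < e"
    using tangent_scales[OF T Qe] by (elim exE conjE)
  have r: "\<And>m. 0 < r m" "\<And>m. r m < 1" using r0 by auto
  have near: "\<exists>N. \<forall>m\<ge>N. \<exists>q\<in>Q. dE n y (\<lambda>i. (q i - z i) / r m) < e" if "y \<in> T" "e > 0" for y e
    using near0 that by blast
  obtain D where D: "D > 0" "\<And>p q. p \<in> Q \<Longrightarrow> q \<in> Q \<Longrightarrow> dE n p q \<le> D" using Q_diam by blast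
  \<comment> \<open>The margin 1 admits the approximating points, which may lie slightly outside the
    ball of radius \<open>R\<close>.\<close>
  define R1 where "R1 = real R + 1"
  define S where "S m = {w. stop (r m) w \<and> (\<exists>x\<in>wmap w ` Q. dE n x z \<le> R1 * r m)}" for m
  obtain M where M0: "\<forall>r>0. \<forall>z\<in>eucl n.
    finite {w. stop r w \<and> (\<exists>x\<in>wmap w ` Q. dE n x z \<le> R1 * r)} \<and>
    card {w. stop r w \<and> (\<exists>x\<in>wmap w ` Q. dE n x z \<le> R1 * r)} \<le> M"
    using stop_count[of R1] by (elim exE)
  have M: "\<And>m. finite (S m)" "\<And>m. card (S m) \<le> M" unfolding S_def using M0 r(1) z by blast+
  have Sne: "S m \<noteq> {}" for m
  proof -
    obtain w where "stop (r m) w" "z \<in> wmap w ` Q" using stop_exists[OF zQ r] by blast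
    moreover have "dE n z z \<le> R1 * r m" using r(1)[of m] by (simp add: R1_def)
    ultimately show ?thesis unfolding S_def by blast
  qed
  \<comment> \<open>An enumeration with repetitions, so that the index range does not vary with
    \<open>m\<close>.\<close>
  have "\<exists>e. (\<forall>j. e j \<in> S m) \<and> S m \<subseteq> e ` {..<M}" for m
  proof -
    obtain h where h: "bij_betw h {0..<card (S m)} (S m)" using ex_bij_betw_nat_finite[OF M(1)] by blast
    have pos: "0 < card (S m)" using Sne M(1) by (simp add: card_gt_0_iff)
    show ?thesis
    proof (intro exI[of _ "\<lambda>j. h (if j < card (S m) then j else 0)"] conjI allI subsetI)
      fix j show "h (if j < card (S m) then j else 0) \<in> S m"
        using h pos by (auto simp: bij_betw_def)
    next
      fix w assume "w \<in> S m"
      then have "w \<in> h ` {0..<card (S m)}" using h by (simp add: bij_betw_def)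
      then obtain j where "j < card (S m)" "w = h j" by auto
      then show "w \<in> (\<lambda>j. h (if j < card (S m) then j else 0)) ` {..<M}"
        using M(2)[of m] by (intro image_eqI[of _ _ j]) auto
    qed
  qed
  then obtain e where e: "\<And>m j. e m j \<in> S m" "\<And>m. S m \<subseteq> e m ` {..<M}" by metis
  have ew: "e m j \<in> words" and est: "stop (r m) (e m j)" for m j using e(1)[of m j] by (auto simp: S_def stop_def)
  have up: "wrat (e m j) \<le> 1 * r m" for m j using est[of m j] by (simp add: stop_def)
  have low: "rmin * r m \<le> wrat (e m j)" for m j using stop_lower[OF est r(1)] .
  define f where "f m j p = (\<lambda>i. (wmap (e m j) p i - z i) / r m)" for m j p
  have fsim: "dE n (f m j p) (f m j q) \<le> dE n p q" if "p \<in> Q" "q \<in> Q" for m j p q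
  proof -
    have "dE n (f m j p) (f m j q) = wrat (e m j) * dE n p q / r m"
      unfolding f_def using dE_scale[OF r(1)] wmap_sim[OF ew] Q_eucl that by simp
    also have "\<dots> \<le> r m * dE n p q / r m" using up[of m j] r(1)[of m] by (intro divide_right_mono mult_right_mono) auto
    finally show ?thesis using r(1)[of m] by simp
  qed
  have forig: "dE n (f m j p) origin = dE n (wmap (e m j) p) z / r m" for m j p
  proof -
    have "origin = (\<lambda>i. (z i - z i) / r m)" by (simp add: origin_def)
    then show ?thesis unfolding f_def using dE_scale[OF r(1)[of m], of n "wmap (e m j) p" z z] by simp
  qed
  have fb: "dE n (f m j p) origin \<le> R1 + D" if p: "p \<in> Q" for m j p
  proof -
    obtain q where q: "q \<in> Q" "dE n (wmap (e m j) q) z \<le> R1 * r m" using e(1)[of m j] by (auto simp: S_def)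
    have "dE n (f m j q) origin \<le> R1" unfolding forig using q(2) r(1)[of m] by (simp add: field_simps)
    then show ?thesis using dE_triangle[of n "f m j p" origin "f m j q"] fsim[OF p q(1), of m j] D(2)[OF p q(1)] by linarith
  qed
  have bdd: "\<exists>B. \<forall>m. \<forall>p\<in>Q. dE n (\<lambda>i. (wmap (e m j) p i - z i) / r m) origin \<le> B" for j
    using fb unfolding f_def by blast
  have "\<exists>\<sigma> F. strict_mono (\<sigma> :: nat \<Rightarrow> nat) \<and> (\<forall>j. \<forall>p\<in>Q. F j p \<in> eucl n) \<and>
      (\<forall>j. \<forall>p\<in>Q. (\<lambda>m. dE n (f (\<sigma> m) j p) (F j p)) \<longlonglongrightarrow> 0) \<and>
      (\<forall>j. \<exists>c>0. \<forall>p\<in>Q. \<forall>q\<in>Q. dE n (F j p) (F j q) = c * dE n p q)"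
    unfolding f_def by (rule cylinder_limits[of e rmin r 1 z a a', OF ew low up rmin(1) r(1) z bdd two])
  then obtain \<sigma> F where \<sigma>: "strict_mono (\<sigma> :: nat \<Rightarrow> nat)" and F1: "\<forall>j. \<forall>p\<in>Q. F j p \<in> eucl n"
    and F2: "\<forall>j. \<forall>p\<in>Q. (\<lambda>m. dE n (f (\<sigma> m) j p) (F j p)) \<longlonglongrightarrow> 0"
    and F3: "\<forall>j. \<exists>c>0. \<forall>p\<in>Q. \<forall>q\<in>Q. dE n (F j p) (F j q) = c * dE n p q"
    by (elim exE conjE)
  have F: "F j p \<in> eucl n" "(\<lambda>m. dE n (f (\<sigma> m) j p) (F j p)) \<longlonglongrightarrow> 0" if "p \<in> Q" for j p
    using F1 F2 that by blast+
  \<comment> \<open>A point that cylinder \<open>j\<close> approaches again and again is in the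
    limit copy: the points of \<open>Q\<close> that produce the approach have a convergent
    subsequence, and the blow-ups are 1-Lipschitz.\<close>
  have single: "y \<in> F j ` Q"
    if y: "y \<in> eucl n" and H: "\<And>\<epsilon> N. \<epsilon> > 0 \<Longrightarrow> \<exists>m\<ge>N. \<exists>p\<in>Q. dE n y (f (\<sigma> m) j p) < \<epsilon>" for y j
  proof -
    have "\<exists>m\<ge>l. \<exists>p\<in>Q. dE n y (f (\<sigma> m) j p) < 1 / real (Suc l)" for l by (rule H) simp
    then obtain \<mu> p where \<mu>: "\<And>l. \<mu> l \<ge> l" and p: "\<And>l. p l \<in> Q"
      and d: "\<And>l. dE n y (f (\<sigma> (\<mu> l)) j (p l)) < 1 / real (Suc l)" by metis
    obtain q \<tau> where q: "q \<in> Q" and \<tau>: "strict_mono \<tau>" "(\<lambda>l. dE n (p (\<tau> l)) q) \<longlonglongrightarrow> 0"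
      using Q(1) p unfolding compactE_def by meson
    have "filterlim (\<lambda>l. \<mu> (\<tau> l)) at_top sequentially"
      using \<mu> seq_suble[OF \<tau>(1)] by (intro filterlim_at_top_mono[OF filterlim_ident] always_eventually) (meson le_trans)
    from filterlim_compose[OF F(2)[OF q] this]
    have l3: "(\<lambda>l. dE n (f (\<sigma> (\<mu> (\<tau> l))) j q) (F j q)) \<longlonglongrightarrow> 0" .
    have l1: "(\<lambda>l. 1 / real (Suc (\<tau> l))) \<longlonglongrightarrow> 0"
      using LIMSEQ_subseq_LIMSEQ[OF lim_1_over_n[THEN LIMSEQ_Suc] \<tau>(1)] by (simp add: o_def)
    have "dE n y (F j q) \<le> 1 / real (Suc (\<tau> l)) + dE n (p (\<tau> l)) q + dE n (f (\<sigma> (\<mu> (\<tau> l))) j q) (F j q)" for l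
      using d[of "\<tau> l"] fsim[OF p q, of "\<sigma> (\<mu> (\<tau> l))" j "\<tau> l"]
        dE_triangle[of n y "F j q" "f (\<sigma> (\<mu> (\<tau> l))) j (p (\<tau> l))"]
        dE_triangle[of n "f (\<sigma> (\<mu> (\<tau> l))) j (p (\<tau> l))" "F j q" "f (\<sigma> (\<mu> (\<tau> l))) j q"] by linarith
    moreover have "(\<lambda>l. 1 / real (Suc (\<tau> l)) + dE n (p (\<tau> l)) q + dE n (f (\<sigma> (\<mu> (\<tau> l))) j q) (F j q)) \<longlonglongrightarrow> 0 + 0 + 0"
      by (intro tendsto_add l1 \<tau>(2) l3)
    ultimately have "dE n y (F j q) \<le> 0" by (intro LIMSEQ_le_const[where x = 0]) auto
    then have "y = F j q" using dE_eq_0[OF y F(1)[OF q]] dE_nonneg[of n y "F j q"] by simp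
    then show ?thesis using q by blast
  qed
  have "{y \<in> T. dE n y origin \<le> real R} \<subseteq> \<Union>((\<lambda>j. F j ` Q) ` {..<M})"
  proof clarify
    fix y assume y: "y \<in> T" "dE n y origin \<le> real R"
    have ye: "y \<in> eucl n" using y T by (auto simp: tangentE_def closedE_def)
    show "y \<in> \<Union>((\<lambda>j. F j ` Q) ` {..<M})"
    proof (rule ccontr)
      \<comment> \<open>Then each of the finitely many numbers keeps a positive distance from
        \<open>y\<close> from some index on; a common distance and a common index contradict the
        approximation of \<open>y\<close>.\<close>
      assume "\<not> ?thesis"
      then have "\<forall>j<M. \<exists>\<epsilon> N. \<epsilon> > 0 \<and> (\<forall>m\<ge>N. \<forall>p\<in>Q. \<not> dE n y (f (\<sigma> m) j p) < \<epsilon>)"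
        using single[OF ye] by (metis UN_iff lessThan_iff)
      then obtain \<epsilon> N where eN: "\<And>j. j < M \<Longrightarrow> \<epsilon> j > (0::real)"
        "\<And>j m p. j < M \<Longrightarrow> m \<ge> N j \<Longrightarrow> p \<in> Q \<Longrightarrow> \<epsilon> j \<le> dE n y (f (\<sigma> m) j p)" by (metis not_less)
      define \<epsilon>0 where "\<epsilon>0 = Min (insert 1 (\<epsilon> ` {..<M}))"
      define N0 where "N0 = Max (insert 0 (N ` {..<M}))"
      have e0: "0 < \<epsilon>0" unfolding \<epsilon>0_def using eN(1) by (subst Min_gr_iff) auto
      have e1: "\<epsilon>0 \<le> 1" unfolding \<epsilon>0_def by (intro Min_le) auto
      have ej: "\<epsilon>0 \<le> \<epsilon> j" if "j < M" for j unfolding \<epsilon>0_def using that by (intro Min_le) auto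
      have Nj: "N j \<le> N0" if "j < M" for j unfolding N0_def using that by (intro Max_ge) auto
      obtain K where K: "\<And>m. m \<ge> K \<Longrightarrow> \<exists>q\<in>Q. dE n y (\<lambda>i. (q i - z i) / r m) < \<epsilon>0" using near[OF y(1) e0] by blast
      define m where "m = max N0 K"
      have "K \<le> \<sigma> m" using seq_suble[OF \<sigma>, of m] by (simp add: m_def)
      then obtain q where q: "q \<in> Q" "dE n y (\<lambda>i. (q i - z i) / r (\<sigma> m)) < \<epsilon>0" using K by blast
      obtain w p where w: "stop (r (\<sigma> m)) w" "p \<in> Q" "q = wmap w p" using stop_exists[OF q(1) r] by blast
      have "origin = (\<lambda>i. (z i - z i) / r (\<sigma> m))" by (simp add: origin_def)
      then have "dE n (\<lambda>i. (q i - z i) / r (\<sigma> m)) origin = dE n q z / r (\<sigma> m)"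
        using dE_scale[OF r(1)[of "\<sigma> m"], of n q z z] by simp
      moreover have "dE n (\<lambda>i. (q i - z i) / r (\<sigma> m)) origin \<le> R1"
        using q(2) e1 y(2) dE_triangle[of n "\<lambda>i. (q i - z i) / r (\<sigma> m)" origin y]
          dE_commute[of n y "\<lambda>i. (q i - z i) / r (\<sigma> m)"] unfolding R1_def by linarith
      ultimately have "dE n q z / r (\<sigma> m) \<le> R1" by simp
      then have "dE n q z \<le> R1 * r (\<sigma> m)" using r(1)[of "\<sigma> m"] by (simp only: pos_divide_le_eq)
      then have "w \<in> S (\<sigma> m)" using w unfolding S_def by blast
      then obtain j where j: "j < M" "w = e (\<sigma> m) j" using e(2) by blast
      have "\<epsilon> j \<le> dE n y (f (\<sigma> m) j p)" using Nj[OF j(1)] by (intro eN(2) j(1) w(2)) (simp add: m_def)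
      moreover have "f (\<sigma> m) j p = (\<lambda>i. (q i - z i) / r (\<sigma> m))" unfolding f_def w(3) j(2) ..
      ultimately show False using q(2) ej[OF j(1)] by simp
    qed
  qed
  moreover have "\<forall>A\<in>(\<lambda>j. F j ` Q) ` {..<M}. \<exists>F. \<exists>c>0. A = F ` Q \<and> A \<subseteq> eucl n \<and> (\<forall>p\<in>Q. \<forall>q\<in>Q. dE n (F p) (F q) = c * dE n p q)"
    using F1 F3 by blast
  ultimately show ?thesis
    by (intro exI[of _ "(\<lambda>j. F j ` Q) ` {..<M}"] conjI) (auto intro: countable_finite)
qed

lemma tangent_covered:
  assumes T: "tangentE n Q z T" and two: "a \<in> Q" "a' \<in> Q" "a \<noteq> a'"
  obtains \<S> where "countable \<S>" "T \<subseteq> \<Union>\<S>"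
    "\<And>A. A \<in> \<S> \<Longrightarrow> \<exists>F. \<exists>c>0. A = F ` Q \<and> A \<subseteq> eucl n \<and> (\<forall>p\<in>Q. \<forall>q\<in>Q. dE n (F p) (F q) = c * dE n p q)"
proof -
  have "\<forall>R. \<exists>\<S>. countable \<S> \<and> {y \<in> T. dE n y origin \<le> real R} \<subseteq> \<Union>\<S> \<and>
    (\<forall>A\<in>\<S>. \<exists>F. \<exists>c>0. A = F ` Q \<and> A \<subseteq> eucl n \<and> (\<forall>p\<in>Q. \<forall>q\<in>Q. dE n (F p) (F q) = c * dE n p q))"
    by (intro allI tangent_ball_covered[OF T two])
  from choice[OF this] obtain \<S> where S': "\<forall>R. countable (\<S> R) \<and> {y \<in> T. dE n y origin \<le> real R} \<subseteq> \<Union>(\<S> R) \<and>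
    (\<forall>A\<in>\<S> R. \<exists>F. \<exists>c>0. A = F ` Q \<and> A \<subseteq> eucl n \<and> (\<forall>p\<in>Q. \<forall>q\<in>Q. dE n (F p) (F q) = c * dE n p q))"
    by (elim exE)
  have S: "countable (\<S> R)" "{y \<in> T. dE n y origin \<le> real R} \<subseteq> \<Union>(\<S> R)"
    "\<forall>A\<in>\<S> R. \<exists>F. \<exists>c>0. A = F ` Q \<and> A \<subseteq> eucl n \<and> (\<forall>p\<in>Q. \<forall>q\<in>Q. dE n (F p) (F q) = c * dE n p q)" for R
    by (rule S'[rule_format, THEN conjunct1])
      (rule S'[rule_format, THEN conjunct2, THEN conjunct1], rule S'[THEN spec, THEN conjunct2, THEN conjunct2])
  show thesis
  proof (rule that[of "\<Union>R. \<S> R"])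
    show "countable (\<Union>R. \<S> R)" using S(1) by (intro countable_UN) auto
    show "T \<subseteq> \<Union>(\<Union>R. \<S> R)"
    proof
      fix y assume y: "y \<in> T"
      obtain R where "dE n y origin \<le> real R" using real_arch_simple by blast
      then show "y \<in> \<Union>(\<Union>R. \<S> R)" using S(2)[of R] y by blast
    qed
  qed (use S(3) in blast)
qed

end

lemma self_similar_osc:
  assumes "self_similarE n Q"
  obtains k \<phi> \<rho> U where "osc_ifs n k \<phi> \<rho> Q U"
proof -
  obtain k :: nat and \<phi> where A: "(\<forall>i<k. similarityE n (\<phi> i)) \<and> Q \<noteq> {} \<and> compactE n Q \<and> Q = (\<Union>i<k. \<phi> i ` Q) \<and>
    (\<exists>U. U \<noteq> {} \<and> openE n U \<and> (\<forall>i<k. \<phi> i ` U \<subseteq> U) \<and>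
      (\<forall>i<k. \<forall>j<k. i \<noteq> j \<longrightarrow> \<phi> i ` U \<inter> \<phi> j ` U = {}))"
    using assms unfolding self_similarE_def by (elim exE)
  then have "\<exists>U. U \<noteq> {} \<and> openE n U \<and> (\<forall>i<k. \<phi> i ` U \<subseteq> U) \<and>
      (\<forall>i<k. \<forall>j<k. i \<noteq> j \<longrightarrow> \<phi> i ` U \<inter> \<phi> j ` U = {})" by (elim conjE)
  then obtain U where B: "U \<noteq> {} \<and> openE n U \<and> (\<forall>i<k. \<phi> i ` U \<subseteq> U) \<and>
      (\<forall>i<k. \<forall>j<k. i \<noteq> j \<longrightarrow> \<phi> i ` U \<inter> \<phi> j ` U = {})" by (elim exE)
  have H: "\<forall>i<k. similarityE n (\<phi> i)" "Q \<noteq> {}" "compactE n Q" "Q = (\<Union>i<k. \<phi> i ` Q)"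
    "U \<noteq> {}" "openE n U" "\<forall>i<k. \<phi> i ` U \<subseteq> U" "\<forall>i<k. \<forall>j<k. i \<noteq> j \<longrightarrow> \<phi> i ` U \<inter> \<phi> j ` U = {}"
    using conjunct1[OF A] conjunct1[OF conjunct2[OF A]] conjunct1[OF conjunct2[OF conjunct2[OF A]]]
      conjunct1[OF conjunct2[OF conjunct2[OF conjunct2[OF A]]]]
      conjunct1[OF B] conjunct1[OF conjunct2[OF B]] conjunct1[OF conjunct2[OF conjunct2[OF B]]]
      conjunct2[OF conjunct2[OF conjunct2[OF B]]] by - assumption+
  obtain \<rho> where \<rho>: "\<forall>i<k. 0 < \<rho> i \<and> \<rho> i < 1 \<and> (\<forall>x\<in>eucl n. \<forall>y\<in>eucl n. dE n (\<phi> i x) (\<phi> i y) = \<rho> i * dE n x y)"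
    using H(1) unfolding similarityE_def by metis
  have "osc_ifs n k \<phi> \<rho> Q U"
  proof
    show "\<phi> i x \<in> eucl n" if "i < k" "x \<in> eucl n" for i x using H(1) that unfolding similarityE_def by blast
    show "Q = (\<Union>i<k. \<phi> i ` Q)" by (rule H(4))
  qed (use H \<rho> in auto)
  then show thesis by (rule that)
qed

lemma hdimE_singleton:
  assumes "x \<in> eucl n" shows "hdimE n {x} = 0"
proof -
  have "hausdorffE n 0 {x} = 0"
    unfolding hausdorffE_null_iff
  proof (intro allI impI)
    fix \<delta> \<epsilon> :: real assume "\<delta> > 0" "\<epsilon> > 0"
    \<comment> \<open>Here \<open>0 powr 0 = 0\<close>, so a one-point set costs nothing even for
      the exponent 0.\<close>
    have "diamE n {x} = 0" by (simp add: diamE_def)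
    then show "\<exists>C :: nat \<Rightarrow> (nat \<Rightarrow> real) set. {x} \<subseteq> (\<Union>i. C i) \<and>
     (\<forall>i. C i \<subseteq> eucl n \<and> (\<forall>x\<in>C i. \<forall>y\<in>C i. dE n x y \<le> \<delta>)) \<and>
     (\<Sum>i. ennreal (diamE n (C i) powr 0)) \<le> ennreal \<epsilon>"
      using assms \<open>\<delta> > 0\<close> by (intro exI[of _ "\<lambda>_. {x}"]) simp
  qed
  then have "0 \<in> {t. t \<ge> 0 \<and> hausdorffE n t {x} = 0}" by simp
  then show ?thesis unfolding hdimE_def by (intro cInf_eq_minimum) auto
qed

section \<open>The loop predicate of the curve\<close>

text \<open>A block is coded by a triple: the kind of its pattern, its length minus one, and an index which
  makes every combination of kind and length occur infinitely often.\<close>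

definition kindB :: "nat \<Rightarrow> nat" where "kindB M = fst (prod_decode M)"
definition lenB :: "nat \<Rightarrow> nat" where "lenB M = Suc (fst (prod_decode (snd (prod_decode M))))"
text \<open>A block has three stretches of \<open>lenB M\<close> levels: the tested digits, the
  levels of the pattern, and empty levels. The first and the last carry no loops.\<close>

primrec startB :: "nat \<Rightarrow> nat" where
  "startB 0 = 0"
| "startB (Suc M) = startB M + 3 * lenB M"
definition specB :: "nat \<Rightarrow> nat" where "specB M = startB M + lenB M"
definition ones :: "nat \<Rightarrow> nat \<Rightarrow> nat" where "ones b l = (\<Sum>i<l. b ^ i)"

text \<open>Kind \<open>0\<close> puts a loop into every cell, kind \<open>k + 1\<close> only into the first cell of each of \<open>k\<close> levels.\<close>

definition pattern :: "nat \<Rightarrow> nat \<Rightarrow> nat \<Rightarrow> bool" where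
  "pattern \<kappa> j n \<longleftrightarrow> \<kappa> = 0 \<or> n = 0 \<and> j < \<kappa> - 1"

text \<open>The special cells of block \<open>M\<close> are the cells of level \<open>specB M\<close> whose last \<open>lenB M\<close> digits are all \<open>1\<close>.\<close>

definition lamB :: "nat \<Rightarrow> nat \<Rightarrow> nat \<Rightarrow> bool" where
  "lamB b j n \<longleftrightarrow> (\<exists>M. specB M \<le> j \<and> j < specB M + lenB M \<and>
     (n div b ^ (j - specB M)) mod b ^ lenB M = ones b (lenB M) \<and>
     pattern (kindB M) (j - specB M) (n mod b ^ (j - specB M)))"

lemma lenB_pos [simp]: "0 < lenB M" by (simp add: lenB_def)

lemma kindB_encode [simp]: "kindB (prod_encode (\<kappa>, prod_encode (l, i))) = \<kappa>"
  by (simp add: kindB_def)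

lemma lenB_encode [simp]: "lenB (prod_encode (\<kappa>, prod_encode (l, i))) = Suc l"
  by (simp add: lenB_def)

lemma startB_mono: "M \<le> M' \<Longrightarrow> startB M \<le> startB M'"
  by (rule lift_Suc_mono_le) auto

lemma startB_ge: "M \<le> startB M"
proof (induction M)
  case (Suc M)
  have "1 \<le> lenB M" using lenB_pos[of M] by linarith
  then show ?case using Suc by simp
qed simp

lemma specB_less: "M < M' \<Longrightarrow> specB M < specB M'"
proof -
  assume "M < M'"
  then have "startB (Suc M) \<le> startB M'" by (intro startB_mono) simp
  then show ?thesis using lenB_pos[of M] lenB_pos[of M'] unfolding specB_def startB.simps by linarith
qed

text \<open>Such a level belongs to an earlier block, as the first stretch of block \<open>M\<close>
  is empty.\<close>

lemma block_below:
  assumes "specB M' \<le> i" "i < specB M' + lenB M'" "i < specB M"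
  shows "i < startB M"
proof -
  have "M' < M"
  proof (rule ccontr)
    assume "\<not> M' < M"
    then have "M = M' \<or> specB M < specB M'" using specB_less by (meson nat_neq_iff)
    then show False using assms by auto
  qed
  then have "startB (Suc M') \<le> startB M" by (intro startB_mono) simp
  then show ?thesis using assms(2) by (simp add: specB_def)
qed

text \<open>From \<open>specB M\<close> on, the pattern and the empty last stretch of block
  \<open>M\<close> fill \<open>2 * lenB M\<close> levels, so no other block puts loops
  there.\<close>

lemma block_same:
  assumes "specB M' \<le> i" "i < specB M' + lenB M'" "specB M \<le> i" "i < specB M + 2 * lenB M"
  shows "M' = M"
proof (rule ccontr)
  assume "M' \<noteq> M"
  then consider "M' < M" | "M < M'" by linarith
  then show False
  proof cases
    case 1
    then have "startB (Suc M') \<le> startB M" by (intro startB_mono) simp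
    then show ?thesis using assms lenB_pos[of M] by (simp add: specB_def)
  next
    case 2
    then have "startB (Suc M) \<le> startB M'" by (intro startB_mono) simp
    then show ?thesis using assms lenB_pos[of M'] by (simp add: specB_def)
  qed
qed

lemma ones_Suc: "ones b (Suc l) = ones b l + b ^ l"
  by (simp add: ones_def)

lemma ones_Suc_shift: "ones b (Suc l) = 1 + b * ones b l"
proof (induction l)
  case (Suc l)
  have "ones b (Suc (Suc l)) = 1 + b * ones b l + b ^ Suc l" unfolding ones_Suc[of b "Suc l"] Suc.IH ..
  also have "\<dots> = 1 + b * ones b (Suc l)"
    by (simp only: ones_Suc[of b l] power_Suc distrib_left add.assoc)
  finally show ?case .
qed (simp add: ones_def)

lemma ones_add: "ones b (l + j) = ones b j + b ^ j * ones b l"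
  by (induction l) (simp_all add: ones_Suc power_add algebra_simps, simp add: ones_def)

lemma ones_bounds:
  assumes "6 \<le> b" "0 < l"
  shows "b ^ (l - 1) \<le> ones b l" "ones b l < 2 * b ^ (l - 1)"
proof -
  obtain l' where l: "l = Suc l'" using assms by (cases l) auto
  have "ones b (Suc l') < 2 * b ^ l'"
  proof (induction l')
    case (Suc l')
    have "ones b (Suc (Suc l')) < 2 * b ^ l' + b ^ Suc l'" using Suc by (simp add: ones_Suc)
    moreover have "2 * b ^ l' \<le> b * b ^ l'" using assms by (intro mult_right_mono) auto
    ultimately show ?case unfolding power_Suc by linarith
  qed (simp add: ones_def)
  then show "b ^ (l - 1) \<le> ones b l" "ones b l < 2 * b ^ (l - 1)" using l by (auto simp: ones_Suc)
qed

text \<open>Together with \<open>ones_bounds\<close>: a special cell is at least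
  \<open>b ^ (l - 1)\<close> cells away from both ends of its ancestor \<open>l\<close> levels up.
  This is the radius of the window.\<close>

lemma ones_less: "6 \<le> b \<Longrightarrow> 0 < l \<Longrightarrow> ones b l + b ^ (l - 1) + 1 \<le> b ^ l"
proof -
  assume b: "6 \<le> b" and l: "0 < l"
  have p: "1 \<le> b ^ (l - 1)" using b by simp
  have "6 * b ^ (l - 1) \<le> b * b ^ (l - 1)" using b by (intro mult_right_mono) auto
  also have "\<dots> = b ^ l" using l by (cases l) auto
  finally show ?thesis using ones_bounds[OF b l] p by linarith
qed

lemma card_digits:
  assumes "finite N" "finite R" "0 < (c::nat)"
  shows "finite {m. m div c \<in> N \<and> m mod c \<in> R} \<and> card {m. m div c \<in> N \<and> m mod c \<in> R} \<le> card N * card R"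
proof -
  have inj: "inj_on (\<lambda>m. (m div c, m mod c)) {m. m div c \<in> N \<and> m mod c \<in> R}"
    by (rule inj_onI) (metis div_mult_mod_eq prod.inject)
  have sub: "(\<lambda>m. (m div c, m mod c)) ` {m. m div c \<in> N \<and> m mod c \<in> R} \<subseteq> N \<times> R" by auto
  show ?thesis
    using card_inj_on_le[OF inj sub] inj_on_finite[OF inj sub] assms by (auto simp: card_cartesian_product)
qed

section \<open>Almost every time is generic\<close>

locale zoo_curve = loop_curve b "lamB b" s D col for b s D col
begin

definition special :: "nat \<Rightarrow> real \<Rightarrow> bool" where
  "special M t \<longleftrightarrow> cell (specB M) t mod b ^ lenB M = ones b (lenB M)"

lemma cell_le: "t \<in> {0..1} \<Longrightarrow> cell l t \<le> b ^ l"
proof -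
  assume t: "t \<in> {0..1}"
  have "real (cell l t) \<le> real b ^ l * t" using cell_bounds(1)[of t l] t by simp
  also have "\<dots> \<le> real b ^ l * 1" using t by (intro mult_left_mono) auto
  finally have "real (cell l t) \<le> real (b ^ l)" by simp
  then show ?thesis by linarith
qed

text \<open>Each further block of this kind and length excludes one of the \<open>b ^ Suc l\<close>
  strings of tested digits, so the proportion of surviving cells shrinks by a fixed factor.\<close>

lemma never_special_cover:
  assumes E: "E \<subseteq> {0..1}" "\<And>i t. t \<in> E \<Longrightarrow> \<not> special (prod_encode (\<kappa>, prod_encode (l, i))) t"
  shows "\<exists>J\<ge>J0. \<exists>N. finite N \<and> (\<forall>t\<in>E. cell J t \<in> N) \<and>
     real (card N) \<le> 2 * real b ^ J * (1 - 1 / real b ^ Suc l) ^ r"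
proof (induction r)
  case 0
  \<comment> \<open>The time 1 lies in the cell number \<open>b ^ J0\<close>, so there are
    \<open>b ^ J0 + 1\<close> cells; the factor 2 absorbs the extra one.\<close>
  have "1 \<le> b ^ J0" using b_pos by (simp add: Suc_leI)
  then have "real (b ^ J0 + 1) \<le> real (2 * b ^ J0)" by (simp only: of_nat_le_iff)
  then have "real (card {..b ^ J0}) \<le> 2 * real b ^ J0" by simp
  then show ?case using cell_le E(1) by (intro exI[of _ J0] conjI exI[of _ "{..b ^ J0}"]) auto
next
  case (Suc r)
  then obtain J N where J: "J0 \<le> J" and N: "finite N" "\<forall>t\<in>E. cell J t \<in> N"
     "real (card N) \<le> 2 * real b ^ J * (1 - 1 / real b ^ Suc l) ^ r" by blast
  \<comment> \<open>The running index \<open>J\<close> moves the block beyond level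
    \<open>J\<close>, where the cells in \<open>N\<close> put no condition on the digits
    yet.\<close>
  define M where "M = prod_encode (\<kappa>, prod_encode (l, J))"
  define a where "a = startB M"
  have "J \<le> M" unfolding M_def using le_prod_encode_2 order_trans by blast
  then have Ja: "J \<le> a" using startB_ge[of M] by (simp add: a_def)
  have e: "specB M = a + Suc l" "lenB M = Suc l" by (auto simp: specB_def a_def M_def)
  define N2 where "N2 = {m. m div b ^ (a - J) \<in> N \<and> m mod b ^ (a - J) \<in> {..<b ^ (a - J)}}"
  define N3 where "N3 = {m. m div b ^ Suc l \<in> N2 \<and> m mod b ^ Suc l \<in> {..<b ^ Suc l} - {ones b (Suc l)}}"
  have N2: "finite N2" "card N2 \<le> card N * b ^ (a - J)"
    unfolding N2_def using card_digits[OF N(1) finite_lessThan, of "b ^ (a - J)" "b ^ (a - J)"] b_pos by auto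
  have "ones b (Suc l) \<in> {..<b ^ Suc l}"
    using ones_less[OF b6, of "Suc l"] by simp
  then have "card ({..<b ^ Suc l} - {ones b (Suc l)}) = b ^ Suc l - 1" by (simp add: card_Diff_singleton)
  then have N3: "finite N3" "card N3 \<le> card N2 * (b ^ Suc l - 1)"
    unfolding N3_def using card_digits[OF N2(1), of "{..<b ^ Suc l} - {ones b (Suc l)}" "b ^ Suc l"] b_pos by auto
  have "cell (specB M) t \<in> N3" if t: "t \<in> E" for t
  proof -
    have t0: "0 \<le> t" using t E(1) by auto
    have 1: "cell (specB M) t div b ^ Suc l = cell a t" unfolding e by (rule cell_div[OF t0])
    have 2: "cell a t div b ^ (a - J) = cell J t" using cell_div[OF t0, of J "a - J"] Ja by simp
    have 3: "cell (specB M) t mod b ^ Suc l \<noteq> ones b (Suc l)"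
      using E(2)[OF t, of J] unfolding special_def M_def[symmetric] e(2) .
    show ?thesis unfolding N3_def N2_def using 1 2 3 N(2) t b_pos by simp
  qed
  moreover have "real (card N3) \<le> 2 * real b ^ specB M * (1 - 1 / real b ^ Suc l) ^ Suc r"
  proof -
    have bb: "0 < real b ^ Suc l" using b_gt1 by simp
    have p: "0 \<le> 1 - 1 / real b ^ Suc l"
      using one_le_power[of "real b" "Suc l"] b_gt1 by (simp del: power_Suc)
    have "1 \<le> b ^ Suc l" using b_pos by (simp add: Suc_leI)
    then have q: "real (b ^ Suc l - 1) = real b ^ Suc l * (1 - 1 / real b ^ Suc l)"
      using bb by (simp add: of_nat_diff field_simps)
    have "card N3 \<le> card N * b ^ (a - J) * (b ^ Suc l - 1)"
      using N3(2) N2(2) by (meson mult_le_mono1 order_trans)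
    then have "real (card N3) \<le> real (card N * b ^ (a - J) * (b ^ Suc l - 1))" by (simp only: of_nat_le_iff)
    also have "\<dots> = real (card N) * (real b ^ (a - J) * (real b ^ Suc l * (1 - 1 / real b ^ Suc l)))"
      unfolding of_nat_mult q by simp
    also have "\<dots> \<le> (2 * real b ^ J * (1 - 1 / real b ^ Suc l) ^ r) * (real b ^ (a - J) * (real b ^ Suc l * (1 - 1 / real b ^ Suc l)))"
      using N(3) p bb by (intro mult_right_mono mult_nonneg_nonneg) auto
    also have "\<dots> = 2 * (real b ^ J * real b ^ (a - J) * real b ^ Suc l) * (1 - 1 / real b ^ Suc l) ^ Suc r"
      by (simp only: power_Suc mult_ac)
    also have "real b ^ J * real b ^ (a - J) * real b ^ Suc l = real b ^ specB M"
      unfolding e(1) using Ja by (simp flip: power_add)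
    finally show ?thesis .
  qed
  moreover have "J0 \<le> specB M" using J Ja e by simp
  ultimately show ?case using N3(1) by blast
qed

lemma never_special_null:
  "hausdorffE dim s (curve ` {t \<in> {0..1}. \<forall>i. \<not> special (prod_encode (\<kappa>, prod_encode (l, i))) t}) = 0"
proof (rule curve_null_image)
  fix \<epsilon> :: real and J0 :: nat assume e: "\<epsilon> > 0"
  have p: "0 \<le> 1 - 1 / real b ^ Suc l" "1 - 1 / real b ^ Suc l < 1"
    using one_le_power[of "real b" "Suc l"] b_gt1 by (simp_all del: power_Suc)
  obtain r where r: "(1 - 1 / real b ^ Suc l) ^ r < \<epsilon> / 2"
    using real_arch_pow_inv[of "\<epsilon> / 2"] e p(2) by (metis half_gt_zero)
  have "\<exists>J\<ge>J0. \<exists>N. finite N \<and>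
     (\<forall>t\<in>{t \<in> {0..1}. \<forall>i. \<not> special (prod_encode (\<kappa>, prod_encode (l, i))) t}. cell J t \<in> N) \<and>
     real (card N) \<le> 2 * real b ^ J * (1 - 1 / real b ^ Suc l) ^ r"
    by (rule never_special_cover) auto
  then obtain J N where J: "J0 \<le> J" and N: "finite N"
     "\<forall>t\<in>{t \<in> {0..1}. \<forall>i. \<not> special (prod_encode (\<kappa>, prod_encode (l, i))) t}. cell J t \<in> N"
     "real (card N) \<le> 2 * real b ^ J * (1 - 1 / real b ^ Suc l) ^ r"
    by blast
  have "2 * real b ^ J * (1 - 1 / real b ^ Suc l) ^ r \<le> 2 * real b ^ J * (\<epsilon> / 2)"
    using r b_gt1 by (intro mult_left_mono) auto
  moreover have "2 * real b ^ J * (\<epsilon> / 2) = \<epsilon> * real b ^ J" by simp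
  ultimately have c: "real (card N) \<le> \<epsilon> * real b ^ J" using N(3) by linarith
  show "\<exists>J\<ge>J0. \<exists>N. finite N \<and>
     (\<forall>t\<in>{t \<in> {0..1}. \<forall>i. \<not> special (prod_encode (\<kappa>, prod_encode (l, i))) t}. cell J t \<in> N) \<and>
     real (card N) \<le> \<epsilon> * real b ^ J"
    by (intro exI[of _ J] exI[of _ N] conjI J N(1,2) c)
qed auto

text \<open>One occurrence for each length is enough: unbounded lengths produce infinitely many
  blocks.\<close>

definition generic :: "real \<Rightarrow> bool" where
  "generic t \<longleftrightarrow> (\<forall>\<kappa> l. \<exists>i. special (prod_encode (\<kappa>, prod_encode (l, i))) t)"

lemma nongeneric_null: "hausdorffE dim s (curve ` {t \<in> {0..1}. \<not> generic t}) = 0"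
proof -
  have "hausdorffE dim s (\<Union>m. curve ` {t \<in> {0..1}. \<forall>i.
     \<not> special (prod_encode (fst (prod_decode m), prod_encode (snd (prod_decode m), i))) t}) = 0"
    by (intro hausdorffE_null_UN never_special_null)
  moreover have "curve ` {t \<in> {0..1}. \<not> generic t} \<subseteq> (\<Union>m. curve ` {t \<in> {0..1}. \<forall>i.
     \<not> special (prod_encode (fst (prod_decode m), prod_encode (snd (prod_decode m), i))) t})"
  proof clarify
    fix t assume t: "t \<in> {0..1}" "\<not> generic t"
    then obtain \<kappa> l where "\<forall>i. \<not> special (prod_encode (\<kappa>, prod_encode (l, i))) t" by (auto simp: generic_def)
    then show "curve t \<in> (\<Union>m. curve ` {t \<in> {0..1}. \<forall>i.
     \<not> special (prod_encode (fst (prod_decode m), prod_encode (snd (prod_decode m), i))) t})"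
      using t(1) by (intro UN_I[of "prod_encode (\<kappa>, l)"]) auto
  qed
  ultimately show ?thesis by (rule hausdorffE_null_mono)
qed

section \<open>Vertex identifications near a special cell\<close>

text \<open>In the unit of the special cell and relative to its left end, \<open>loopL i n\<close> and \<open>loopR i n\<close>
  are the two times identified by a loop in its \<open>n\<close>-th subcell of depth \<open>i\<close>.\<close>

definition loopL :: "nat \<Rightarrow> nat \<Rightarrow> real" where "loopL i n = (real n * real b + 2) / real b ^ Suc i"
definition loopR :: "nat \<Rightarrow> nat \<Rightarrow> real" where "loopR i n = (real n * real b + 3) / real b ^ Suc i"

lemma special_quot:
  assumes "special M t" "t \<in> {0..1}"
  shows "cell (specB M) t = cell (startB M) t * b ^ lenB M + ones b (lenB M)"
    and "cell (specB M) t + b ^ (lenB M - 1) + 1 \<le> b ^ specB M"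
    and "b ^ (lenB M - 1) \<le> cell (specB M) t"
proof -
  let ?W = "cell (specB M) t" and ?q = "cell (startB M) t" and ?l = "lenB M"
  have q: "?W div b ^ ?l = ?q" unfolding specB_def using assms(2) by (intro cell_div) auto
  show W: "?W = ?q * b ^ ?l + ones b ?l"
    using assms(1) q unfolding special_def by (metis div_mult_mod_eq)
  show "b ^ (?l - 1) \<le> ?W" using W ones_bounds(1)[OF b6 lenB_pos, of M] by linarith
  have "?q < b ^ startB M"
  proof (rule ccontr)
    assume "\<not> ?q < b ^ startB M"
    then have "b ^ startB M * b ^ ?l \<le> ?q * b ^ ?l" by (intro mult_right_mono) auto
    then have "b ^ specB M \<le> ?q * b ^ ?l" by (simp add: specB_def power_add)
    moreover have "0 < ones b ?l" using ones_bounds(1)[OF b6 lenB_pos, of M] b_pos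
      by (metis less_le_trans zero_less_power)
    ultimately have "b ^ specB M < ?W" using W by linarith
    then show False using cell_le[OF assms(2), of "specB M"] by simp
  qed
  then have "Suc ?q * b ^ ?l \<le> b ^ startB M * b ^ ?l" by (intro mult_right_mono) auto
  then have "?q * b ^ ?l + b ^ ?l \<le> b ^ specB M" by (simp add: specB_def power_add)
  then show "?W + b ^ (?l - 1) + 1 \<le> b ^ specB M" using W ones_less[OF b6 lenB_pos, of M] by linarith
qed

text \<open>At level \<open>specB M\<close> the vertices of coarser loops are multiples of
  \<open>b ^ lenB M\<close>, and the digits 1 keep the window clear of these. A loop of the block
  itself sits in a special cell, and two special cells differ by a multiple of
  \<open>b ^ lenB M\<close>, which exceeds what the window allows.\<close>

lemma window_identifications:
  assumes sp: "special M t" "t \<in> {0..1}" and j: "j \<le> 2 * lenB M"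
    and rep: "rep (specB M + j) v = rep (specB M + j) v'" "v < v'"
    and win: "\<bar>real v / real b ^ j - real (cell (specB M) t)\<bar> < real b ^ (lenB M - 1)"
  shows "\<exists>i n. i < lenB M \<and> n < b ^ i \<and> pattern (kindB M) i n \<and>
     real v / real b ^ j = real (cell (specB M) t) + loopL i n \<and>
     real v' / real b ^ j = real (cell (specB M) t) + loopR i n"
proof -
  let ?W = "cell (specB M) t" and ?e = "specB M" and ?l = "lenB M"
  have bj: "0 < real b ^ j" using b_gt1 by simp
  obtain i' n' where i': "i' < ?e + j" "lamB b i' n'"
    and v: "v = (n' * b + 2) * b ^ (?e + j - Suc i')" "v' = (n' * b + 3) * b ^ (?e + j - Suc i')"
    using rep_pair[OF rep] by blast
  obtain M' where M': "specB M' \<le> i'" "i' < specB M' + lenB M'"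
     "(n' div b ^ (i' - specB M')) mod b ^ lenB M' = ones b (lenB M')"
     "pattern (kindB M') (i' - specB M') (n' mod b ^ (i' - specB M'))"
    using i'(2) unfolding lamB_def by blast
  have i'e: "?e \<le> i'"
  proof (rule ccontr)
    assume "\<not> ?e \<le> i'"
    then have "i' < startB M" using block_below[OF M'(1,2)] by simp
    then have k: "?e + j - Suc i' = (startB M - Suc i') + (?l + j)" by (simp add: specB_def)
    define x where "x = (n' * b + 2) * b ^ (startB M - Suc i')"
    have vx: "v = x * b ^ ?l * b ^ j" unfolding v(1) k x_def by (simp only: power_add mult.assoc)
    have "real v / real b ^ j = real (x * b ^ ?l)" unfolding vx using bj by simp
    then have "\<bar>real (x * b ^ ?l) - real ?W\<bar> < real (b ^ (?l - 1))" using win by simp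
    then have w: "x * b ^ ?l < ?W + b ^ (?l - 1)" "?W < x * b ^ ?l + b ^ (?l - 1)" by linarith+
    have W: "?W = cell (startB M) t * b ^ ?l + ones b ?l" by (rule special_quot(1)[OF sp])
    have o: "b ^ (?l - 1) \<le> ones b ?l" "ones b ?l + b ^ (?l - 1) + 1 \<le> b ^ ?l"
      using ones_bounds(1)[OF b6 lenB_pos] ones_less[OF b6 lenB_pos] by auto
    show False
    proof (cases "x \<le> cell (startB M) t")
      case True
      then have "x * b ^ ?l \<le> cell (startB M) t * b ^ ?l" by (rule mult_right_mono) simp
      then show False using w W o by linarith
    next
      case False
      then have "Suc (cell (startB M) t) * b ^ ?l \<le> x * b ^ ?l" by (intro mult_right_mono) auto
      then have "cell (startB M) t * b ^ ?l + b ^ ?l \<le> x * b ^ ?l" by simp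
      then show False using w W o by linarith
    qed
  qed
  have MM: "M' = M" using block_same[OF M'(1,2) i'e] i'(1) j by simp
  define i where "i = i' - ?e"
  have i: "i' = ?e + i" "i < ?l" "i < j" using i'e M'(2) i'(1) MM by (auto simp: i_def)
  define W' where "W' = n' div b ^ i"
  define n where "n = n' mod b ^ i"
  have n: "n < b ^ i" using b_pos by (simp add: n_def)
  have n': "n' = W' * b ^ i + n" unfolding W'_def n_def by (rule div_mult_mod_eq[symmetric])
  have W': "W' mod b ^ ?l = ones b ?l" using M'(3) MM by (simp add: W'_def i_def)
  have pat: "pattern (kindB M) i n" using M'(4) MM by (simp add: i_def n_def)
  have k: "?e + j - Suc i' = j - Suc i" using i by simp
  have bjk: "real b ^ j = real b ^ (j - Suc i) * real b ^ Suc i"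
    unfolding power_add[symmetric] using i(3) by (intro arg_cong[where f = "\<lambda>k. real b ^ k"]) linarith
  have bi: "real b ^ i > 0" "real b ^ (j - Suc i) > 0" using b_gt1 by auto
  have vv: "real v / real b ^ j = real W' + loopL i n" "real v' / real b ^ j = real W' + loopR i n"
  proof -
    have c: "real ((n' * b + k) * b ^ (j - Suc i)) / real b ^ j = real W' + (real n * real b + real k) / real b ^ Suc i" for k
    proof -
      have "real ((n' * b + k) * b ^ (j - Suc i)) / real b ^ j = (real n' * real b + real k) / real b ^ Suc i"
        unfolding bjk using bi(2) by simp
      also have "real n' * real b + real k = real W' * real b ^ Suc i + (real n * real b + real k)"
        by (subst n') (simp add: algebra_simps)
      also have "(real W' * real b ^ Suc i + (real n * real b + real k)) / real b ^ Suc i =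
          real W' + (real n * real b + real k) / real b ^ Suc i"
        using bi(1) b_gt1 by (simp add: add_divide_distrib)
      finally show ?thesis .
    qed
    show "real v / real b ^ j = real W' + loopL i n" "real v' / real b ^ j = real W' + loopR i n"
      unfolding v k loopL_def loopR_def using c[of 2] c[of 3] by simp_all
  qed
  have "n * b + 3 \<le> b ^ Suc i"
  proof -
    have "n * b + 3 \<le> Suc n * b" using b6 by simp
    also have "\<dots> \<le> b ^ i * b" using n by (intro mult_right_mono) auto
    finally show ?thesis by (simp add: mult.commute)
  qed
  then have "real (n * b + 3) \<le> real (b ^ Suc i)" by (simp only: of_nat_le_iff)
  then have lr: "0 \<le> loopL i n" "loopL i n \<le> 1"
    unfolding loopL_def using b_gt1 by (simp_all add: field_simps)
  \<comment> \<open>The window restricts the left vertex of the loop, which lies at most 1 to the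
    right of the left end of its cell \<open>W'\<close>.\<close>
  have "\<bar>real W' - real ?W\<bar> < real b ^ (?l - 1) + 1" using win lr unfolding vv by linarith
  then have "\<bar>real W' - real ?W\<bar> < real (b ^ (?l - 1) + 1)" by simp
  then have w: "W' < ?W + (b ^ (?l - 1) + 1)" "?W < W' + (b ^ (?l - 1) + 1)" by linarith+
  have "b ^ (?l - 1) + 1 \<le> b ^ ?l" using ones_less[OF b6 lenB_pos, of M] by linarith
  then have w': "W' < ?W + b ^ ?l" "?W < W' + b ^ ?l" using w by linarith+
  have "W' mod b ^ ?l = ?W mod b ^ ?l" using W' sp(1) by (simp add: special_def)
  have "W' = ?W"
  proof -
    have "int (b ^ ?l) dvd int W' - int ?W"
      using \<open>W' mod b ^ ?l = ?W mod b ^ ?l\<close> by (metis mod_eq_dvd_iff zmod_int)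
    moreover have "\<bar>int W' - int ?W\<bar> < int (b ^ ?l)" using w' by linarith
    ultimately have "int W' - int ?W = 0" using dvd_imp_le_int by (metis not_le abs_of_nat)
    then show ?thesis by simp
  qed
  then show ?thesis using vv i(2) n pat by blast
qed

lemma window_loop:
  assumes "special M t" "i < lenB M" "n < b ^ i" "pattern (kindB M) i n"
  shows "curve ((real (cell (specB M) t) + loopL i n) / real b ^ specB M) =
         curve ((real (cell (specB M) t) + loopR i n) / real b ^ specB M)"
proof -
  let ?W = "cell (specB M) t" and ?e = "specB M"
  define n' where "n' = ?W * b ^ i + n"
  have "n' div b ^ i = ?W" "n' mod b ^ i = n" using assms(3) by (simp_all add: n'_def)
  then have "lamB b (?e + i) n'"
    unfolding lamB_def using assms(1,2,4) by (intro exI[of _ M]) (simp add: special_def)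
  then have "rep (Suc (?e + i)) (n' * b + 2) = rep (Suc (?e + i)) (n' * b + 3)" by (simp only: rep_loop)
  then have c: "curve (real (n' * b + 2) / real b ^ Suc (?e + i)) = curve (real (n' * b + 3) / real b ^ Suc (?e + i))"
    by (rule curve_vertex_eq)
  have bi: "0 < real b ^ i" "0 < real b ^ ?e" "0 < real b" using b_gt1 by auto
  have "real (n' * b + 2) / real b ^ Suc (?e + i) = (real ?W + loopL i n) / real b ^ ?e"
    "real (n' * b + 3) / real b ^ Suc (?e + i) = (real ?W + loopR i n) / real b ^ ?e"
    unfolding loopL_def loopR_def n'_def using bi by (simp_all add: field_simps power_add)
  then show ?thesis using c by simp
qed

text \<open>At the levels of the first stretch the cell of \<open>t\<close> ends in the digit 1, so
  its end vertices are not divisible by \<open>b\<close>, while all vertices identified at these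
  levels are. Adjacent cells are therefore ordinary neighbours. This makes the tangents proper
  images of the line.\<close>

lemma window_far:
  assumes sp: "special M t" "t \<in> {0..1}" and u: "u \<in> {0..1}" and j: "j < lenB M"
    and far: "2 * real b ^ j \<le> real b ^ specB M * \<bar>u - t\<bar>"
  shows "\<not> adjt (specB M - j) t u"
proof
  let ?e = "specB M" and ?l = "lenB M"
  define l where "l = ?e - j"
  have l: "?e = l + j" "startB M < l" using j by (auto simp: l_def specB_def)
  assume "adjt (specB M - j) t u"
  then have adj: "adjt l t u" by (simp add: l_def)
  have t0: "0 \<le> t" and u0: "0 \<le> u" using sp u by auto
  let ?A = "cell l t" and ?B = "cell l u"
  obtain m where m: "?l = Suc m + j" using j by (metis add.commute add_Suc_right less_imp_Suc_add)
  have "?A = cell ?e t div b ^ j" unfolding l(1) by (rule cell_div[OF t0, symmetric])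
  also have "cell ?e t = (cell (startB M) t * b ^ Suc m + ones b (Suc m)) * b ^ j + ones b j"
    unfolding special_quot(1)[OF sp] m ones_add by (simp add: algebra_simps power_add)
  also have "((cell (startB M) t * b ^ Suc m + ones b (Suc m)) * b ^ j + ones b j) div b ^ j =
     cell (startB M) t * b ^ Suc m + ones b (Suc m)"
  proof -
    have "ones b j < b ^ j"
    proof (cases "j = 0")
      case False then show ?thesis using ones_less[OF b6, of j] by simp
    qed (simp add: ones_def)
    then show ?thesis by simp
  qed
  also have "\<dots> = (cell (startB M) t * b ^ m + ones b m) * b + 1"
    unfolding ones_Suc_shift by (simp add: algebra_simps)
  finally have A: "?A = (cell (startB M) t * b ^ m + ones b m) * b + 1" .
  have nd: "\<not> b dvd ?A" "\<not> b dvd Suc ?A"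
    using digit(3)[of 1 "cell (startB M) t * b ^ m + ones b m"] digit23(5)[of "cell (startB M) t * b ^ m + ones b m"] b6
    unfolding A by auto
  have pairs: "b dvd v \<and> b dvd w" if vw: "rep l v = rep l w" "v < w" for v w
  proof -
    obtain i n where i: "i < l" "lamB b i n" "v = (n * b + 2) * b ^ (l - Suc i)" "w = (n * b + 3) * b ^ (l - Suc i)"
      using rep_pair[OF vw] by blast
    obtain M' where M': "specB M' \<le> i" "i < specB M' + lenB M'" using i(2) unfolding lamB_def by blast
    have "i < specB M" using i(1) l(1) by linarith
    then have "i < startB M" by (rule block_below[OF M'])
    then have "0 < l - Suc i" using l(2) by simp
    then have "b dvd b ^ (l - Suc i)" by simp
    then show ?thesis using i(3,4) by simp
  qed
  obtain v w where vw: "v \<in> {?A, Suc ?A}" "w \<in> {?B, Suc ?B}" "rep l v = rep l w"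
    using adj unfolding adjt_def adj_def by blast
  have "\<not> b dvd v" using nd vw(1) by auto
  then have "v = w" using pairs vw(3) by (metis linorder_neqE_nat)
  then have "?A \<le> Suc ?B" "?B \<le> Suc ?A" using vw by auto
  then have "\<bar>real b ^ l * u - real b ^ l * t\<bar> < 2"
    using cell_bounds[OF t0, of l] cell_bounds[OF u0, of l] by linarith
  then have "real b ^ l * \<bar>u - t\<bar> < 2" by (simp add: abs_mult flip: right_diff_distrib)
  then have "real b ^ j * (real b ^ l * \<bar>u - t\<bar>) < real b ^ j * 2"
    using b_gt1 by (intro mult_strict_left_mono) auto
  then show False using far unfolding l(1) by (simp add: power_add mult_ac)
qed

end

section \<open>Tangents of the curve\<close>

text \<open>A common modulus of continuity reduces the interval to finitely many test
  points.\<close>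

lemma holder_uniform_limit:
  fixes f :: "nat \<Rightarrow> real \<Rightarrow> nat \<Rightarrow> real"
  assumes C: "0 \<le> C" and a: "0 < a"
    and f: "\<And>m x y. dE n (f m x) (f m y) \<le> C * \<bar>x - y\<bar> powr a"
    and F: "\<And>x y. dE n (F x) (F y) \<le> C * \<bar>x - y\<bar> powr a"
    and lim: "\<And>x. (\<lambda>m. dE n (f m x) (F x)) \<longlonglongrightarrow> 0"
    and e: "0 < e"
  shows "\<exists>N. \<forall>m\<ge>N. \<forall>x\<in>{-B..B}. dE n (f m x) (F x) < e"
proof -
  \<comment> \<open>Chosen to give \<open>C * \<eta> powr a \<le> e / 4\<close>;
    \<open>C + 1\<close> avoids a division by 0.\<close>
  define \<eta> where "\<eta> = (e / (4 * (C + 1))) powr (1 / a)"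
  have \<eta>: "0 < \<eta>" using C e by (simp add: \<eta>_def)
  have small: "C * d powr a \<le> e / 4" if "0 \<le> d" "d \<le> \<eta>" for d
  proof -
    have "d powr a \<le> \<eta> powr a" using that a by (intro powr_mono2) auto
    also have "\<eta> powr a = e / (4 * (C + 1))" using a C e by (simp add: \<eta>_def powr_powr)
    finally have "C * d powr a \<le> C * (e / (4 * (C + 1)))" using C by (rule mult_left_mono)
    also have "\<dots> \<le> e / 4" using C e by (simp add: field_simps)
    finally show ?thesis .
  qed
  have "compact {-B..B}" by simp
  then obtain T where T: "T \<subseteq> {-B..B}" "finite T" "{-B..B} \<subseteq> (\<Union>c\<in>T. ball c \<eta>)"
    by (rule compactE_image[of "{-B..B}" "{-B..B}" "\<lambda>c. ball c \<eta>"]) (use \<eta> in auto)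
  have "\<forall>c\<in>T. \<exists>N. \<forall>m\<ge>N. dE n (f m c) (F c) < e / 4"
    using order_tendstoD(2)[OF lim, of "e / 4"] e unfolding eventually_sequentially by auto
  then obtain N where N: "\<And>c m. c \<in> T \<Longrightarrow> m \<ge> N c \<Longrightarrow> dE n (f m c) (F c) < e / 4" by metis
  define N0 where "N0 = Max (insert 0 (N ` T))"
  show ?thesis
  proof (intro exI[of _ N0] allI impI ballI)
    fix m x assume m: "m \<ge> N0" and x: "x \<in> {-B..B}"
    obtain c where c: "c \<in> T" "\<bar>c - x\<bar> < \<eta>" using T(3) x by (force simp: dist_real_def)
    have "N c \<le> N0" unfolding N0_def using T(2) c(1) by (intro Max_ge) auto
    then have 1: "dE n (f m c) (F c) < e / 4" using N[OF c(1)] m by simp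
    have 2: "dE n (f m x) (f m c) \<le> e / 4"
      using f[of m x c] small[of "\<bar>x - c\<bar>"] c(2) by (simp add: abs_minus_commute)
    have 3: "dE n (F c) (F x) \<le> e / 4"
      using F[of c x] small[of "\<bar>c - x\<bar>"] c(2) by simp
    show "dE n (f m x) (F x) < e"
      using 1 2 3 e dE_triangle[of n "f m x" "F x" "f m c"] dE_triangle[of n "f m c" "F x" "F c"] by linarith
  qed
qed

section \<open>Zooming in at special cells\<close>

context zoo_curve
begin

definition ident :: "nat \<Rightarrow> real \<Rightarrow> real \<Rightarrow> bool" where
  "ident \<kappa> x y \<longleftrightarrow> (\<exists>i n. n < b ^ i \<and> pattern \<kappa> i n \<and> x = loopL i n \<and> y = loopR i n)"

text \<open>Extends the blown-up curves to the whole line with the same Hoelder constant; inside a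
  window it changes nothing.\<close>

definition clamp :: "real \<Rightarrow> real" where "clamp x = max 0 (min 1 x)"

text \<open>The parameter is centred at the left end of the special cell, the value at
  \<open>curve t\<close>. The time \<open>t\<close> itself thus sits at a parameter in
  \<open>[0, 1]\<close> that depends on the block.\<close>

definition zoom :: "real \<Rightarrow> nat \<Rightarrow> real \<Rightarrow> nat \<Rightarrow> real" where
  "zoom t M x = (\<lambda>k. (curve (clamp ((real (cell (specB M) t) + x) / real b ^ specB M)) k - curve t k) / kap ^ specB M)"

lemma clamp01 [simp]: "clamp x \<in> {0..1}" by (simp add: clamp_def)

lemma clamp_id: "x \<in> {0..1} \<Longrightarrow> clamp x = x" by (simp add: clamp_def)

lemma clamp_lip: "\<bar>clamp x - clamp y\<bar> \<le> \<bar>x - y\<bar>"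
  unfolding clamp_def max_def min_def by auto

lemma kap_pos: "0 < kap ^ l" using kap01 by simp

lemma zoom_dist:
  "dE dim (zoom t M x) (zoom t M y) =
    dE dim (curve (clamp ((real (cell (specB M) t) + x) / real b ^ specB M)))
      (curve (clamp ((real (cell (specB M) t) + y) / real b ^ specB M))) / kap ^ specB M"
  unfolding zoom_def by (rule dE_scale[OF kap_pos])

text \<open>Parameters are scaled by \<open>1 / b ^ l\<close> and values by \<open>kap ^ l\<close>,
  its power \<open>1 / s\<close>, so the constant does not depend on the block.\<close>

lemma zoom_holder: "dE dim (zoom t M x) (zoom t M y) \<le> C1 * \<bar>x - y\<bar> powr (1 / s)"
proof -
  let ?W = "real (cell (specB M) t)" and ?e = "specB M"
  let ?u = "clamp ((?W + x) / real b ^ ?e)" and ?v = "clamp ((?W + y) / real b ^ ?e)"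
  have "\<bar>?u - ?v\<bar> \<le> \<bar>(?W + x) / real b ^ ?e - (?W + y) / real b ^ ?e\<bar>" by (rule clamp_lip)
  also have "(?W + x) / real b ^ ?e - (?W + y) / real b ^ ?e = (x - y) / real b ^ ?e"
    by (simp flip: diff_divide_distrib)
  finally have uv: "\<bar>?u - ?v\<bar> \<le> \<bar>x - y\<bar> * (1 / real b ^ ?e)" by simp
  have 01: "0 \<le> ?u" "0 \<le> ?v" "\<bar>?u - ?v\<bar> \<le> 1" by (auto simp: clamp_def)
  have "dE dim (curve ?u) (curve ?v) \<le> C1 * \<bar>?u - ?v\<bar> powr (1 / s)" by (rule curve_holder[OF 01])
  also have "\<dots> \<le> C1 * (\<bar>x - y\<bar> * (1 / real b ^ ?e)) powr (1 / s)"
    using uv s1 C1_nonneg by (intro mult_left_mono powr_mono2) auto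
  also have "\<dots> = C1 * (\<bar>x - y\<bar> powr (1 / s) * kap ^ ?e)"
    unfolding kap_pow using b_gt1 by (subst powr_mult) auto
  finally show ?thesis
    unfolding zoom_dist using kap_pos[of ?e] by (simp add: divide_le_eq mult.assoc)
qed

lemma zoom_at_offset:
  assumes "u \<in> {0..1}"
  shows "zoom t M (real b ^ specB M * u - real (cell (specB M) t)) = (\<lambda>k. (curve u k - curve t k) / kap ^ specB M)"
  unfolding zoom_def using assms b_gt1 by (simp add: clamp_id)

lemma zoom_base:
  assumes "t \<in> {0..1}" shows "zoom t M (real b ^ specB M * t - real (cell (specB M) t)) = origin"
  unfolding zoom_at_offset[OF assms] by (simp add: origin_def)

lemma window_unit:
  assumes "special M t" "t \<in> {0..1}" "\<bar>x\<bar> \<le> real b ^ (lenB M - 1)"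
  shows "(real (cell (specB M) t) + x) / real b ^ specB M \<in> {0..1}"
proof -
  have "real (b ^ (lenB M - 1)) \<le> real (cell (specB M) t)"
    "real (cell (specB M) t + b ^ (lenB M - 1) + 1) \<le> real (b ^ specB M)"
    using special_quot(2,3)[OF assms(1,2)] by (simp_all only: of_nat_le_iff)
  then have "real b ^ (lenB M - 1) \<le> real (cell (specB M) t)"
    "real (cell (specB M) t) + real b ^ (lenB M - 1) + 1 \<le> real b ^ specB M"
    unfolding of_nat_add of_nat_power of_nat_1 .
  then have "0 \<le> real (cell (specB M) t) + x" "real (cell (specB M) t) + x \<le> real b ^ specB M"
    using assms(3) by linarith+
  then show ?thesis using b_gt1 by simp
qed

text \<open>Properness uniformly in the block: the lower bound tends to infinity with
  \<open>j\<close>.\<close>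

lemma zoom_far:
  assumes "special M t" "t \<in> {0..1}" "u \<in> {0..1}" "j < lenB M"
    and "2 * real b ^ j + 1 \<le> \<bar>real b ^ specB M * u - real (cell (specB M) t)\<bar>"
  shows "1 / (4 * kap ^ j) \<le> dE dim (\<lambda>k. (curve u k - curve t k) / kap ^ specB M) origin"
proof -
  let ?e = "specB M"
  have "\<bar>real b ^ ?e * t - real (cell ?e t)\<bar> \<le> 1" using cell_bounds[of t ?e] assms(2) by auto
  then have "2 * real b ^ j \<le> \<bar>real b ^ ?e * u - real b ^ ?e * t\<bar>" using assms(5) by linarith
  then have "2 * real b ^ j \<le> real b ^ ?e * \<bar>u - t\<bar>" by (simp add: abs_mult flip: right_diff_distrib)
  then have "\<not> adjt (?e - j) t u" by (rule window_far[OF assms(1-4)])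
  then have "kap ^ (?e - j) / 4 \<le> dE dim (curve t) (curve u)" by (rule curve_lower[OF assms(2,3)])
  then have le: "kap ^ (?e - j) / 4 / kap ^ ?e \<le> dE dim (curve u) (curve t) / kap ^ ?e"
    using kap_pos[of ?e] dE_commute[of dim "curve t" "curve u"] by (intro divide_right_mono) auto
  have "kap ^ ?e = kap ^ (?e - j) * kap ^ j" using assms(4) by (simp add: specB_def flip: power_add)
  then have "kap ^ (?e - j) / 4 / kap ^ ?e = 1 / (4 * kap ^ j)" using kap01 by simp
  moreover have "origin = (\<lambda>k. (curve t k - curve t k) / kap ^ ?e)" by (simp add: origin_def)
  ultimately show ?thesis
    using le dE_scale[OF kap_pos[of ?e], where n = dim and x = "curve u" and y = "curve t" and z = "curve t"] by simp
qed

lemma zoom_ident: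
  assumes "special M t" "t \<in> {0..1}" "i < lenB M" "n < b ^ i" "pattern (kindB M) i n"
  shows "zoom t M (loopL i n) = zoom t M (loopR i n)"
proof -
  have "n * b + 3 \<le> b ^ Suc i"
  proof -
    have "n * b + 3 \<le> Suc n * b" using b6 by simp
    also have "\<dots> \<le> b ^ i * b" using assms(4) by (intro mult_right_mono) auto
    finally show ?thesis by (simp add: mult.commute)
  qed
  then have "real (n * b + 3) \<le> real (b ^ Suc i)" by (simp only: of_nat_le_iff)
  then have "\<bar>loopL i n\<bar> \<le> 1" "\<bar>loopR i n\<bar> \<le> 1"
    unfolding loopL_def loopR_def using b_gt1 by (simp_all add: field_simps)
  moreover have "1 \<le> real b ^ (lenB M - 1)" using b_gt1 by (intro one_le_power) auto
  ultimately show ?thesis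
    unfolding zoom_def using window_unit[OF assms(1,2), of "loopL i n"] window_unit[OF assms(1,2), of "loopR i n"]
      window_loop[OF assms(1,3,4,5)] by (simp add: clamp_id)
qed

lemma finite_positive_lower_bound:
  assumes "finite A" "\<And>x. x \<in> A \<Longrightarrow> 0 < (f x :: real)"
  shows "\<exists>\<delta>>0. \<forall>x\<in>A. \<delta> \<le> f x"
proof (intro exI[of _ "Min (insert 1 (f ` A))"] conjI ballI)
  show "0 < Min (insert 1 (f ` A))" using assms by (subst Min_gr_iff) auto
  show "Min (insert 1 (f ` A)) \<le> f x" if "x \<in> A" for x using assms that by (intro Min_le) auto
qed

text \<open>Only finitely many loops are long enough to come close to two given times, so times that are not
  identified fall into cells that are not adjacent at some level independent of the block.\<close>

lemma zoom_separates:
  assumes xy: "x < y" "\<not> ident \<kappa> x y"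
  shows "\<exists>c>0. \<exists>j. \<forall>M t. special M t \<longrightarrow> t \<in> {0..1} \<longrightarrow> kindB M = \<kappa> \<longrightarrow> j \<le> lenB M \<longrightarrow>
     \<bar>x\<bar> + 2 < real b ^ (lenB M - 1) \<longrightarrow> \<bar>y\<bar> + 2 < real b ^ (lenB M - 1) \<longrightarrow>
     c \<le> dE dim (zoom t M x) (zoom t M y)"
proof -
  \<comment> \<open>A loop that joins neighbours of \<open>x\<close> and \<open>y\<close> has length
    at least \<open>(y - x) / 2\<close>, hence \<open>Suc i < I\<close> for its depth
    \<open>i\<close>.\<close>
  obtain I where I: "(1 / real b) ^ I < (y - x) / 2"
    using real_arch_pow_inv[of "(y - x) / 2" "1 / real b"] xy b_gt1 by auto
  define A where "A = {(i,n). i < I \<and> n < b ^ i \<and> pattern \<kappa> i n}"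
  have "A \<subseteq> (SIGMA i:{..<I}. {..<b ^ i})" by (auto simp: A_def)
  then have finA: "finite A" by (rule finite_subset) auto
  have "0 < max \<bar>loopL (fst p) (snd p) - x\<bar> \<bar>loopR (fst p) (snd p) - y\<bar>" if "p \<in> A" for p
  proof -
    obtain i n where p: "p = (i,n)" "n < b ^ i" "pattern \<kappa> i n" using \<open>p \<in> A\<close> by (auto simp: A_def)
    have "\<not> (x = loopL i n \<and> y = loopR i n)" using xy(2) p(2,3) unfolding ident_def by blast
    then show ?thesis using p(1) by (auto simp: less_max_iff_disj)
  qed
  note pos_max = this
  have "\<exists>\<delta>>0. \<forall>p\<in>A. \<delta> \<le> max \<bar>loopL (fst p) (snd p) - x\<bar> \<bar>loopR (fst p) (snd p) - y\<bar>"
    by (rule finite_positive_lower_bound[OF finA]) (rule pos_max)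
  then obtain \<delta> where \<delta>0: "0 < \<delta>"
    "\<forall>p\<in>A. \<delta> \<le> max \<bar>loopL (fst p) (snd p) - x\<bar> \<bar>loopR (fst p) (snd p) - y\<bar>" by blast
  have \<delta>: "0 < \<delta>" "\<And>i n. (i,n) \<in> A \<Longrightarrow> \<delta> \<le> max \<bar>loopL i n - x\<bar> \<bar>loopR i n - y\<bar>"
    using \<delta>0 by force+
  \<comment> \<open>At this mesh an identification of neighbours would come from a loop closer than
    \<open>\<delta>\<close> to the pair; the bound \<open>(y - x) / 4\<close> keeps the neighbours
    of \<open>x\<close> to the left of those of \<open>y\<close>.\<close>
  obtain j where j: "(1 / real b) ^ j < min \<delta> ((y - x) / 4)"
    using real_arch_pow_inv[of "min \<delta> ((y - x) / 4)" "1 / real b"] \<delta>(1) xy b_gt1 by auto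
  define q where "q = 1 / real b ^ j"
  have q: "0 < q" "q < \<delta>" "q < (y - x) / 4" "q \<le> 1"
    using j b_gt1 by (auto simp: q_def power_one_over one_le_power)
  have bj: "0 < real b ^ j" using b_gt1 by simp
  show ?thesis
  proof (intro exI[of _ "kap ^ j / 4"] exI[of _ j] conjI allI impI)
    show "0 < kap ^ j / 4" using kap01 by simp
  next
    fix M t assume sp: "special M t" "t \<in> {0..1}" and kd: "kindB M = \<kappa>" and jl: "j \<le> lenB M"
      and win: "\<bar>x\<bar> + 2 < real b ^ (lenB M - 1)" "\<bar>y\<bar> + 2 < real b ^ (lenB M - 1)"
    let ?W = "real (cell (specB M) t)" and ?e = "specB M"
    define u where "u = (?W + x) / real b ^ ?e"
    define v where "v = (?W + y) / real b ^ ?e"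
    have uv: "u \<in> {0..1}" "v \<in> {0..1}" unfolding u_def v_def
      by (rule window_unit[OF sp], use win in linarith)+
    have pu: "real b ^ (?e + j) * u = real b ^ j * (?W + x)" "real b ^ (?e + j) * v = real b ^ j * (?W + y)"
      unfolding u_def v_def using b_gt1 by (simp_all add: power_add)
    have near: "\<bar>real p / real b ^ j - ?W - x\<bar> \<le> q" if "p \<in> {cell (?e + j) u, Suc (cell (?e + j) u)}" "u \<in> {0..1}"
        "real b ^ (?e + j) * u = real b ^ j * (?W + x)" for p u x
    proof -
      have "\<bar>real p - real b ^ j * (?W + x)\<bar> \<le> 1"
        using cell_bounds[of u "?e + j"] that by auto
      then have "\<bar>real p - real b ^ j * (?W + x)\<bar> / real b ^ j \<le> 1 / real b ^ j" using bj by (intro divide_right_mono) auto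
      moreover have "\<bar>real p - real b ^ j * (?W + x)\<bar> / real b ^ j = \<bar>(real p - real b ^ j * (?W + x)) / real b ^ j\<bar>"
        using bj by simp
      moreover have "(real p - real b ^ j * (?W + x)) / real b ^ j = real p / real b ^ j - ?W - x"
        using bj by (simp add: diff_divide_distrib)
      ultimately show ?thesis by (simp add: q_def)
    qed
    have "\<not> adjt (?e + j) u v"
    proof
      assume "adjt (?e + j) u v"
      then obtain p p' where p: "p \<in> {cell (?e + j) u, Suc (cell (?e + j) u)}"
        "p' \<in> {cell (?e + j) v, Suc (cell (?e + j) v)}" "rep (?e + j) p = rep (?e + j) p'"
        unfolding adjt_def adj_def by blast
      have np: "\<bar>real p / real b ^ j - ?W - x\<bar> \<le> q" by (rule near[OF p(1) uv(1) pu(1)])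
      have np': "\<bar>real p' / real b ^ j - ?W - y\<bar> \<le> q" by (rule near[OF p(2) uv(2) pu(2)])
      have lt: "a < a'" if "\<bar>a - W - x\<bar> \<le> q" "\<bar>a' - W - y\<bar> \<le> q" for a a' W
        using that q unfolding abs_le_iff by argo
      have bd: "\<bar>a - W\<bar> < c" if "\<bar>a - W - x\<bar> \<le> q" "\<bar>x\<bar> + 2 < c" for a W c
        using that q unfolding abs_le_iff abs_less_iff by argo
      have "real p / real b ^ j < real p' / real b ^ j" by (rule lt[OF np np'])
      then have "p < p'" using bj by (simp add: divide_less_cancel)
      moreover have "\<bar>real p / real b ^ j - ?W\<bar> < real b ^ (lenB M - 1)" by (rule bd[OF np win(1)])
      ultimately obtain i n where i: "i < lenB M" "n < b ^ i" "pattern \<kappa> i n"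
        "real p / real b ^ j = ?W + loopL i n" "real p' / real b ^ j = ?W + loopR i n"
        using window_identifications[OF sp _ p(3)] jl kd by auto
      have l: "\<bar>loopL i n - x\<bar> \<le> q" "\<bar>loopR i n - y\<bar> \<le> q" using np np' i(4,5) by auto
      have "loopR i n - loopL i n = (1 / real b) ^ Suc i"
        unfolding loopL_def loopR_def by (simp add: power_one_over flip: diff_divide_distrib)
      then have "(y - x) / 2 \<le> (1 / real b) ^ Suc i" using l q unfolding abs_le_iff by argo
      then have lt2: "(1 / real b) ^ I < (1 / real b) ^ Suc i" using I by argo
      have "Suc i < I"
      proof (rule ccontr)
        assume "\<not> Suc i < I"
        then have "(1 / real b) ^ Suc i \<le> (1 / real b) ^ I" using b_gt1 by (intro power_decreasing) auto
        then show False using lt2 by simp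
      qed
      then have "(i,n) \<in> A" using i by (simp add: A_def)
      then show False using \<delta>(2) l q(2) by fastforce
    qed
    then have "kap ^ (?e + j) / 4 \<le> dE dim (curve u) (curve v)" by (rule curve_lower[OF uv])
    then have "kap ^ (?e + j) / 4 / kap ^ ?e \<le> dE dim (zoom t M x) (zoom t M y)"
    proof -
      assume le: "kap ^ (?e + j) / 4 \<le> dE dim (curve u) (curve v)"
      have "dE dim (zoom t M x) (zoom t M y) = dE dim (curve u) (curve v) / kap ^ ?e"
        unfolding zoom_dist u_def[symmetric] v_def[symmetric] clamp_id[OF uv(1)] clamp_id[OF uv(2)] ..
      then show ?thesis using le kap_pos[of ?e] by (simp only: divide_right_mono less_imp_le)
    qed
    then show "kap ^ j / 4 \<le> dE dim (zoom t M x) (zoom t M y)" using kap01 by (simp add: power_add)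
  qed
qed

lemma generic_blocks:
  assumes "generic t"
  shows "\<exists>f. strict_mono f \<and> (\<forall>m. special (f m) t \<and> kindB (f m) = \<kappa> \<and> m \<le> lenB (f m))"
proof -
  have ex: "\<exists>M. special M t \<and> kindB M = \<kappa> \<and> lenB M = Suc l" for l
    using assms unfolding generic_def by (metis kindB_encode lenB_encode)
  have "\<exists>f. \<forall>m. (special (f m) t \<and> kindB (f m) = \<kappa> \<and> m \<le> lenB (f m)) \<and> f m < f (Suc m)"
  proof (rule dependent_nat_choice)
    show "\<exists>M. special M t \<and> kindB M = \<kappa> \<and> 0 \<le> lenB M" using ex by blast
  next
    fix M m assume "special M t \<and> kindB M = \<kappa> \<and> m \<le> lenB M"
    \<comment> \<open>A length above the sum of all lengths up to block \<open>M\<close> can only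
      occur in a later block.\<close>
    obtain M' where M': "special M' t" "kindB M' = \<kappa>" "lenB M' = Suc (m + (\<Sum>i\<le>M. lenB i))" using ex by blast
    have "M < M'"
    proof (rule ccontr)
      assume "\<not> M < M'"
      then have "lenB M' \<le> (\<Sum>i\<le>M. lenB i)" by (intro member_le_sum) auto
      then show False using M'(3) by simp
    qed
    then show "\<exists>M'. (special M' t \<and> kindB M' = \<kappa> \<and> Suc m \<le> lenB M') \<and> M < M'" using M' by auto
  qed
  then show ?thesis by (auto simp: strict_mono_Suc_iff)
qed

text \<open>\<open>G\<close> is a limit of \<open>zoom t\<close> along blocks of kind
  \<open>\<kappa>\<close> and growing length, so the windows exhaust the line. The bounds of
  \<open>zoom_holder\<close>, \<open>zoom_far\<close> and \<open>zoom_separates\<close> do not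
  depend on the block and pass to the limit, as do the coincidences of
  \<open>zoom_ident\<close>.\<close>

lemma generic_tangent:
  assumes t: "generic t" "t \<in> {0..1}"
  shows "\<exists>G. (\<forall>x. G x \<in> eucl dim) \<and> (\<forall>x y. dE dim (G x) (G y) \<le> C1 * \<bar>x - y\<bar> powr (1 / s)) \<and>
    (\<forall>R. \<exists>B. \<forall>x. B < \<bar>x\<bar> \<longrightarrow> R < dE dim (G x) origin) \<and>
    (\<forall>x y. G x = G y \<longleftrightarrow> x = y \<or> ident \<kappa> x y \<or> ident \<kappa> y x) \<and>
    range G \<in> TanE dim (curve ` {0..1}) (curve t)"
proof -
  obtain f where f: "strict_mono f" "\<forall>m. special (f m) t \<and> kindB (f m) = \<kappa> \<and> m \<le> lenB (f m)"
    using generic_blocks[OF t(1), of \<kappa>] by blast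
  have "\<exists>\<sigma> G. strict_mono (\<sigma> :: nat \<Rightarrow> nat) \<and> (\<forall>x. G x \<in> eucl dim \<and> (\<lambda>m. dE dim (zoom t (f (\<sigma> m)) x) (G x)) \<longlonglongrightarrow> 0)"
  proof (rule pointwise_compactness[of "\<rat>" UNIV dim "\<lambda>m. zoom t (f m)"])
    show "countable (\<rat> :: real set)" by (rule countable_rat)
  next
    fix x e :: real assume e: "e > 0"
    have "((\<lambda>d. C1 * d powr (1 / s)) \<longlongrightarrow> C1 * 0 powr (1 / s)) (at_right 0)"
      using s1 by (intro tendsto_intros) (auto simp: eventually_at_filter)
    then have "\<forall>\<^sub>F d in at_right 0. C1 * d powr (1 / s) < e" using e by (intro order_tendstoD(2)) auto
    then obtain d0 where d0: "d0 > 0" "\<And>d. 0 < d \<Longrightarrow> d < d0 \<Longrightarrow> C1 * d powr (1 / s) < e"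
      unfolding eventually_at_right_field by blast
    obtain y where y: "y \<in> \<rat>" "x < y" "y < x + d0" using Rats_dense_in_real[of x "x + d0"] d0(1) by auto
    have "dE dim (zoom t (f m) x) (zoom t (f m) y) \<le> e" for m
      using zoom_holder[of t "f m" x y] d0(2)[of "\<bar>x - y\<bar>"] y by auto
    then show "\<exists>y\<in>\<rat>. \<forall>m. dE dim (zoom t (f m) x) (zoom t (f m) y) \<le> e" using y(1) by blast
  next
    fix y :: real
    have "dE dim (zoom t (f m) y) origin \<le> C1 * (\<bar>y\<bar> + 1) powr (1 / s)" for m
    proof -
      let ?\<theta> = "real b ^ specB (f m) * t - real (cell (specB (f m)) t)"
      have \<theta>: "\<bar>?\<theta>\<bar> \<le> 1" using cell_bounds[of t "specB (f m)"] t(2) by auto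
      have "dE dim (zoom t (f m) y) origin \<le> C1 * \<bar>y - ?\<theta>\<bar> powr (1 / s)"
        using zoom_holder[of t "f m" y ?\<theta>] zoom_base[OF t(2), of "f m"] by simp
      also have "\<dots> \<le> C1 * (\<bar>y\<bar> + 1) powr (1 / s)"
        using C1_nonneg s1 \<theta> by (intro mult_left_mono powr_mono2) auto
      finally show ?thesis .
    qed
    then show "\<exists>B. \<forall>m. dE dim (zoom t (f m) y) origin \<le> B" by blast
  qed auto
  then obtain \<sigma> G where \<sigma>: "strict_mono (\<sigma> :: nat \<Rightarrow> nat)"
    and G: "\<And>x. G x \<in> eucl dim" "\<And>x. (\<lambda>m. dE dim (zoom t (f (\<sigma> m)) x) (G x)) \<longlonglongrightarrow> 0" by blast
  define \<mu> where "\<mu> m = f (\<sigma> m)" for m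
  have \<mu>: "strict_mono \<mu>" using f(1) \<sigma> by (simp add: \<mu>_def strict_mono_def)
  have sp: "special (\<mu> m) t" and kd: "kindB (\<mu> m) = \<kappa>" and len: "m \<le> lenB (\<mu> m)" for m
    using f(2) seq_suble[OF \<sigma>, of m] by (auto simp: \<mu>_def intro: order_trans)
  have lim: "(\<lambda>m. dE dim (zoom t (\<mu> m) x) (G x)) \<longlonglongrightarrow> 0" for x using G(2) by (simp add: \<mu>_def)
  have lim2: "(\<lambda>m. dE dim (zoom t (\<mu> m) x) (zoom t (\<mu> m) y)) \<longlonglongrightarrow> dE dim (G x) (G y)" for x y
    by (rule tendsto_dE[OF lim lim])
  have hol: "dE dim (G x) (G y) \<le> C1 * \<bar>x - y\<bar> powr (1 / s)" for x y
    by (rule LIMSEQ_le_const2[OF lim2]) (use zoom_holder in blast)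
  have big: "\<exists>N. \<forall>m\<ge>N. B < real b ^ (lenB (\<mu> m) - 1)" for B
  proof -
    obtain N where N: "B < real b ^ N" using real_arch_pow[OF b_gt1] by blast
    have "B < real b ^ (lenB (\<mu> m) - 1)" if "m \<ge> Suc N" for m
    proof -
      have "N \<le> lenB (\<mu> m) - 1" using len[of m] that by simp
      then have "real b ^ N \<le> real b ^ (lenB (\<mu> m) - 1)" using b_gt1 by (intro power_increasing) auto
      then show ?thesis using N by linarith
    qed
    then show ?thesis by blast
  qed
  have far: "1 / (4 * kap ^ j) \<le> dE dim (G x) origin" if x: "2 * real b ^ j + 1 \<le> \<bar>x\<bar>" for j x
  proof -
    obtain N where N: "\<And>m. m \<ge> N \<Longrightarrow> \<bar>x\<bar> < real b ^ (lenB (\<mu> m) - 1)" using big[of "\<bar>x\<bar>"] by blast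
    have le: "1 / (4 * kap ^ j) \<le> dE dim (zoom t (\<mu> m) x) origin" if m: "m \<ge> max N (Suc j)" for m
    proof -
      let ?u = "(real (cell (specB (\<mu> m)) t) + x) / real b ^ specB (\<mu> m)"
      have u: "?u \<in> {0..1}" using N[of m] m by (intro window_unit[OF sp t(2)]) auto
      have "real b ^ specB (\<mu> m) * ?u - real (cell (specB (\<mu> m)) t) = x" using b_gt1 by simp
      moreover have "j < lenB (\<mu> m)" using len[of m] m by simp
      ultimately show ?thesis
        using zoom_far[OF sp t(2) u, where j = j] x zoom_at_offset[OF u, of t "\<mu> m"] by simp
    qed
    have "(\<lambda>m. dE dim (zoom t (\<mu> m) x) origin) \<longlonglongrightarrow> dE dim (G x) origin"
      by (rule tendsto_dE[OF lim]) simp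
    then show ?thesis by (rule LIMSEQ_le_const) (use le in blast)
  qed
  have kap_big: "\<exists>j. R < 1 / (4 * kap ^ j)" for R
  proof -
    have "0 < 1 / (4 * (\<bar>R\<bar> + 1))" by simp
    then obtain j where "kap ^ j < 1 / (4 * (\<bar>R\<bar> + 1))" using kap_pow_small by blast
    then have "(\<bar>R\<bar> + 1) * (4 * kap ^ j) < 1" by (simp add: field_simps)
    then have "\<bar>R\<bar> + 1 < 1 / (4 * kap ^ j)" using kap_pos[of j] by (simp add: less_divide_eq)
    then show ?thesis by (intro exI[of _ j]) linarith
  qed
  have proper: "\<exists>B. \<forall>x. B < \<bar>x\<bar> \<longrightarrow> R < dE dim (G x) origin" for R
  proof -
    obtain j where "R < 1 / (4 * kap ^ j)" using kap_big by blast
    then have "\<forall>x. 2 * real b ^ j + 1 < \<bar>x\<bar> \<longrightarrow> R < dE dim (G x) origin"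
      using far[of j] by (meson less_imp_le less_le_trans)
    then show ?thesis by blast
  qed
  have id1: "G x = G y" if xy: "ident \<kappa> x y" for x y
  proof -
    obtain i n where i: "n < b ^ i" "pattern \<kappa> i n" "x = loopL i n" "y = loopR i n" using xy unfolding ident_def by blast
    have "\<forall>\<^sub>F m in sequentially. dE dim (zoom t (\<mu> m) x) (zoom t (\<mu> m) y) = 0"
      unfolding eventually_sequentially
    proof (intro exI[of _ "Suc i"] allI impI)
      fix m assume "Suc i \<le> m"
      then have "i < lenB (\<mu> m)" using len[of m] by simp
      then show "dE dim (zoom t (\<mu> m) x) (zoom t (\<mu> m) y) = 0"
        using zoom_ident[OF sp t(2) _ i(1)] i kd by simp
    qed
    then have "(\<lambda>m. dE dim (zoom t (\<mu> m) x) (zoom t (\<mu> m) y)) \<longlonglongrightarrow> 0" by (rule tendsto_eventually)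
    then have "dE dim (G x) (G y) = 0" using lim2 LIMSEQ_unique by blast
    then show ?thesis using dE_eq_0 G(1) by blast
  qed
  have id2: "G x \<noteq> G y" if xy: "x < y" "\<not> ident \<kappa> x y" for x y
  proof -
    obtain j c where c: "0 < c" "\<forall>M t. special M t \<longrightarrow> t \<in> {0..1} \<longrightarrow> kindB M = \<kappa> \<longrightarrow> j \<le> lenB M \<longrightarrow>
     \<bar>x\<bar> + 2 < real b ^ (lenB M - 1) \<longrightarrow> \<bar>y\<bar> + 2 < real b ^ (lenB M - 1) \<longrightarrow>
     c \<le> dE dim (zoom t M x) (zoom t M y)" using zoom_separates[OF xy] by blast
    obtain N where N: "\<And>m. m \<ge> N \<Longrightarrow> max (\<bar>x\<bar> + 2) (\<bar>y\<bar> + 2) < real b ^ (lenB (\<mu> m) - 1)" using big by blast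
    have "c \<le> dE dim (zoom t (\<mu> m) x) (zoom t (\<mu> m) y)" if "m \<ge> max N j" for m
      using N[of m] len[of m] that by (intro c(2)[rule_format] sp t(2) kd) auto
    then have "c \<le> dE dim (G x) (G y)" using LIMSEQ_le_const[OF lim2] by blast
    then show ?thesis using c(1) by auto
  qed
  have id: "G x = G y \<longleftrightarrow> x = y \<or> ident \<kappa> x y \<or> ident \<kappa> y x" for x y
    using id1[of x y] id1[of y x] id2[of x y] id2[of y x] by (metis linorder_neqE_linordered_idom)
  define rr where "rr m = kap ^ specB (\<mu> m)" for m
  define Xs where "Xs m = (\<lambda>y i. (y i - curve t i) / rr m) ` (curve ` {0..1})" for m
  have rr_dec: "decseq rr"
    unfolding decseq_Suc_iff rr_def
  proof
    fix m
    have "specB (\<mu> m) \<le> specB (\<mu> (Suc m))" using specB_less \<mu> by (simp add: strict_mono_Suc_iff less_imp_le)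
    then show "kap ^ specB (\<mu> (Suc m)) \<le> kap ^ specB (\<mu> m)" using kap01 by (intro power_decreasing) auto
  qed
  have rr_lim: "rr \<longlonglongrightarrow> 0"
  proof -
    have "strict_mono (\<lambda>m. specB (\<mu> m))" using specB_less \<mu> by (simp add: strict_mono_def)
    moreover have "(\<lambda>m. kap ^ m) \<longlonglongrightarrow> 0" using kap01 by (intro LIMSEQ_realpow_zero) auto
    ultimately show ?thesis unfolding rr_def using LIMSEQ_subseq_LIMSEQ by (force simp: o_def)
  qed
  have unif: "\<exists>N. \<forall>m\<ge>N. \<forall>x\<in>{-B..B}. dE dim (zoom t (\<mu> m) x) (G x) < e" if "e > 0" for B e
    by (rule holder_uniform_limit[OF C1_nonneg _ zoom_holder hol lim that]) (use s1 in auto)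
  have aw: "aw_conv dim Xs (range G)"
    unfolding aw_conv_def
  proof (intro allI impI conjI)
    fix r :: real assume r: "r > 0"
    obtain j where j: "r < 1 / (4 * kap ^ j)" using kap_big by blast
    \<comment> \<open>The ball of radius \<open>r\<close> sees only parameters in
      \<open>[-B, B]\<close>, both in the limit and in the late blow-ups, and there the convergence
      is uniform.\<close>
    define B where "B = 2 * real b ^ j + 1"
    show "(\<lambda>m. excE dim (Xs m \<inter> cballE dim r) (range G)) \<longlonglongrightarrow> 0"
    proof (rule tendsto_zero_ennreal)
      fix e :: real assume e: "0 < e"
      obtain N where N: "\<And>m x. m \<ge> N \<Longrightarrow> x \<in> {-B..B} \<Longrightarrow> dE dim (zoom t (\<mu> m) x) (G x) < e / 2"
        using unif[of "e / 2" B] half_gt_zero[OF e] by blast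
      show "\<forall>\<^sub>F m in sequentially. excE dim (Xs m \<inter> cballE dim r) (range G) < ennreal e"
        unfolding eventually_sequentially
      proof (intro exI[of _ "max N (Suc j)"] allI impI)
        fix m assume m: "max N (Suc j) \<le> m"
        have "excE dim (Xs m \<inter> cballE dim r) (range G) \<le> ennreal (e / 2)"
        proof (rule excE_le)
          fix a assume a: "a \<in> Xs m \<inter> cballE dim r"
          then obtain u where u: "u \<in> {0..1}" "a = (\<lambda>k. (curve u k - curve t k) / kap ^ specB (\<mu> m))"
            by (auto simp: Xs_def rr_def)
          define x where "x = real b ^ specB (\<mu> m) * u - real (cell (specB (\<mu> m)) t)"
          have az: "a = zoom t (\<mu> m) x" unfolding x_def u(2) by (rule zoom_at_offset[OF u(1), symmetric])
          have "\<bar>x\<bar> \<le> B"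
          proof (rule ccontr)
            assume "\<not> \<bar>x\<bar> \<le> B"
            then have "1 / (4 * kap ^ j) \<le> dE dim a origin"
              unfolding u(2) x_def B_def using len[of m] m by (intro zoom_far[OF sp t(2) u(1)]) auto
            then show False using a j by (auto simp: cballE_def dE_commute)
          qed
          then have "x \<in> {-B..B}" by (simp add: abs_le_iff minus_le_iff)
          then have "dE dim a (G x) < e / 2" unfolding az using N[of m x] m by simp
          then show "\<exists>c\<in>range G. dE dim a c \<le> e / 2" by (auto intro: less_imp_le)
        qed
        also have "\<dots> < ennreal e" using e by (simp add: ennreal_less_iff)
        finally show "excE dim (Xs m \<inter> cballE dim r) (range G) < ennreal e" .
      qed
    qed
    show "(\<lambda>m. excE dim (range G \<inter> cballE dim r) (Xs m)) \<longlonglongrightarrow> 0"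
    proof (rule tendsto_zero_ennreal)
      fix e :: real assume e: "0 < e"
      obtain N where N: "\<And>m x. m \<ge> N \<Longrightarrow> x \<in> {-B..B} \<Longrightarrow> dE dim (zoom t (\<mu> m) x) (G x) < e / 2"
        using unif[of "e / 2" B] half_gt_zero[OF e] by blast
      obtain N' where N': "\<And>m. m \<ge> N' \<Longrightarrow> B < real b ^ (lenB (\<mu> m) - 1)" using big by blast
      show "\<forall>\<^sub>F m in sequentially. excE dim (range G \<inter> cballE dim r) (Xs m) < ennreal e"
        unfolding eventually_sequentially
      proof (intro exI[of _ "max N N'"] allI impI)
        fix m assume m: "max N N' \<le> m"
        have "excE dim (range G \<inter> cballE dim r) (Xs m) \<le> ennreal (e / 2)"
        proof (rule excE_le)
          fix a assume a: "a \<in> range G \<inter> cballE dim r"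
          then obtain x where x: "a = G x" by blast
          have xB: "\<bar>x\<bar> \<le> B"
          proof (rule ccontr)
            assume "\<not> \<bar>x\<bar> \<le> B"
            then have "1 / (4 * kap ^ j) \<le> dE dim (G x) origin" using far[of j x] by (simp add: B_def)
            then show False using a j x by (auto simp: cballE_def dE_commute)
          qed
          let ?u = "(real (cell (specB (\<mu> m)) t) + x) / real b ^ specB (\<mu> m)"
          have u: "?u \<in> {0..1}" using N'[of m] m xB by (intro window_unit[OF sp t(2)]) auto
          have "real b ^ specB (\<mu> m) * ?u - real (cell (specB (\<mu> m)) t) = x" using b_gt1 by simp
          then have "zoom t (\<mu> m) x = (\<lambda>k. (curve ?u k - curve t k) / kap ^ specB (\<mu> m))"
            using zoom_at_offset[OF u, of t "\<mu> m"] by simp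
          then have "zoom t (\<mu> m) x \<in> Xs m" unfolding Xs_def rr_def using u by blast
          moreover have "dE dim a (zoom t (\<mu> m) x) \<le> e / 2"
          proof -
            have "x \<in> {-B..B}" using xB by (simp add: abs_le_iff minus_le_iff)
            then show ?thesis using N[of m x] m dE_commute[of dim "G x" "zoom t (\<mu> m) x"] unfolding x by simp
          qed
          ultimately show "\<exists>c\<in>Xs m. dE dim a c \<le> e / 2" by blast
        qed
        also have "\<dots> < ennreal e" using e by (simp add: ennreal_less_iff)
        finally show "excE dim (range G \<inter> cballE dim r) (Xs m) < ennreal e" .
      qed
    qed
  qed
  have closed: "closedE dim (range G)"
    unfolding closedE_def
  proof (intro conjI ballI impI)
    show "range G \<subseteq> eucl dim" using G(1) by blast
    fix z assume z: "z \<in> eucl dim" and H: "\<forall>e>0. \<exists>y\<in>range G. dE dim z y < e"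
    have "\<forall>m. \<exists>x. dE dim z (G x) < 1 / real (Suc m)" using H by auto
    then obtain x where x: "\<And>m. dE dim z (G (x m)) < 1 / real (Suc m)" by metis
    obtain B where B: "\<And>x. B < \<bar>x\<bar> \<Longrightarrow> dE dim z origin + 1 < dE dim (G x) origin" using proper by blast
    have "\<bar>x m\<bar> \<le> B" for m
    proof (rule ccontr)
      assume "\<not> \<bar>x m\<bar> \<le> B"
      then have "dE dim z origin + 1 < dE dim (G (x m)) origin" using B by simp
      moreover have "1 / real (Suc m) \<le> 1" by simp
      ultimately show False
        using x[of m] dE_triangle[of dim "G (x m)" origin z] dE_commute[of dim z "G (x m)"] by linarith
    qed
    then have "x m \<in> {-B..B}" for m by (simp add: abs_le_iff minus_le_iff)
    then obtain l \<tau> where \<tau>: "strict_mono (\<tau> :: nat \<Rightarrow> nat)" "(x \<circ> \<tau>) \<longlonglongrightarrow> l"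
      using compact_Icc[of "-B" B] unfolding compact_eq_seq_compact_metric seq_compact_def by meson
    have "(\<lambda>m. dE dim (G (x (\<tau> m))) (G l)) \<longlonglongrightarrow> 0"
    proof (rule tendsto_sandwich[OF always_eventually always_eventually tendsto_const])
      have "(\<lambda>m. \<bar>x (\<tau> m) - l\<bar>) \<longlonglongrightarrow> 0" using \<tau>(2) by (simp add: LIM_zero tendsto_rabs_zero o_def)
      then have "(\<lambda>m. C1 * \<bar>x (\<tau> m) - l\<bar> powr (1 / s)) \<longlonglongrightarrow> C1 * 0 powr (1 / s)"
        using s1 by (intro tendsto_mult tendsto_const tendsto_powr') auto
      then show "(\<lambda>m. C1 * \<bar>x (\<tau> m) - l\<bar> powr (1 / s)) \<longlonglongrightarrow> 0" by simp
    qed (use hol in auto)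
    moreover have "(\<lambda>m. dE dim (G (x (\<tau> m))) z) \<longlonglongrightarrow> 0"
    proof (rule tendsto_sandwich[OF always_eventually always_eventually tendsto_const])
      show "(\<lambda>m. 1 / real (Suc (\<tau> m))) \<longlonglongrightarrow> 0"
        using LIMSEQ_subseq_LIMSEQ[OF lim_1_over_n[THEN LIMSEQ_Suc] \<tau>(1)] by (simp add: o_def)
      show "\<forall>m. dE dim (G (x (\<tau> m))) z \<le> 1 / real (Suc (\<tau> m))"
      proof
        fix m
        show "dE dim (G (x (\<tau> m))) z \<le> 1 / real (Suc (\<tau> m))"
          using x[of "\<tau> m"] dE_commute[of dim z "G (x (\<tau> m))"] by simp
      qed
    qed simp
    ultimately have "G l = z" by (rule dE_limit_unique[OF _ _ G(1) z])
    then show "z \<in> range G" by blast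
  qed
  have "origin \<in> range G"
  proof (rule aw_conv_limit[OF aw closed _ origin_eucl])
    show "Xs m \<subseteq> eucl dim" for m unfolding Xs_def using blowup_eucl curve_eucl by blast
    fix e :: real assume e: "e > 0"
    have "origin \<in> Xs m" for m
    proof -
      have "origin = (\<lambda>i. (curve t i - curve t i) / rr m)" by (simp add: origin_def)
      then show ?thesis unfolding Xs_def using t(2) by blast
    qed
    then have "\<exists>x'\<in>Xs m. dE dim origin x' < e" for m using e by (intro bexI[of _ origin]) auto
    then show "\<exists>\<^sub>F m in sequentially. \<exists>x'\<in>Xs m. dE dim origin x' < e" by (simp add: frequently_sequentially) blast
  qed
  then have "tangentE dim (curve ` {0..1}) (curve t) (range G)"
    unfolding tangentE_def using t(2) closed rr_dec rr_lim aw kap_pos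
    by (intro conjI exI[of _ rr]) (auto simp: Xs_def[abs_def] rr_def)
  then show ?thesis using G(1) hol proper id unfolding TanE_def by blast
qed

end

section \<open>Proper images of the line\<close>

text \<open>\<open>\<phi>\<close> is a locally constant label of the pieces. Labels move along a
  homeomorphism by composition, so no topology on \<open>eucl n\<close> and no components are
  needed.\<close>

definition cuts3 :: "nat \<Rightarrow> (nat \<Rightarrow> real) set \<Rightarrow> (nat \<Rightarrow> real) \<Rightarrow> bool" where
  "cuts3 n X p \<longleftrightarrow> (\<exists>\<phi> :: (nat \<Rightarrow> real) \<Rightarrow> nat.
     (\<forall>x\<in>X - {p}. \<exists>d>0. \<forall>y\<in>X - {p}. dE n x y < d \<longrightarrow> \<phi> y = \<phi> x) \<and> {0, 1, 2} \<subseteq> \<phi> ` (X - {p}))"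

lemma cuts3_transfer:
  assumes fg: "\<And>x. x \<in> A \<Longrightarrow> f x \<in> B \<and> g (f x) = x" "\<And>y. y \<in> B \<Longrightarrow> g y \<in> A \<and> f (g y) = y"
    and g: "contE m n g B" and p: "p \<in> A" "cuts3 n A p"
  shows "cuts3 m B (f p)"
proof -
  obtain \<phi> :: "(nat \<Rightarrow> real) \<Rightarrow> nat" where
    \<phi>: "\<forall>x\<in>A - {p}. \<exists>d>0. \<forall>y\<in>A - {p}. dE n x y < d \<longrightarrow> \<phi> y = \<phi> x" "{0, 1, 2} \<subseteq> \<phi> ` (A - {p})"
    using p(2) unfolding cuts3_def by blast
  have mem: "g y \<in> A - {p}" if "y \<in> B - {f p}" for y using that fg(2)[of y] by auto
  show ?thesis
    unfolding cuts3_def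
  proof (intro exI[of _ "\<lambda>y. \<phi> (g y)"] conjI ballI)
    fix x assume x: "x \<in> B - {f p}"
    obtain d where d: "d > 0" "\<forall>y\<in>A - {p}. dE n (g x) y < d \<longrightarrow> \<phi> y = \<phi> (g x)" using \<phi>(1) mem[OF x] by blast
    obtain d' where d': "d' > 0" "\<forall>y\<in>B. dE m x y < d' \<longrightarrow> dE n (g x) (g y) < d"
      using g x d(1) unfolding contE_def by blast
    show "\<exists>d>0. \<forall>y\<in>B - {f p}. dE m x y < d \<longrightarrow> \<phi> (g y) = \<phi> (g x)"
      using d(2) d' mem by (intro exI[of _ d']) blast
  next
    show "{0, 1, 2} \<subseteq> (\<lambda>y. \<phi> (g y)) ` (B - {f p})"
    proof
      fix i :: nat assume "i \<in> {0, 1, 2}"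
      then have "i \<in> \<phi> ` (A - {p})" by (rule subsetD[OF \<phi>(2)])
      then obtain x where x: "x \<in> A" "x \<noteq> p" "\<phi> x = i" by auto
      have "f x \<noteq> f p" using fg(1)[OF x(1)] fg(1)[OF p(1)] x(2) by metis
      then show "i \<in> (\<lambda>y. \<phi> (g y)) ` (B - {f p})" using fg(1)[OF x(1)] x(3) by (intro image_eqI[of _ _ "f x"]) auto
    qed
  qed
qed

lemma homeomorphic_cuts3_card:
  assumes "homeomorphicE n A m B"
  shows "card {p \<in> A. cuts3 n A p} = card {q \<in> B. cuts3 m B q}"
proof -
  obtain f where f: "bij_betw f A B" "contE n m f A" "contE m n (inv_into A f) B"
    using assms unfolding homeomorphicE_def by blast
  let ?g = "inv_into A f"
  have 1: "f x \<in> B \<and> ?g (f x) = x" if "x \<in> A" for x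
    using f(1) that by (auto simp: bij_betw_def)
  have 2: "?g y \<in> A \<and> f (?g y) = y" if "y \<in> B" for y
    using f(1) that by (auto simp: bij_betw_def f_inv_into_f inv_into_into)
  have "bij_betw f {p \<in> A. cuts3 n A p} {q \<in> B. cuts3 m B q}"
  proof (rule bij_betw_byWitness[where f' = ?g])
    show "f ` {p \<in> A. cuts3 n A p} \<subseteq> {q \<in> B. cuts3 m B q}"
      using cuts3_transfer[OF 1 2 f(3)] 1 by blast
    show "?g ` {q \<in> B. cuts3 m B q} \<subseteq> {p \<in> A. cuts3 n A p}"
      using cuts3_transfer[OF 2 1 f(2)] 2 by blast
  qed (use 1 2 in auto)
  then show ?thesis by (rule bij_betw_same_card)
qed

locale line_image =
  fixes n :: nat and G :: "real \<Rightarrow> nat \<Rightarrow> real" and C a :: real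
  assumes G_eucl: "G x \<in> eucl n"
    and C0: "0 \<le> C" and a0: "0 < a"
    and holder: "dE n (G x) (G y) \<le> C * \<bar>x - y\<bar> powr a"
    and proper: "\<exists>B. \<forall>x. B < \<bar>x\<bar> \<longrightarrow> R < dE n (G x) origin"
begin

lemma G_tendsto:
  assumes "x \<longlonglongrightarrow> l" shows "(\<lambda>m. dE n (G (x m)) (G l)) \<longlonglongrightarrow> 0"
proof (rule tendsto_sandwich[OF always_eventually always_eventually tendsto_const])
  have "(\<lambda>m. \<bar>x m - l\<bar>) \<longlonglongrightarrow> 0" using assms by (simp add: LIM_zero tendsto_rabs_zero)
  then have "(\<lambda>m. C * \<bar>x m - l\<bar> powr a) \<longlonglongrightarrow> C * 0 powr a"
    using a0 by (intro tendsto_mult tendsto_const tendsto_powr') auto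
  then show "(\<lambda>m. C * \<bar>x m - l\<bar> powr a) \<longlonglongrightarrow> 0" by simp
qed (use holder in auto)

lemma G_cont:
  assumes "0 < e" shows "\<exists>d>0. \<forall>y. \<bar>y - x\<bar> < d \<longrightarrow> dE n (G x) (G y) < e"
proof (rule ccontr)
  assume "\<not> ?thesis"
  then have neg: "\<And>d. d > 0 \<Longrightarrow> \<exists>y. \<bar>y - x\<bar> < d \<and> e \<le> dE n (G x) (G y)" by (meson not_less)
  have "\<forall>m. \<exists>y. \<bar>y - x\<bar> < 1 / real (Suc m) \<and> e \<le> dE n (G x) (G y)" by (intro allI neg) simp
  then obtain y where y: "\<And>m. \<bar>y m - x\<bar> < 1 / real (Suc m)" "\<And>m. e \<le> dE n (G x) (G (y m))" by metis
  have "(\<lambda>m. y m - x) \<longlonglongrightarrow> 0"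
    by (rule Lim_null_comparison[OF _ lim_1_over_n[THEN LIMSEQ_Suc]]) (use y(1) less_imp_le in \<open>auto intro!: always_eventually\<close>)
  then have "y \<longlonglongrightarrow> x" by (simp add: LIM_zero_iff)
  then have "(\<lambda>m. dE n (G (y m)) (G x)) \<longlonglongrightarrow> 0" by (rule G_tendsto)
  then have "e \<le> 0" by (rule LIMSEQ_le_const) (use y(2) dE_commute in metis)
  then show False using assms by simp
qed

text \<open>Properness provides convergent subsequences of parameters, so \<open>G\<close> is a
  closed map: values near \<open>G x\<close> come from parameters near the fibre of
  \<open>G x\<close>.\<close>

lemma near_preimages:
  assumes "open V" "\<And>y. G y = G x \<Longrightarrow> y \<in> V"
  shows "\<exists>d>0. \<forall>y. dE n (G x) (G y) < d \<longrightarrow> y \<in> V"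
proof (rule ccontr)
  assume "\<not> ?thesis"
  then have "\<forall>m. \<exists>y. dE n (G x) (G y) < 1 / real (Suc m) \<and> y \<notin> V" by auto
  then obtain y where y: "\<And>m. dE n (G x) (G (y m)) < 1 / real (Suc m)" "\<And>m. y m \<notin> V" by metis
  obtain B where B: "\<And>y. B < \<bar>y\<bar> \<Longrightarrow> dE n (G x) origin + 1 < dE n (G y) origin" using proper by blast
  have "y m \<in> {-B..B}" for m
  proof (rule ccontr)
    assume "y m \<notin> {-B..B}"
    then have "B < \<bar>y m\<bar>" by (auto simp: not_le)
    moreover have "1 / real (Suc m) \<le> 1" by simp
    ultimately show False
      using B[of "y m"] y(1)[of m] dE_triangle[of n "G (y m)" origin "G x"] dE_commute[of n "G x" "G (y m)"] by linarith
  qed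
  then obtain l \<tau> where \<tau>: "strict_mono (\<tau> :: nat \<Rightarrow> nat)" "(y \<circ> \<tau>) \<longlonglongrightarrow> l"
    using compact_Icc[of "-B" B] unfolding compact_eq_seq_compact_metric seq_compact_def by meson
  have 1: "(\<lambda>m. dE n (G (y (\<tau> m))) (G l)) \<longlonglongrightarrow> 0" using G_tendsto[OF \<tau>(2)] by simp
  have 2: "(\<lambda>m. dE n (G (y (\<tau> m))) (G x)) \<longlonglongrightarrow> 0"
  proof (rule tendsto_sandwich[OF always_eventually always_eventually tendsto_const])
    show "(\<lambda>m. 1 / real (Suc (\<tau> m))) \<longlonglongrightarrow> 0"
      using LIMSEQ_subseq_LIMSEQ[OF lim_1_over_n[THEN LIMSEQ_Suc] \<tau>(1)] by (simp add: o_def)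
    show "\<forall>m. dE n (G (y (\<tau> m))) (G x) \<le> 1 / real (Suc (\<tau> m))"
    proof
      fix m show "dE n (G (y (\<tau> m))) (G x) \<le> 1 / real (Suc (\<tau> m))"
        using y(1)[of "\<tau> m"] dE_commute[of n "G x" "G (y (\<tau> m))"] by simp
    qed
  qed simp
  have "G l = G x" by (rule dE_limit_unique[OF 1 2 G_eucl G_eucl])
  then have "l \<in> V" by (rule assms(2))
  then have "\<forall>\<^sub>F m in sequentially. (y \<circ> \<tau>) m \<in> V" using \<tau>(2) assms(1) by (rule topological_tendstoD[rotated 2])
  then show False using y(2) by (auto simp: eventually_sequentially)
qed

text \<open>The complement of the point is the image of two open rays, and a locally constant label
  is constant on each.\<close>

lemma not_cuts3:
  assumes "\<And>y. G y = G t \<Longrightarrow> y = t"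
  shows "\<not> cuts3 n (range G) (G t)"
proof
  assume "cuts3 n (range G) (G t)"
  then obtain \<phi> :: "(nat \<Rightarrow> real) \<Rightarrow> nat" where
    \<phi>: "\<forall>x\<in>range G - {G t}. \<exists>d>0. \<forall>y\<in>range G - {G t}. dE n x y < d \<longrightarrow> \<phi> y = \<phi> x"
      "{0, 1, 2} \<subseteq> \<phi> ` (range G - {G t})"
    unfolding cuts3_def by blast
  have const: "\<phi> (G x) = \<phi> (G y)" if I: "connected I" "t \<notin> I" "x \<in> I" "y \<in> I" for I x y
  proof (rule connected_local_const[OF I(1,3,4), of "\<lambda>x. \<phi> (G x)"], intro ballI)
    fix z assume z: "z \<in> I"
    have mem: "G w \<in> range G - {G t}" if "w \<in> I" for w using assms I(2) that by blast
    obtain d where d: "d > 0" "\<forall>y\<in>range G - {G t}. dE n (G z) y < d \<longrightarrow> \<phi> y = \<phi> (G z)" using \<phi>(1) mem[OF z] by blast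
    obtain d' where d': "d' > 0" "\<forall>y. \<bar>y - z\<bar> < d' \<longrightarrow> dE n (G z) (G y) < d" using G_cont[OF d(1)] by blast
    show "\<forall>\<^sub>F w in at z within I. \<phi> (G z) = \<phi> (G w)"
      unfolding eventually_at
    proof (intro exI[of _ d'] conjI ballI impI d'(1))
      fix w assume "w \<in> I" "w \<noteq> z \<and> dist w z < d'"
      then have "dE n (G z) (G w) < d" using d'(2) by (simp add: dist_real_def)
      then show "\<phi> (G z) = \<phi> (G w)" using d(2) mem[OF \<open>w \<in> I\<close>] by simp
    qed
  qed
  have "\<phi> ` (range G - {G t}) \<subseteq> {\<phi> (G (t - 1)), \<phi> (G (t + 1))}"
  proof
    fix v assume "v \<in> \<phi> ` (range G - {G t})"
    then obtain w where w: "v = \<phi> (G w)" "w \<noteq> t" by blast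
    show "v \<in> {\<phi> (G (t - 1)), \<phi> (G (t + 1))}"
    proof (cases "w < t")
      case True
      have "\<phi> (G w) = \<phi> (G (t - 1))"
        by (rule const[of "{..<t}"]) (use True in \<open>auto intro: convex_connected\<close>)
      then show ?thesis using w(1) by simp
    next
      case False
      have "\<phi> (G w) = \<phi> (G (t + 1))"
        by (rule const[of "{t<..}"]) (use False w(2) in \<open>auto intro: convex_connected\<close>)
      then show ?thesis using w(1) by simp
    qed
  qed
  then have "{0, 1, 2} \<subseteq> {\<phi> (G (t - 1)), \<phi> (G (t + 1))}" by (rule order_trans[OF \<phi>(2)])
  then have "card {0, 1, 2 :: nat} \<le> card {\<phi> (G (t - 1)), \<phi> (G (t + 1))}" by (rule card_mono[rotated]) simp
  then show False by (simp add: card_insert_if split: if_splits)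
qed

text \<open>Removing the common image of \<open>l\<close> and \<open>r\<close> leaves the loop and
  two outer parts. No other identification crosses \<open>l\<close> or \<open>r\<close> into another
  part, so a label taken from any preimage is well defined.\<close>

lemma cuts3_pair:
  assumes lr: "l < r" and pre: "\<And>y. G y = G l \<longleftrightarrow> y = l \<or> y = r"
    and others: "\<And>x y. G x = G y \<Longrightarrow> x < y \<Longrightarrow> (x = l \<and> y = r) \<or> y < l \<or> r < x \<or> (l < x \<and> y < r)"
  shows "cuts3 n (range G) (G l)"
proof -
  define reg where "reg y = (if y < l then 0 else if y < r then 1 else (2::nat))" for y
  define U where "U y = (if y < l then {..<l} else if y < r then {l<..<r} else {r<..})" for y
  have reg: "reg x = reg y" if "G x = G y" "G x \<noteq> G l" for x y
  proof -
    have ne: "x \<noteq> l" "x \<noteq> r" "y \<noteq> l" "y \<noteq> r" using pre that by metis+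
    consider "x < y" | "x = y" | "y < x" by linarith
    then show ?thesis
    proof cases
      case 1
      have "y < l \<or> r < x \<or> (l < x \<and> y < r)" using others[OF that(1) 1] ne by blast
      then show ?thesis using 1 lr unfolding reg_def by (elim disjE) simp_all
    next
      case 3
      have "x < l \<or> r < y \<or> (l < y \<and> x < r)" using others[OF that(1)[symmetric] 3] ne by blast
      then show ?thesis using 3 lr unfolding reg_def by (elim disjE) simp_all
    qed simp
  qed
  define \<phi> where "\<phi> z = reg (SOME y. G y = z)" for z
  have \<phi>: "\<phi> (G y) = reg y" if "G y \<noteq> G l" for y
  proof -
    have "G (SOME y'. G y' = G y) = G y" by (rule someI[of "\<lambda>y'. G y' = G y" y]) simp
    then show ?thesis unfolding \<phi>_def using reg that by metis
  qed
  show ?thesis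
    unfolding cuts3_def
  proof (intro exI[of _ \<phi>] conjI ballI)
    fix x assume "x \<in> range G - {G l}"
    then obtain y where y: "x = G y" "G y \<noteq> G l" by auto
    have "open (U y)" by (simp add: U_def)
    moreover have "y' \<in> U y" if "G y' = G y" for y'
    proof -
      have "reg y' = reg y" by (rule reg) (use that y(2) in simp_all)
      moreover have "y' \<noteq> l" "y' \<noteq> r" using that y(2) pre by metis+
      ultimately show ?thesis by (auto simp: U_def reg_def split: if_splits)
    qed
    ultimately obtain d where d: "d > 0" "\<forall>y'. dE n (G y) (G y') < d \<longrightarrow> y' \<in> U y" using near_preimages by blast
    have "\<phi> z = \<phi> x" if z: "z \<in> range G - {G l}" "dE n x z < d" for z
    proof -
      obtain y' where y': "z = G y'" "G y' \<noteq> G l" using z(1) by auto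
      have "y' \<in> U y" using d(2) z(2) y(1) y'(1) by blast
      then have "reg y' = reg y" using lr by (auto simp: U_def reg_def split: if_splits)
      then show ?thesis using \<phi> y y' by simp
    qed
    then show "\<exists>d>0. \<forall>z\<in>range G - {G l}. dE n x z < d \<longrightarrow> \<phi> z = \<phi> x" using d(1) by blast
  next
    have m: "reg y \<in> \<phi> ` (range G - {G l})" if "y \<noteq> l" "y \<noteq> r" for y
    proof -
      have "G y \<noteq> G l" using pre that by metis
      then show ?thesis using \<phi>[of y] by (intro image_eqI[of _ _ "G y"]) simp_all
    qed
    have "reg (l - 1) = 0" "reg ((l + r) / 2) = 1" "reg (r + 1) = 2" using lr by (auto simp: reg_def)
    moreover have "reg (l - 1) \<in> \<phi> ` (range G - {G l})" "reg ((l + r) / 2) \<in> \<phi> ` (range G - {G l})"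
      "reg (r + 1) \<in> \<phi> ` (range G - {G l})"
      by (rule m; use lr in simp)+
    ultimately show "{0, 1, 2} \<subseteq> \<phi> ` (range G - {G l})" by (metis empty_subsetI insert_subset)
  qed
qed

end

section \<open>No self-similar set has the tangent with densely many loops on one side\<close>

text \<open>A curve that is injective up to countably many times but returns to a point cannot be mapped
  injectively and continuously into the line: by the intermediate value theorem uncountably many values
  would be taken twice.\<close>

lemma loop_not_in_line:
  fixes \<zeta> :: "real \<Rightarrow> real"
  assumes PR: "P < R" "\<zeta> P = \<zeta> R" and cont: "continuous_on {P..R} \<zeta>"
    and Z: "countable Z" and inj: "\<And>x y. x \<in> {P..R} \<Longrightarrow> y \<in> {P..R} \<Longrightarrow> \<zeta> x = \<zeta> y \<Longrightarrow> x \<noteq> y \<Longrightarrow> x \<in> Z"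
  shows False
proof -
  have main: False if cont: "continuous_on {P..R} f" and fPR: "f P = f R" and m: "P < m" "m < R" "f P < f m"
    and inj: "\<And>x y. x \<in> {P..R} \<Longrightarrow> y \<in> {P..R} \<Longrightarrow> f x = f y \<Longrightarrow> x \<noteq> y \<Longrightarrow> x \<in> Z" for f :: "real \<Rightarrow> real" and m
  proof -
    have "{f P<..<f m} \<subseteq> f ` Z"
    proof
      fix v assume v: "v \<in> {f P<..<f m}"
      have "\<exists>x\<ge>P. x \<le> m \<and> f x = v"
        using v m by (intro IVT' continuous_on_subset[OF cont]) auto
      then obtain x where x: "P \<le> x" "x \<le> m" "f x = v" by blast
      have "\<exists>y\<ge>m. y \<le> R \<and> f y = v"
        using v m fPR by (intro IVT2' continuous_on_subset[OF cont]) auto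
      then obtain y where y: "m \<le> y" "y \<le> R" "f y = v" by blast
      have "x \<noteq> y" using x y v by auto
      then have "x \<in> Z" using x y m by (intro inj[of x y]) auto
      then show "v \<in> f ` Z" using x(3) by blast
    qed
    then have "countable {f P<..<f m}" using Z countable_subset countable_image by metis
    then show False using m(3) uncountable_open_interval by blast
  qed
  have "uncountable {P<..<R}" using PR(1) uncountable_open_interval by blast
  then have "\<not> {P<..<R} \<subseteq> Z" using Z countable_subset by blast
  then obtain m where "m \<in> {P<..<R}" "m \<notin> Z" by blast
  then have m: "P < m" "m < R" "m \<notin> Z" by auto
  have "\<zeta> m \<noteq> \<zeta> P" using inj[of m P] m by auto
  then consider "\<zeta> P < \<zeta> m" | "\<zeta> m < \<zeta> P" by linarith
  then show False
  proof cases
    case 1 then show False using main[of \<zeta> m] cont PR(2) m inj by blast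
  next
    case 2
    show False
      by (rule main[of "\<lambda>x. - \<zeta> x" m]) (use cont PR(2) m inj 2 in \<open>auto intro: continuous_intros\<close>)
  qed
qed

text \<open>Baire in \<open>[0, 1]\<close>: if no \<open>A\<close> had interior, the complements
  would be open and dense, and so would have a nonempty intersection.\<close>

lemma countable_closed_cover_interval:
  assumes S: "countable \<C>" "\<And>A. A \<in> \<C> \<Longrightarrow> closed A" "{0..1::real} \<subseteq> \<Union>\<C>"
  shows "\<exists>A\<in>\<C>. \<exists>x\<in>{0..1}. \<exists>e>0. ball x e \<inter> {0..1} \<subseteq> A"
proof (rule ccontr)
  assume none: "\<not> ?thesis"
  define \<G> where "\<G> = (\<lambda>A. {0..1} - A) ` \<C>"
  have "{0..1} \<subseteq> closure (\<Inter>\<G>)"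
  proof (rule Baire)
    show "closed {0..1::real}" by simp
    show "countable \<G>" unfolding \<G>_def using S(1) by (rule countable_image)
    fix T assume "T \<in> \<G>"
    then obtain A where A: "A \<in> \<C>" "T = {0..1} - A" unfolding \<G>_def by blast
    have "{0..1} \<subseteq> closure T"
    proof
      fix x :: real assume x: "x \<in> {0..1}"
      show "x \<in> closure T"
        unfolding closure_approachable
      proof (intro allI impI)
        fix e :: real assume "0 < e"
        then have "\<not> ball x e \<inter> {0..1} \<subseteq> A" using none A(1) x by blast
        then obtain y where "y \<in> ball x e" "y \<in> {0..1}" "y \<notin> A" by blast
        then show "\<exists>y\<in>T. dist y x < e" unfolding A(2) by (intro bexI[of _ y]) (auto simp: dist_commute)
      qed
    qed
    moreover have "openin (top_of_set {0..1}) T"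
      unfolding A(2) Diff_eq using S(2)[OF A(1)] by (intro openin_open_Int open_Compl)
    ultimately show "openin (top_of_set {0..1}) T \<and> {0..1} \<subseteq> closure T" by blast
  qed
  moreover have "\<Inter>\<G> = {}"
  proof -
    obtain A where A: "A \<in> \<C>" using S(3) by (metis Union_empty atLeastatMost_empty_iff2 equals0I subset_empty zero_le_one)
    have False if "x \<in> \<Inter>\<G>" for x
    proof -
      have "x \<in> {0..1}" using that A unfolding \<G>_def by blast
      then show False using S(3) that unfolding \<G>_def by blast
    qed
    then show ?thesis by blast
  qed
  ultimately show False by simp
qed

text \<open>The contradiction is the map \<open>\<xi> \<circ> \<eta>\<close> from
  \<open>[P, R]\<close> to the line. \<open>\<eta>\<close> reads the loop into \<open>Q\<close>
  through the copy that contains it, and \<open>\<xi>\<close> sends \<open>Q\<close> to parameters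
  in \<open>V\<close> through a copy near \<open>f (G p)\<close>.\<close>

lemma (in line_image) bilip_tangent_False:
  assumes ifs: "osc_ifs m k \<phi> \<rho> Q U" and two: "a1 \<in> Q" "a2 \<in> Q" "a1 \<noteq> a2"
    and T: "tangentE m Q z T" and L: "0 < L" and f: "bij_betw f (range G) T"
    and bilip: "\<And>x y. dE n (G x) (G y) / L \<le> dE m (f (G x)) (f (G y)) \<and>
        dE m (f (G x)) (f (G y)) \<le> L * dE n (G x) (G y)"
    and arc: "open V" "p \<in> V" "\<And>x y. x \<in> V \<Longrightarrow> G y = G x \<Longrightarrow> y = x"
    and Z: "countable Z" "\<And>x y. G x = G y \<Longrightarrow> x \<noteq> y \<Longrightarrow> x \<in> Z"
    and loops: "\<And>x e. x \<in> {0..1} \<Longrightarrow> 0 < e \<Longrightarrow> \<exists>P R. P < R \<and> {P..R} \<subseteq> ball x e \<inter> {0..1} \<and> G P = G R"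
  shows False
proof -
  interpret I: osc_ifs m k \<phi> \<rho> Q U by (rule ifs)
  have fT: "f (G x) \<in> T" for x using bij_betwE[OF f] by simp
  have Te: "T \<subseteq> eucl m" using T by (simp add: tangentE_def closedE_def)
  have finj: "G x = G y" if "f (G x) = f (G y)" for x y
    using that bij_betw_imp_inj_on[OF f] by (auto dest: inj_onD)
  have sim_inj: "q = q'" if "0 < c" "\<forall>p\<in>Q. \<forall>q\<in>Q. dE m (F p) (F q) = c * dE m p q" "q \<in> Q" "q' \<in> Q" "F q = F q'"
    for c :: real and F :: "(nat \<Rightarrow> real) \<Rightarrow> nat \<Rightarrow> real" and q q'
  proof -
    have "c * dE m q q' = 0" using that(2-5) dE_refl[of m "F q"] by metis
    then have "dE m q q' = 0" using that(1) by simp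
    then show ?thesis using dE_eq_0 I.Q_eucl that(3,4) by metis
  qed
  obtain d where d: "d > 0" "\<forall>y. dE n (G p) (G y) < d \<longrightarrow> y \<in> V"
    using near_preimages[OF arc(1), of p] arc(2,3) by blast
  \<comment> \<open>With radius \<open>d / L\<close>, pulling the copy back by \<open>f\<close>
    gives points within \<open>d\<close> of \<open>G p\<close>, whose parameters lie in
    \<open>V\<close>, where \<open>G\<close> is injective.\<close>
  obtain F c where c: "c > 0" and F: "\<forall>q\<in>Q. F q \<in> T \<and> dE m (F q) (f (G p)) < d / L"
     "\<forall>q\<in>Q. \<forall>q'\<in>Q. dE m (F q) (F q') = c * dE m q q'"
    using I.tangent_contains_copy[OF T two fT, of "d / L" p] d(1) L by auto
  define \<xi> where "\<xi> q = (SOME x. f (G x) = F q)" for q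
  have \<xi>: "f (G (\<xi> q)) = F q" "\<xi> q \<in> V" if q: "q \<in> Q" for q
  proof -
    have "F q \<in> f ` range G" using F(1) q bij_betw_imp_surj_on[OF f] by blast
    then have "\<exists>x. f (G x) = F q" by (metis imageE)
    then show 1: "f (G (\<xi> q)) = F q" unfolding \<xi>_def by (rule someI_ex)
    have "dE n (G p) (G (\<xi> q)) / L \<le> dE m (f (G p)) (F q)" using bilip[of p "\<xi> q"] 1 by simp
    also have "\<dots> < d / L" using F(1) q dE_commute by metis
    finally show "\<xi> q \<in> V" using d(2) L by (simp add: divide_less_cancel)
  qed
  have \<xi>_inj: "q = q'" if "q \<in> Q" "q' \<in> Q" "\<xi> q = \<xi> q'" for q q'
    by (rule sim_inj[OF c F(2) that(1,2)]) (use \<xi>(1) that in metis)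
  \<comment> \<open>Fibres over \<open>G x\<close> with \<open>x\<close> in \<open>V\<close> are
    single points, so \<open>near_preimages\<close> is continuity of the inverse of \<open>G\<close>
    there.\<close>
  have \<xi>_cont: "\<exists>\<delta>>0. \<forall>q'\<in>Q. dE m q q' < \<delta> \<longrightarrow> \<bar>\<xi> q' - \<xi> q\<bar> < e" if q: "q \<in> Q" and e: "0 < e" for q e
  proof -
    obtain \<delta> where \<delta>: "\<delta> > 0" "\<forall>y. dE n (G (\<xi> q)) (G y) < \<delta> \<longrightarrow> y \<in> ball (\<xi> q) e"
      using near_preimages[of "ball (\<xi> q) e" "\<xi> q"] arc(3)[OF \<xi>(2)[OF q]] e by (metis centre_in_ball open_ball)
    have "\<bar>\<xi> q' - \<xi> q\<bar> < e" if q': "q' \<in> Q" "dE m q q' < \<delta> / (L * c)" for q'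
    proof -
      have "dE n (G (\<xi> q)) (G (\<xi> q')) / L \<le> c * dE m q q'"
        using bilip[of "\<xi> q" "\<xi> q'"] F(2)[rule_format, OF q q'(1)] unfolding \<xi>(1)[OF q] \<xi>(1)[OF q'(1)] by argo
      also have "\<dots> < c * (\<delta> / (L * c))" using q'(2) c by (intro mult_strict_left_mono)
      also have "\<dots> = \<delta> / L" using c by simp
      finally have "dE n (G (\<xi> q)) (G (\<xi> q')) < \<delta>" using L by (simp add: divide_less_cancel)
      then show ?thesis using \<delta>(2) by (auto simp: dist_real_def)
    qed
    then show ?thesis using \<delta>(1) L c by (intro exI[of _ "\<delta> / (L * c)"]) simp
  qed
  obtain \<S> where S: "countable \<S>" "T \<subseteq> \<Union>\<S>"
    and SF: "\<And>A. A \<in> \<S> \<Longrightarrow> \<exists>F. \<exists>c>0. A = F ` Q \<and> A \<subseteq> eucl m \<and> (\<forall>p\<in>Q. \<forall>q\<in>Q. dE m (F p) (F q) = c * dE m p q)"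
    using I.tangent_covered[OF T two] by metis
  define \<C> where "\<C> = (\<lambda>A. {x \<in> {0..1}. f (G x) \<in> A}) ` \<S>"
  have "\<exists>C\<in>\<C>. \<exists>x\<in>{0..1}. \<exists>e>0. ball x e \<inter> {0..1} \<subseteq> C"
  proof (rule countable_closed_cover_interval)
    show "countable \<C>" unfolding \<C>_def using S(1) by simp
    show "{0..1} \<subseteq> \<Union>\<C>" unfolding \<C>_def using S(2) fT by blast
    fix C assume "C \<in> \<C>"
    then obtain A where A: "A \<in> \<S>" "C = {x \<in> {0..1}. f (G x) \<in> A}" unfolding \<C>_def by blast
    obtain F' c' where F': "A = F' ` Q" "A \<subseteq> eucl m" "\<forall>p\<in>Q. \<forall>q\<in>Q. dE m (F' p) (F' q) = c' * dE m p q"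
      using SF[OF A(1)] by blast
    \<comment> \<open>\<open>f\<close> is Lipschitz and a similar copy of the compact set
      \<open>Q\<close> contains its limits.\<close>
    show "closed C"
      unfolding closed_sequential_limits
    proof (intro allI impI, elim conjE)
      fix x l assume xC: "\<forall>j. x j \<in> C" and lim: "x \<longlonglongrightarrow> l"
      have l01: "l \<in> {0..1}"
        using closed_sequentially[OF closed_real_atLeastAtMost, of x 0 1 l] xC lim A(2) by blast
      have "\<forall>j. \<exists>q\<in>Q. f (G (x j)) = F' q" using xC A(2) F'(1) by blast
      then obtain q where q: "\<And>j. q j \<in> Q" "\<And>j. f (G (x j)) = F' (q j)" by metis
      obtain q0 \<sigma> where \<sigma>: "q0 \<in> Q" "strict_mono (\<sigma> :: nat \<Rightarrow> nat)" "(\<lambda>j. dE m (q (\<sigma> j)) q0) \<longlonglongrightarrow> 0"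
        using I.Q(1) q(1) unfolding compactE_def by blast
      have "(\<lambda>j. c' * dE m (q (\<sigma> j)) q0) \<longlonglongrightarrow> c' * 0" by (intro tendsto_mult tendsto_const \<sigma>(3))
      then have 1: "(\<lambda>j. dE m (f (G (x (\<sigma> j)))) (F' q0)) \<longlonglongrightarrow> 0"
        unfolding q(2) using F'(3)[rule_format, OF q(1) \<sigma>(1)] by simp
      have "(\<lambda>j. dE n (G (x (\<sigma> j))) (G l)) \<longlonglongrightarrow> 0"
        using G_tendsto[OF LIMSEQ_subseq_LIMSEQ[OF lim \<sigma>(2)]] by (simp add: o_def)
      then have "(\<lambda>j. L * dE n (G (x (\<sigma> j))) (G l)) \<longlonglongrightarrow> L * 0" by (intro tendsto_mult tendsto_const)
      then have l0: "(\<lambda>j. L * dE n (G (x (\<sigma> j))) (G l)) \<longlonglongrightarrow> 0" by simp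
      have 2: "(\<lambda>j. dE m (f (G (x (\<sigma> j)))) (f (G l))) \<longlonglongrightarrow> 0"
        by (rule tendsto_sandwich[OF always_eventually always_eventually tendsto_const l0]) (use bilip in auto)
      have "F' q0 = f (G l)"
        by (rule dE_limit_unique[OF 1 2]) (use F'(1,2) \<sigma>(1) fT Te in auto)
      then show "l \<in> C" using \<sigma>(1) F'(1) A(2) l01 by force
    qed
  qed
  then obtain A x0 e where A: "A \<in> \<S>" "x0 \<in> {0..1}" "e > 0" and sub: "ball x0 e \<inter> {0..1} \<subseteq> {x \<in> {0..1}. f (G x) \<in> A}"
    unfolding \<C>_def by blast
  obtain F' c' where F': "A = F' ` Q" "c' > 0" "\<forall>p\<in>Q. \<forall>q\<in>Q. dE m (F' p) (F' q) = c' * dE m p q"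
    using SF[OF A(1)] by blast
  obtain P R where PR: "P < R" "{P..R} \<subseteq> ball x0 e \<inter> {0..1}" "G P = G R" using loops[OF A(2,3)] by blast
  define \<eta> where "\<eta> x = (SOME q. q \<in> Q \<and> F' q = f (G x))" for x
  have \<eta>: "\<eta> x \<in> Q" "F' (\<eta> x) = f (G x)" if "x \<in> {P..R}" for x
  proof -
    have "f (G x) \<in> F' ` Q" using that PR(2) sub F'(1) by blast
    then have "\<exists>q. q \<in> Q \<and> F' q = f (G x)" by (metis imageE)
    then have "\<eta> x \<in> Q \<and> F' (\<eta> x) = f (G x)" unfolding \<eta>_def by (rule someI_ex)
    then show "\<eta> x \<in> Q" "F' (\<eta> x) = f (G x)" by auto
  qed
  show False
  proof (rule loop_not_in_line[OF PR(1) _ _ Z(1), of "\<lambda>x. \<xi> (\<eta> x)"])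
    \<comment> \<open>\<open>\<eta> x\<close> is chosen from \<open>f (G x)\<close> alone, and
      \<open>G P = G R\<close>.\<close>
    show "\<xi> (\<eta> P) = \<xi> (\<eta> R)" unfolding \<eta>_def PR(3) ..
  next
    fix x y assume xy: "x \<in> {P..R}" "y \<in> {P..R}" "\<xi> (\<eta> x) = \<xi> (\<eta> y)" "x \<noteq> y"
    have "\<eta> x = \<eta> y" by (rule \<xi>_inj) (use xy \<eta>(1) in auto)
    then have "f (G x) = f (G y)" using \<eta>(2) xy(1,2) by metis
    then show "x \<in> Z" using finj Z(2) xy(4) by blast
  next
    show "continuous_on {P..R} (\<lambda>x. \<xi> (\<eta> x))"
      unfolding continuous_on_iff
    proof (intro ballI allI impI)
      fix x e :: real assume x: "x \<in> {P..R}" and e: "0 < e"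
      obtain \<delta> where \<delta>: "\<delta> > 0" "\<forall>q'\<in>Q. dE m (\<eta> x) q' < \<delta> \<longrightarrow> \<bar>\<xi> q' - \<xi> (\<eta> x)\<bar> < e"
        using \<xi>_cont[OF \<eta>(1)[OF x] e] by blast
      have "0 < c' * \<delta> / L" using \<delta>(1) F'(2) L by simp
      from G_cont[OF this, of x] obtain h where h: "h > 0" "\<forall>y. \<bar>y - x\<bar> < h \<longrightarrow> dE n (G x) (G y) < c' * \<delta> / L"
        by blast
      have "dist (\<xi> (\<eta> y)) (\<xi> (\<eta> x)) < e" if y: "y \<in> {P..R}" "dist y x < h" for y
      proof -
        have "c' * dE m (\<eta> x) (\<eta> y) = dE m (f (G x)) (f (G y))" using F'(3) \<eta> x y(1) by metis
        also have "\<dots> \<le> L * dE n (G x) (G y)" using bilip by blast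
        also have "\<dots> < L * (c' * \<delta> / L)" using h(2) y(2) L by (intro mult_strict_left_mono) (auto simp: dist_real_def)
        also have "\<dots> = c' * \<delta>" using L by simp
        finally have "dE m (\<eta> x) (\<eta> y) < \<delta>" using F'(2) by simp
        then show ?thesis using \<delta>(2) \<eta>(1)[OF y(1)] by (simp add: dist_real_def)
      qed
      then show "\<exists>d>0. \<forall>x'\<in>{P..R}. dist x' x < d \<longrightarrow> dist (\<xi> (\<eta> x')) (\<xi> (\<eta> x)) < e" using h(1) by blast
    qed
  qed
qed

lemma self_similar_two_points:
  assumes "self_similarE n Q" "hdimE n Q \<noteq> 0"
  obtains a a' where "a \<in> Q" "a' \<in> Q" "a \<noteq> a'"
proof -
  have Q: "Q \<noteq> {}" "Q \<subseteq> eucl n" using assms(1) by (auto simp: self_similarE_def compactE_def)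
  then obtain a where a: "a \<in> Q" by blast
  have "Q \<noteq> {a}" using hdimE_singleton[of a n] a Q(2) assms(2) by auto
  then show ?thesis using a that by blast
qed

section \<open>The tangents at generic times\<close>

context zoo_curve
begin

lemma loopL_less_loopR: "loopL i j < loopR i j"
proof -
  have "0 < real b ^ Suc i" using b_gt1 by (intro zero_less_power) simp
  then show ?thesis unfolding loopL_def loopR_def by (intro divide_strict_right_mono) simp_all
qed

text \<open>The loops in first cells are \<open>[2 / b ^ Suc i, 3 / b ^ Suc i]\<close>; they move
  towards 0 and are disjoint because \<open>3 / b < 2\<close>.\<close>

lemma loopR_less_loopL: assumes "i < j" shows "loopR j 0 < loopL i 0"
proof -
  have "(3::real) / real b ^ Suc j < 2 / real b ^ Suc i"
  proof -
    have p: "0 < real b ^ Suc i" using b_gt1 by simp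
    have "real b ^ Suc i * real b ^ 1 \<le> real b ^ Suc i * real b ^ (j - i)"
      using assms b_gt1 p by (intro mult_left_mono power_increasing) auto
    also have "\<dots> = real b ^ Suc j" using assms by (simp flip: power_add)
    finally have le: "real b ^ Suc i * real b \<le> real b ^ Suc j" by (simp only: power_one_right)
    have "real b ^ Suc i * 6 \<le> real b ^ Suc i * real b" using b6 p by (intro mult_left_mono) simp_all
    from this le have "real b ^ Suc i * 6 \<le> real b ^ Suc j" by (rule order_trans)
    then have "3 / real b ^ Suc j \<le> 3 / (real b ^ Suc i * 6)" using p by (intro divide_left_mono) auto
    also have "\<dots> < 2 / real b ^ Suc i" using p by (simp add: divide_simps)
    finally show ?thesis .
  qed
  then show ?thesis by (simp add: loopL_def loopR_def)
qed

lemma ident_Suc: "ident (Suc k) x y \<longleftrightarrow> (\<exists>i<k. x = loopL i 0 \<and> y = loopR i 0)"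
proof -
  have "0 < b ^ i" for i using b_pos by simp
  then show ?thesis unfolding ident_def pattern_def by auto
qed

text \<open>Points with one preimage do not cut by \<open>not_cuts3\<close>; the \<open>k\<close>
  loop points do by \<open>cuts3_pair\<close>, since the loops are pairwise disjoint.\<close>

lemma card_cuts3:
  assumes "line_image dim G C a" and pre: "\<And>x y. G x = G y \<longleftrightarrow> x = y \<or> ident (Suc k) x y \<or> ident (Suc k) y x"
  shows "card {p \<in> range G. cuts3 dim (range G) p} = k"
proof -
  interpret line_image dim G C a by (rule assms(1))
  have eq: "G x = G y \<longleftrightarrow> x = y \<or> (\<exists>i<k. x = loopL i 0 \<and> y = loopR i 0) \<or> (\<exists>i<k. y = loopL i 0 \<and> x = loopR i 0)" for x y
    unfolding pre ident_Suc ..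
  have LR: "loopL i 0 \<noteq> loopR j 0" for i j
    using loopL_less_loopR[of i 0] loopL_less_loopR[of j 0] loopR_less_loopL[of i j] loopR_less_loopL[of j i]
    by (cases i j rule: linorder_cases) auto
  have LL: "loopL i 0 = loopL j 0 \<longleftrightarrow> i = j" for i j
    using loopL_less_loopR[of i 0] loopL_less_loopR[of j 0] loopR_less_loopL[of i j] loopR_less_loopL[of j i]
    by (cases i j rule: linorder_cases) auto
  have cut: "cuts3 dim (range G) (G (loopL i 0))" if i: "i < k" for i
  proof (rule cuts3_pair[OF loopL_less_loopR[of i 0]])
    fix y show "G y = G (loopL i 0) \<longleftrightarrow> y = loopL i 0 \<or> y = loopR i 0"
      unfolding eq using LR LL i by metis
  next
    fix x y assume xy: "G x = G y" "x < y"
    then have "(\<exists>j<k. x = loopL j 0 \<and> y = loopR j 0) \<or> (\<exists>j<k. y = loopL j 0 \<and> x = loopR j 0)"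
      unfolding eq by auto
    then obtain j where "x = loopL j 0" "y = loopR j 0"
      using xy(2) loopL_less_loopR by (metis less_asym)
    then show "x = loopL i 0 \<and> y = loopR i 0 \<or> y < loopL i 0 \<or> loopR i 0 < x \<or> loopL i 0 < x \<and> y < loopR i 0"
      using loopR_less_loopL[of i j] loopR_less_loopL[of j i] by (cases i j rule: linorder_cases) auto
  qed
  have "{p \<in> range G. cuts3 dim (range G) p} = (\<lambda>i. G (loopL i 0)) ` {..<k}"
  proof
    show "{p \<in> range G. cuts3 dim (range G) p} \<subseteq> (\<lambda>i. G (loopL i 0)) ` {..<k}"
    proof
      fix p assume "p \<in> {p \<in> range G. cuts3 dim (range G) p}"
      then obtain t where t: "p = G t" "cuts3 dim (range G) (G t)" by blast
      then obtain y where y: "G y = G t" "y \<noteq> t" using not_cuts3 by blast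
      then have "(\<exists>i<k. y = loopL i 0 \<and> t = loopR i 0) \<or> (\<exists>i<k. t = loopL i 0 \<and> y = loopR i 0)"
        unfolding eq by blast
      then show "p \<in> (\<lambda>i. G (loopL i 0)) ` {..<k}" using t(1) y(1) by force
    qed
  qed (use cut in blast)
  moreover have "inj_on (\<lambda>i. G (loopL i 0)) {..<k}"
    unfolding inj_on_def eq using LR LL by metis
  ultimately show ?thesis by (simp add: card_image)
qed

lemma infinitely_many_tangents:
  assumes "generic t" "t \<in> {0..1}"
  shows "\<exists>S \<subseteq> TanE dim (curve ` {0..1}) (curve t). infinite S \<and>
    (\<forall>T1\<in>S. \<forall>T2\<in>S. T1 \<noteq> T2 \<longrightarrow> \<not> homeomorphicE dim T1 dim T2)"
proof -
  have "\<forall>k. \<exists>T\<in>TanE dim (curve ` {0..1}) (curve t). card {p \<in> T. cuts3 dim T p} = k"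
  proof
    fix k
    obtain G where G: "\<forall>x. G x \<in> eucl dim" "\<forall>x y. dE dim (G x) (G y) \<le> C1 * \<bar>x - y\<bar> powr (1 / s)"
      "\<forall>R. \<exists>B. \<forall>x. B < \<bar>x\<bar> \<longrightarrow> R < dE dim (G x) origin"
      "\<forall>x y. G x = G y \<longleftrightarrow> x = y \<or> ident (Suc k) x y \<or> ident (Suc k) y x"
      "range G \<in> TanE dim (curve ` {0..1}) (curve t)"
      using generic_tangent[OF assms, of "Suc k"] by (elim exE conjE)
    have "line_image dim G C1 (1 / s)" using G(1-3) C1_nonneg s1 by unfold_locales auto
    then have "card {p \<in> range G. cuts3 dim (range G) p} = k" by (rule card_cuts3) (use G(4) in blast)
    then show "\<exists>T\<in>TanE dim (curve ` {0..1}) (curve t). card {p \<in> T. cuts3 dim T p} = k" using G(5) by blast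
  qed
  from bchoice[of UNIV, simplified, OF this[simplified Bex_def]]
  obtain T where T: "\<forall>k. T k \<in> TanE dim (curve ` {0..1}) (curve t) \<and> card {p \<in> T k. cuts3 dim (T k) p} = k" by blast
  have inj: "inj T" by (rule injI) (use T in metis)
  have "\<not> homeomorphicE dim (T k) dim (T l)" if "T k \<noteq> T l" for k l
    using homeomorphic_cuts3_card[of dim "T k" dim "T l"] T that by metis
  then show ?thesis
    using T range_inj_infinite[OF inj] by (intro exI[of _ "range T"]) blast
qed

text \<open>Stronger than almost everywhere, as no point \<open>z\<close> is excepted. The dimension
  gives \<open>Q\<close> two distinct points: a one-point set has dimension 0.\<close>

lemma wild_tangent:
  assumes "generic t" "t \<in> {0..1}"
  shows "\<exists>T \<in> TanE dim (curve ` {0..1}) (curve t). \<forall>n Q z. self_similarE n Q \<longrightarrow> hdimE n Q = s \<longrightarrow>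
     \<not> (\<exists>T' \<in> TanE n Q z. bilip_homeomorphicE dim T n T')"
proof -
  obtain G where G: "\<forall>x. G x \<in> eucl dim" "\<forall>x y. dE dim (G x) (G y) \<le> C1 * \<bar>x - y\<bar> powr (1 / s)"
      "\<forall>R. \<exists>B. \<forall>x. B < \<bar>x\<bar> \<longrightarrow> R < dE dim (G x) origin"
      "\<forall>x y. G x = G y \<longleftrightarrow> x = y \<or> ident 0 x y \<or> ident 0 y x"
      "range G \<in> TanE dim (curve ` {0..1}) (curve t)"
    using generic_tangent[OF assms, of 0] by (elim exE conjE)
  interpret line_image dim G C1 "1 / s" using G(1-3) C1_nonneg s1 by unfold_locales auto
  have pattern: "pattern 0 i j" for i j by (simp add: pattern_def)
  have cell: "real j / real b ^ i < loopL i j" "loopR i j < (real j + 1) / real b ^ i" for i j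
  proof -
    have p: "0 < real b ^ i" "0 < real b" using b_gt1 by auto
    have "real j / real b ^ i = (real j * real b) / real b ^ Suc i" using p by simp
    also have "\<dots> < loopL i j" unfolding loopL_def using p by (intro divide_strict_right_mono zero_less_power) auto
    finally show "real j / real b ^ i < loopL i j" .
    have "loopR i j < ((real j + 1) * real b) / real b ^ Suc i"
      unfolding loopR_def using p b6 by (intro divide_strict_right_mono zero_less_power) (auto simp: algebra_simps)
    also have "\<dots> = (real j + 1) / real b ^ i" using p by simp
    finally show "loopR i j < (real j + 1) / real b ^ i" .
  qed
  have unit: "(real j + 1) / real b ^ i \<le> 1" if "j < b ^ i" for i j
  proof -
    have "real (Suc j) \<le> real (b ^ i)" using that by (simp only: of_nat_le_iff Suc_leI)
    then show ?thesis using b_gt1 by (simp add: divide_le_eq)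
  qed
  define Z where "Z = range (\<lambda>(i, j). loopL i j) \<union> range (\<lambda>(i, j). loopR i j)"
  have ident_Z: "x \<in> Z \<and> y \<in> Z \<and> x \<le> 1 \<and> y \<le> 1" if xy: "ident 0 x y" for x y
  proof -
    obtain i j where ij: "j < b ^ i" "x = loopL i j" "y = loopR i j" using xy by (auto simp: ident_def)
    then have "x \<in> Z" "y \<in> Z" unfolding Z_def by (force intro: image_eqI[of _ _ "(i, j)"])+
    moreover have "loopR i j \<le> 1" by (rule order_trans[OF less_imp_le[OF cell(2)] unit[OF ij(1)]])
    ultimately show ?thesis using loopL_less_loopR[of i j] ij(2,3) by simp
  qed
  have Z: "x \<in> Z \<and> x \<le> 1" if "G x = G y" "x \<noteq> y" for x y
    using that G(4) ident_Z by blast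
  have "\<not> bilip_homeomorphicE dim (range G) n T'"
    if Q: "self_similarE n Q" "hdimE n Q = s" and T': "T' \<in> TanE n Q z" for n Q z T'
  proof
    assume "bilip_homeomorphicE dim (range G) n T'"
    then obtain f L where L: "L > 0" and f: "bij_betw f (range G) T'" and bilip: "\<forall>x\<in>range G. \<forall>y\<in>range G.
      dE dim x y / L \<le> dE n (f x) (f y) \<and> dE n (f x) (f y) \<le> L * dE dim x y"
      unfolding bilip_homeomorphicE_def by (elim exE conjE)
    obtain k \<phi> \<rho> U where ifs: "osc_ifs n k \<phi> \<rho> Q U" by (rule self_similar_osc[OF Q(1)])
    have "hdimE n Q \<noteq> 0" using Q(2) s1 by simp
    then obtain a a' where two: "a \<in> Q" "a' \<in> Q" "a \<noteq> a'" by (rule self_similar_two_points[OF Q(1)])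
    have T: "tangentE n Q z T'" using T' by (simp add: TanE_def)
    show False
    \<comment> \<open>All loops of this pattern lie in \<open>[0, 1]\<close>, so the time 2 has a
      neighbourhood free of identifications.\<close>
    proof (rule bilip_tangent_False[OF ifs two T L f, of "{3/2<..<5/2}" 2 Z])
      show "open {3/2<..<5/2::real}" "(2::real) \<in> {3/2<..<5/2}" by auto
      show "countable Z" by (simp add: Z_def)
      show "x \<in> Z" if "G x = G y" "x \<noteq> y" for x y using Z that by blast
      show "y = x" if "x \<in> {3/2<..<5/2}" "G y = G x" for x y using Z[of x y] that by auto
      show "dE dim (G x) (G y) / L \<le> dE n (f (G x)) (f (G y)) \<and> dE n (f (G x)) (f (G y)) \<le> L * dE dim (G x) (G y)" for x y
        using bilip by blast
      show "\<exists>P R. P < R \<and> {P..R} \<subseteq> ball x e \<inter> {0..1} \<and> G P = G R" if x: "x \<in> {0..1}" and e: "0 < e" for x e :: real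
      proof -
        obtain i where i: "(1 / real b) ^ i < e" using real_arch_pow_inv[OF e, of "1 / real b"] b_gt1 by auto
        have p: "0 < real b ^ i" using b_gt1 by simp
        have be: "1 / real b ^ i < e" using i by (simp add: power_one_over)
        have "\<exists>j<b ^ i. real j \<le> real b ^ i * x \<and> real b ^ i * x \<le> real j + 1"
        \<comment> \<open>For \<open>x = 1\<close> the floor would give \<open>b ^ i\<close>, beyond
          the last cell; there \<open>x\<close> is taken as the right end of the last cell.\<close>
        proof (cases "x = 1")
          case True
          have "0 < b ^ i" using b_pos by simp
          then obtain j where "b ^ i = Suc j" by (metis gr0_implies_Suc)
          moreover then have "real b ^ i = real j + 1" by (metis of_nat_Suc of_nat_power add.commute)
          ultimately show ?thesis using True by (intro exI[of _ j]) simp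
        next
          case False
          define j where "j = nat \<lfloor>real b ^ i * x\<rfloor>"
          have 0: "0 \<le> real b ^ i * x" using x p by simp
          have j: "real j \<le> real b ^ i * x" "real b ^ i * x \<le> real j + 1"
            using 0 unfolding j_def by linarith+
          have "real b ^ i * x < real b ^ i * 1" using False x p by (intro mult_strict_left_mono) auto
          then have "real j < real b ^ i" using j(1) by linarith
          then have "j < b ^ i" by (metis of_nat_less_iff of_nat_power)
          then show ?thesis using j by blast
        qed
        then obtain j where j: "j < b ^ i" "real j \<le> real b ^ i * x" "real b ^ i * x \<le> real j + 1" by blast
        have x1: "real j / real b ^ i \<le> x" "x \<le> (real j + 1) / real b ^ i"
          using j(2,3) p by (simp_all only: pos_divide_le_eq pos_le_divide_eq mult.commute[of x])
        have w: "(real j + 1) / real b ^ i = real j / real b ^ i + 1 / real b ^ i" by (simp add: add_divide_distrib)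
        have j0: "0 \<le> real j / real b ^ i" by simp
        have "{loopL i j..loopR i j} \<subseteq> ball x e \<inter> {0..1}"
        proof
          fix y assume "y \<in> {loopL i j..loopR i j}"
          then have y: "real j / real b ^ i < y" "y < (real j + 1) / real b ^ i" using cell(1)[of j i] cell(2)[of i j] by auto
          have "\<bar>x - y\<bar> < e" using x1 y w be by linarith
          moreover have "0 \<le> y" "y \<le> 1" using y j0 unit[OF j(1)] by linarith+
          ultimately show "y \<in> ball x e \<inter> {0..1}" by (simp add: dist_real_def)
        qed
        moreover have "G (loopL i j) = G (loopR i j)" using G(4) j(1) pattern unfolding ident_def by blast
        ultimately show ?thesis using loopL_less_loopR by blast
      qed
    qed
  qed
  then show ?thesis using G(5) by blast
qed

end

section \<open>Choice of the parameters and conclusion\<close>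

lemma loop_curve_parameters:
  fixes s :: real
  assumes s: "1 < s"
  shows "\<exists>b D. 6 \<le> b \<and> 2 < real b powr (1 - 1 / s) \<and> 0 < D \<and>
    real b * (2 * real b powr (1 / s - 1)) ^ D / (1 - 2 * real b powr (1 / s - 1)) \<le> 1 / 8 \<and>
    (real b powr (- 1 / s)) ^ D / (1 - real b powr (- 1 / s)) \<le> 1 / 8"
proof -
  have e: "0 < 1 - 1 / s" using s by simp
  \<comment> \<open>First \<open>b\<close>, large enough for \<open>2 < b powr (1 - 1 / s)\<close>.
    This fixes the two ratios below 1, and then \<open>D\<close> is taken so large that their powers
    are small.\<close>
  obtain b :: nat where "max 6 (2 powr (1 / (1 - 1 / s))) < real b" using reals_Archimedean2 by blast
  then have b: "6 < real b" "2 powr (1 / (1 - 1 / s)) < real b" by auto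
  have "(2 powr (1 / (1 - 1 / s))) powr (1 - 1 / s) < real b powr (1 - 1 / s)"
    using b(2) e by (intro powr_less_mono2) auto
  moreover have "(2 powr (1 / (1 - 1 / s))) powr (1 - 1 / s) = (2 :: real)"
    using s unfolding powr_powr by simp
  ultimately have b2: "2 < real b powr (1 - 1 / s)" by simp
  define x where "x = 2 * real b powr (1 / s - 1)"
  define y where "y = real b powr (- 1 / s)"
  have "real b powr (1 / s - 1) = inverse (real b powr (1 - 1 / s))" by (simp flip: powr_minus)
  also have "\<dots> < inverse 2" using b2 by (intro less_imp_inverse_less) auto
  finally have x: "0 < x" "x < 1" using b(1) by (auto simp: x_def)
  have "real b powr (- 1 / s) < real b powr 0" using b(1) s by (intro powr_less_mono) auto
  then have y: "0 < y" "y < 1" using b(1) by (auto simp: y_def)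
  obtain D1 where D1: "x ^ D1 < (1 - x) / (8 * real b)" using real_arch_pow_inv[OF _ x(2), of "(1 - x) / (8 * real b)"] x b(1) by auto
  obtain D2 where D2: "y ^ D2 < (1 - y) / 8" using real_arch_pow_inv[OF _ y(2), of "(1 - y) / 8"] y by auto
  define D where "D = Suc (max D1 D2)"
  have "x ^ D \<le> x ^ D1" "y ^ D \<le> y ^ D2" unfolding D_def using x y by (intro power_decreasing; simp)+
  then have xD: "x ^ D \<le> (1 - x) / (8 * real b)" and yD: "y ^ D \<le> (1 - y) / 8" using D1 D2 by linarith+
  have "real b * x ^ D \<le> real b * ((1 - x) / (8 * real b))" using xD by (intro mult_left_mono) auto
  also have "\<dots> = 1 / 8 * (1 - x)" using b(1) by simp
  finally have 1: "real b * x ^ D / (1 - x) \<le> 1 / 8" using x by (simp add: pos_divide_le_eq)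
  have 2: "y ^ D / (1 - y) \<le> 1 / 8" using yD y by (simp add: pos_divide_le_eq)
  have "6 \<le> b" "0 < D" using b(1) by (auto simp: D_def)
  then show ?thesis using b2 1 2 unfolding x_def y_def by blast
qed

theorem theorem1p4:
  fixes s :: real
  assumes "s > 1"
  shows "\<exists>(N::nat) (g :: real \<Rightarrow> (nat \<Rightarrow> real)).
    holderE N (1 / s) g \<and>
    hausdorffE N s (g ` {0..1}) > 0 \<and>
    hausdorffE N s {x \<in> g ` {0..1}. \<not> (\<exists>S \<subseteq> TanE N (g ` {0..1}) x. infinite S \<and>
        (\<forall>T1\<in>S. \<forall>T2\<in>S. T1 \<noteq> T2 \<longrightarrow> \<not> homeomorphicE N T1 N T2))} = 0 \<and>
    hausdorffE N s {x \<in> g ` {0..1}. \<not> (\<exists>T \<in> TanE N (g ` {0..1}) x.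
        \<forall>(n::nat) Q. self_similarE n Q \<and> hdimE n Q = s \<longrightarrow>
          hausdorffE n s {z \<in> Q. \<exists>T' \<in> TanE n Q z. bilip_homeomorphicE N T n T'} = 0)} = 0"
proof -
  obtain b D where par: "6 \<le> b" "2 < real b powr (1 - 1 / s)" "0 < D"
    "real b * (2 * real b powr (1 / s - 1)) ^ D / (1 - 2 * real b powr (1 / s - 1)) \<le> 1 / 8"
    "(real b powr (- 1 / s)) ^ D / (1 - real b powr (- 1 / s)) \<le> 1 / 8"
    using loop_curve_parameters[OF assms] by (elim exE conjE)
  \<comment> \<open>The colouring is a parameter of the curve locale but depends only on
    \<open>rep\<close> and \<open>near_vertices\<close>, so it is obtained in the smaller locale
    first.\<close>
  interpret L: loops b "lamB b" by unfold_locales (rule par(1))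
  obtain col where col: "\<forall>l v. col l v < 64 * b + 1"
    "\<forall>l v w. L.rep l v = L.rep l w \<longrightarrow> col l v = (col l w :: nat)"
    "\<forall>l v w. L.near_vertices l v w \<longrightarrow> L.rep (Suc l) v \<noteq> L.rep (Suc l) w \<longrightarrow> col (Suc l) v \<noteq> col (Suc l) w"
    using L.colouring_exists by (elim exE conjE)
  interpret zoo_curve b s D col
  proof unfold_locales
    show "1 < s" by (rule assms)
    show "2 < real b powr (1 - 1 / s)" by (rule par(2))
    show "0 < D" by (rule par(3))
    show "real b * (2 * real b powr (1 / s - 1)) ^ D / (1 - 2 * real b powr (1 / s - 1)) \<le> 1 / 8" by (rule par(4))
    show "(real b powr (- 1 / s)) ^ D / (1 - real b powr (- 1 / s)) \<le> 1 / 8" by (rule par(5))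
    show "col l v < 64 * b + 1" for l v by (rule col(1)[rule_format])
    show "col l v = col l w" if "L.rep l v = L.rep l w" for l v w by (rule col(2)[rule_format, OF that])
    show "col (Suc l) v \<noteq> col (Suc l) w" if "L.near_vertices l v w" "L.rep (Suc l) v \<noteq> L.rep (Suc l) w" for l v w
      by (rule col(3)[rule_format, OF that])
  qed
  have empty: "hausdorffE n s {} = 0" for n
    unfolding hausdorffE_null_iff by (intro allI impI exI[of _ "\<lambda>_. {}"]) (simp add: diamE_def)
  show ?thesis
  proof (intro exI[of _ dim] exI[of _ curve] conjI)
    show "holderE dim (1 / s) curve" by (rule curve_holderE)
    show "0 < hausdorffE dim s (curve ` {0..1})" by (rule curve_hausdorff_pos)
    show "hausdorffE dim s {x \<in> curve ` {0..1}. \<not> (\<exists>S \<subseteq> TanE dim (curve ` {0..1}) x. infinite S \<and>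
        (\<forall>T1\<in>S. \<forall>T2\<in>S. T1 \<noteq> T2 \<longrightarrow> \<not> homeomorphicE dim T1 dim T2))} = 0"
    proof (rule hausdorffE_null_mono[OF nongeneric_null], rule subsetI)
      fix x assume x: "x \<in> {x \<in> curve ` {0..1}. \<not> (\<exists>S \<subseteq> TanE dim (curve ` {0..1}) x. infinite S \<and>
        (\<forall>T1\<in>S. \<forall>T2\<in>S. T1 \<noteq> T2 \<longrightarrow> \<not> homeomorphicE dim T1 dim T2))}"
      then obtain t where t: "t \<in> {0..1}" "x = curve t" by blast
      have "\<not> generic t" using infinitely_many_tangents[OF _ t(1)] x unfolding t(2) by blast
      then show "x \<in> curve ` {t \<in> {0..1}. \<not> generic t}" using t by blast
    qed
    show "hausdorffE dim s {x \<in> curve ` {0..1}. \<not> (\<exists>T \<in> TanE dim (curve ` {0..1}) x.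
        \<forall>(n::nat) Q. self_similarE n Q \<and> hdimE n Q = s \<longrightarrow>
          hausdorffE n s {z \<in> Q. \<exists>T' \<in> TanE n Q z. bilip_homeomorphicE dim T n T'} = 0)} = 0"
    proof (rule hausdorffE_null_mono[OF nongeneric_null], rule subsetI)
      fix x assume x: "x \<in> {x \<in> curve ` {0..1}. \<not> (\<exists>T \<in> TanE dim (curve ` {0..1}) x.
        \<forall>(n::nat) Q. self_similarE n Q \<and> hdimE n Q = s \<longrightarrow>
          hausdorffE n s {z \<in> Q. \<exists>T' \<in> TanE n Q z. bilip_homeomorphicE dim T n T'} = 0)}"
      then obtain t where t: "t \<in> {0..1}" "x = curve t" by blast
      have "\<not> generic t"
      proof
        assume "generic t"
        then obtain T where T: "T \<in> TanE dim (curve ` {0..1}) (curve t)"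
          "\<forall>n Q z. self_similarE n Q \<longrightarrow> hdimE n Q = s \<longrightarrow> \<not> (\<exists>T' \<in> TanE n Q z. bilip_homeomorphicE dim T n T')"
          using wild_tangent[OF _ t(1)] by blast
        have null: "\<forall>(n::nat) Q. self_similarE n Q \<and> hdimE n Q = s \<longrightarrow>
          hausdorffE n s {z \<in> Q. \<exists>T' \<in> TanE n Q z. bilip_homeomorphicE dim T n T'} = 0"
        proof (intro allI impI)
          fix n Q assume "self_similarE n Q \<and> hdimE n Q = s"
          then have "{z \<in> Q. \<exists>T' \<in> TanE n Q z. bilip_homeomorphicE dim T n T'} = {}" using T(2) by blast
          then show "hausdorffE n s {z \<in> Q. \<exists>T' \<in> TanE n Q z. bilip_homeomorphicE dim T n T'} = 0"
            by (simp only: empty)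
        qed
        show False using CollectD[OF x, THEN conjunct2] by (rule notE) (rule bexI, rule null, rule T(1)[folded t(2)])
      qed
      then show "x \<in> curve ` {t \<in> {0..1}. \<not> generic t}" using t by blast
    qed
  qed
qed

end
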